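(* Let $p$ be a prime. For positive integers $n,m,r$ put $$G(n,m,r)=\langle a,b \mid a^{p^{n}}=1,\ b^{p^{m}}=1,\ [a,b]=a^{p^{r}}\rangle ,$$ and for positive integers $n,m,l,r$ put $$G(n,m,l,r)=\langle a,b \mid a^{p^{n}}=1,\ b^{p^{m}}=a^{p^{l}},\ [a,b]=a^{p^{r}}\rangle .$$ Consider the following two families of groups. (I) The groups $G(n,m,r)$ with $n-r\le m$ and $2\le r\le n-1$. (II) The groups $G(n,m,l,r)$ with $2\le r<l\le n-1$ and $n-r\le l<m$. Then every group $G(n,m,r)$ in (I) and every group $G(n,m,l,r)$ in (II) has order $p^{n+m}$ and is a non-abelian powerfully nilpotent $p$-group of rank $2$; the groups in the list consisting of families (I) and (II) (for different parameter values, and across the two families) are pairwise non-isomorphic; and every non-abelian powerfully nilpotent $p$-group of rank $2$ is isomorphic to exactly one group in this list.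
   Context: All $p$-groups are finite. $[x,y]=x^{-1}y^{-1}xy$. The rank of a $p$-group considered here is its minimal number of generators. For a group $H$ and a positive integer $k$, $H^{k}$ denotes the subgroup generated by all $k$-th powers of elements of $H$. A finite $p$-group $G$ is powerful if $[G,G]\le G^{p}$ when $p$ is odd, and $[G,G]\le G^{4}$ when $p=2$. A powerful $p$-group $G$ is powerfully nilpotent if it has an ascending chain of subgroups $\{1\}=H_{0}\le H_{1}\le\cdots\le H_{n}=G$ such that $[H_{i},G]\le H_{i-1}^{p}$ for $i=1,\ldots,n$. *)

theory Defs
  imports "HOL-Algebra.Generated_Groups" "HOL-Computational_Algebra.Primes"
begin

section \<open>Free groups and groups given by generators and relators\<close>

text \<open>
  A letter is a pair of a generator and an exponent sign (\<^term>\<open>True\<close> for the generator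
  itself, \<^term>\<open>False\<close> for its formal inverse).  The free group on the type \<open>'g\<close> consists of
  the words in these letters modulo free cancellation.
\<close>

type_synonym 'g word = "('g \<times> bool) list"

definition free_cancel :: "('g word \<times> 'g word) set" where
  "free_cancel = {(u @ [(x, s), (x, \<not> s)] @ v, u @ v) | u x s v. True}"

definition free_equiv :: "('g word \<times> 'g word) set" where
  "free_equiv = (free_cancel \<union> free_cancel\<inverse>)\<^sup>*"

definition free_mult :: "'g word set \<Rightarrow> 'g word set \<Rightarrow> 'g word set" where
  "free_mult C D = {w. \<exists>x\<in>C. \<exists>y\<in>D. (x @ y, w) \<in> free_equiv}"

definition free_group :: "'g word set monoid" where
  "free_group =
    \<lparr> carrier = UNIV // free_equiv,
      monoid.mult = free_mult,
      one = free_equiv `` {[]} \<rparr>"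

definition free_gen :: "'g \<Rightarrow> 'g word set" where
  "free_gen x = free_equiv `` {[(x, True)]}"

definition normal_closure :: "('a, 'b) monoid_scheme \<Rightarrow> 'a set \<Rightarrow> 'a set" where
  "normal_closure G R = \<Inter> {N. N \<lhd> G \<and> R \<subseteq> N}"

definition presented_group :: "'g word set set \<Rightarrow> 'g word set set monoid" where
  "presented_group R = free_group Mod (normal_closure free_group R)"


section \<open>Powerful and powerfully nilpotent groups\<close>

definition commutator :: "('a, 'b) monoid_scheme \<Rightarrow> 'a \<Rightarrow> 'a \<Rightarrow> 'a" where
  "commutator G x y = inv\<^bsub>G\<^esub> x \<otimes>\<^bsub>G\<^esub> inv\<^bsub>G\<^esub> y \<otimes>\<^bsub>G\<^esub> x \<otimes>\<^bsub>G\<^esub> y"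

definition commutator_subgroup :: "('a, 'b) monoid_scheme \<Rightarrow> 'a set \<Rightarrow> 'a set \<Rightarrow> 'a set" where
  "commutator_subgroup G H K = generate G {commutator G h k | h k. h \<in> H \<and> k \<in> K}"

definition power_subgroup :: "('a, 'b) monoid_scheme \<Rightarrow> 'a set \<Rightarrow> nat \<Rightarrow> 'a set" where
  "power_subgroup G H k = generate G ((\<lambda>x. x [^]\<^bsub>G\<^esub> k) ` H)"

definition p_group :: "nat \<Rightarrow> ('a, 'b) monoid_scheme \<Rightarrow> bool" where
  "p_group p G \<longleftrightarrow> group G \<and> finite (carrier G) \<and> (\<exists>k::nat. Coset.order G = p ^ k)"

definition powerful :: "nat \<Rightarrow> ('a, 'b) monoid_scheme \<Rightarrow> bool" where
  "powerful p G \<longleftrightarrow> p_group p G \<and>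
     commutator_subgroup G (carrier G) (carrier G)
       \<subseteq> power_subgroup G (carrier G) (if p = 2 then 4 else p)"

definition powerfully_nilpotent :: "nat \<Rightarrow> ('a, 'b) monoid_scheme \<Rightarrow> bool" where
  "powerfully_nilpotent p G \<longleftrightarrow> powerful p G \<and>
     (\<exists>(n::nat) (H :: nat \<Rightarrow> 'a set).
        H 0 = {\<one>\<^bsub>G\<^esub>} \<and> H n = carrier G \<and>
        (\<forall>i\<le>n. subgroup (H i) G) \<and>
        (\<forall>i\<in>{1..n}. H (i - 1) \<subseteq> H i) \<and>
        (\<forall>i\<in>{1..n}. commutator_subgroup G (H i) (carrier G) \<subseteq> power_subgroup G (H (i - 1)) p))"

definition group_rank :: "('a, 'b) monoid_scheme \<Rightarrow> nat" where
  "group_rank G =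
     (LEAST k. \<exists>S. S \<subseteq> carrier G \<and> finite S \<and> card S = k \<and> generate G S = carrier G)"


section \<open>The two families\<close>

datatype gen = gen_a | gen_b

type_synonym two_gen_group = "gen word set set monoid"

abbreviation fa :: "gen word set" where "fa \<equiv> free_gen gen_a"
abbreviation fb :: "gen word set" where "fb \<equiv> free_gen gen_b"

text \<open>A relation \<open>u = v\<close> is represented by the relator \<open>u v\<^sup>-\<^sup>1\<close>.\<close>

definition relator :: "gen word set \<Rightarrow> gen word set \<Rightarrow> gen word set" where
  "relator u v = u \<otimes>\<^bsub>free_group\<^esub> inv\<^bsub>free_group\<^esub> v"

definition group_I :: "nat \<Rightarrow> nat \<Rightarrow> nat \<Rightarrow> nat \<Rightarrow> two_gen_group" where
  "group_I p n m r = presented_group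
     { relator (fa [^]\<^bsub>free_group\<^esub> (p ^ n)) \<one>\<^bsub>free_group\<^esub>,
       relator (fb [^]\<^bsub>free_group\<^esub> (p ^ m)) \<one>\<^bsub>free_group\<^esub>,
       relator (commutator free_group fa fb) (fa [^]\<^bsub>free_group\<^esub> (p ^ r)) }"

definition group_II :: "nat \<Rightarrow> nat \<Rightarrow> nat \<Rightarrow> nat \<Rightarrow> nat \<Rightarrow> two_gen_group" where
  "group_II p n m l r = presented_group
     { relator (fa [^]\<^bsub>free_group\<^esub> (p ^ n)) \<one>\<^bsub>free_group\<^esub>,
       relator (fb [^]\<^bsub>free_group\<^esub> (p ^ m)) (fa [^]\<^bsub>free_group\<^esub> (p ^ l)),
       relator (commutator free_group fa fb) (fa [^]\<^bsub>free_group\<^esub> (p ^ r)) }"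

datatype params = Fam_I nat nat nat | Fam_II nat nat nat nat

text \<open>
  No truncation occurs in the subtractions below: \<open>2 \<le> r \<le> n - 1\<close>, respectively
  \<open>2 \<le> r < l \<le> n - 1\<close>, forces \<open>r < n\<close>.
\<close>

definition param_list :: "params set" where
  "param_list =
     {Fam_I n m r | n m r. 0 < n \<and> 0 < m \<and> 0 < r \<and>
        n - r \<le> m \<and> 2 \<le> r \<and> r \<le> n - 1} \<union>
     {Fam_II n m l r | n m l r. 0 < n \<and> 0 < m \<and> 0 < l \<and> 0 < r \<and>
        2 \<le> r \<and> r < l \<and> l \<le> n - 1 \<and> n - r \<le> l \<and> l < m}"

fun listed_group :: "nat \<Rightarrow> params \<Rightarrow> two_gen_group" where
  "listed_group p (Fam_I n m r) = group_I p n m r"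
| "listed_group p (Fam_II n m l r) = group_II p n m l r"

fun listed_order :: "nat \<Rightarrow> params \<Rightarrow> nat" where
  "listed_order p (Fam_I n m r) = p ^ (n + m)"
| "listed_order p (Fam_II n m l r) = p ^ (n + m)"


section \<open>Well-formedness of the constructions\<close>

lemma equiv_free_equiv: "equiv UNIV (free_equiv :: ('g word \<times> 'g word) set)"
proof -
  have "sym (free_cancel \<union> free_cancel\<inverse> :: ('g word \<times> 'g word) set)"
    by (auto simp: sym_def)
  then show ?thesis
    unfolding free_equiv_def by (intro equivI) (auto simp: sym_rtrancl refl_rtrancl trans_rtrancl)
qed

lemma free_cancel_context:
  assumes "(x, y) \<in> free_cancel" shows "(u @ x @ v, u @ y @ v) \<in> free_cancel"
proof -
  from assms obtain u' g s v' where "x = u' @ [(g, s), (g, \<not> s)] @ v'" "y = u' @ v'"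
    by (auto simp: free_cancel_def)
  then have "u @ x @ v = (u @ u') @ [(g, s), (g, \<not> s)] @ (v' @ v)" "u @ y @ v = (u @ u') @ (v' @ v)"
    by auto
  then show ?thesis unfolding free_cancel_def by blast
qed

lemma free_equiv_context:
  assumes "(x, y) \<in> free_equiv" shows "(u @ x @ v, u @ y @ v) \<in> free_equiv"
  using assms unfolding free_equiv_def
proof (induction rule: rtrancl_induct)
  case (step y z)
  then have "(u @ y @ v, u @ z @ v) \<in> free_cancel \<union> free_cancel\<inverse>"
    using free_cancel_context by blast
  with step.IH show ?case by (rule rtrancl_into_rtrancl)
qed simp

lemma free_equiv_append:
  assumes "(x, x') \<in> free_equiv" "(y, y') \<in> free_equiv"
  shows "(x @ y, x' @ y') \<in> free_equiv"
  using free_equiv_context[OF assms(1), of "[]" y] free_equiv_context[OF assms(2), of x' "[]"]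
  by (auto simp: free_equiv_def)

lemma free_mult_class:
  "free_equiv `` {x} \<otimes>\<^bsub>free_group\<^esub> free_equiv `` {y} = free_equiv `` {x @ y}"
proof -
  have "(x @ y, w) \<in> free_equiv"
    if "(x, x') \<in> free_equiv" "(y, y') \<in> free_equiv" "(x' @ y', w) \<in> free_equiv" for x' y' w
    using free_equiv_append[OF that(1,2)] that(3) unfolding free_equiv_def by (rule rtrancl_trans)
  moreover have "(x, x) \<in> free_equiv" "(y, y) \<in> free_equiv"
    by (auto simp: free_equiv_def)
  ultimately have "free_mult (free_equiv `` {x}) (free_equiv `` {y}) = free_equiv `` {x @ y}"
    unfolding free_mult_def by blast
  then show ?thesis by (simp add: free_group_def)
qed

lemma free_inverse_word:
  "(rev (map (\<lambda>(g, s). (g, \<not> s)) w) @ w, []) \<in> free_equiv"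
proof (induction w)
  case (Cons c w)
  obtain g s where c: "c = (g, s)" by force
  let ?w' = "rev (map (\<lambda>(g, s). (g, \<not> s)) w)"
  have "(?w' @ [(g, \<not> s), (g, \<not> \<not> s)] @ w, ?w' @ w) \<in> free_cancel"
    unfolding free_cancel_def by blast
  then have "(?w' @ [(g, \<not> s), (g, s)] @ w, ?w' @ w) \<in> free_equiv"
    unfolding free_equiv_def by auto
  with Cons.IH have "(?w' @ [(g, \<not> s), (g, s)] @ w, []) \<in> free_equiv"
    unfolding free_equiv_def by (rule rtrancl_trans[rotated])
  then show ?case by (simp add: c)
qed (simp add: free_equiv_def)

lemma free_group_is_group: "group (free_group :: 'g word set monoid)"
proof (rule groupI)
  have car: "\<exists>w. C = free_equiv `` {w}" if "C \<in> carrier free_group" for C :: "'g word set"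
    using that by (auto simp: free_group_def elim: quotientE)
  have cls: "free_equiv `` {w} \<in> carrier free_group" for w :: "'g word"
    by (simp add: free_group_def quotientI)
  have one: "\<one>\<^bsub>free_group\<^esub> = free_equiv `` {[] :: 'g word}"
    by (simp add: free_group_def)
  show "\<one>\<^bsub>free_group\<^esub> \<in> carrier (free_group :: 'g word set monoid)"
    by (simp only: one cls)
  fix C :: "'g word set" assume C: "C \<in> carrier free_group"
  then obtain x where x: "C = free_equiv `` {x}" using car by blast
  show "\<one>\<^bsub>free_group\<^esub> \<otimes>\<^bsub>free_group\<^esub> C = C"
    unfolding one x free_mult_class by simp
  show "\<exists>D\<in>carrier free_group. D \<otimes>\<^bsub>free_group\<^esub> C = \<one>\<^bsub>free_group\<^esub>"
  proof (rule bexI[OF _ cls])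
    show "free_equiv `` {rev (map (\<lambda>(g, s). (g, \<not> s)) x)} \<otimes>\<^bsub>free_group\<^esub> C = \<one>\<^bsub>free_group\<^esub>"
      unfolding one x free_mult_class by (rule equiv_class_eq[OF equiv_free_equiv free_inverse_word])
  qed
  fix D :: "'g word set" assume D: "D \<in> carrier free_group"
  then obtain y where y: "D = free_equiv `` {y}" using car by blast
  show "C \<otimes>\<^bsub>free_group\<^esub> D \<in> carrier free_group"
    by (simp only: x y free_mult_class cls)
  fix E :: "'g word set" assume E: "E \<in> carrier free_group"
  then obtain z where z: "E = free_equiv `` {z}" using car by blast
  show "C \<otimes>\<^bsub>free_group\<^esub> D \<otimes>\<^bsub>free_group\<^esub> E = C \<otimes>\<^bsub>free_group\<^esub> (D \<otimes>\<^bsub>free_group\<^esub> E)"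
    unfolding x y z free_mult_class by simp
qed

lemma free_gen_closed: "free_gen x \<in> carrier free_group"
  by (simp add: free_gen_def free_group_def quotientI)

lemma (in group) normal_closure_normal:
  assumes "R \<subseteq> carrier G" shows "normal_closure G R \<lhd> G"
proof -
  let ?A = "{N. N \<lhd> G \<and> R \<subseteq> N}"
  have car: "carrier G \<in> ?A"
    using assms by (auto simp: normal_inv_iff subgroup_self)
  have "subgroup (\<Inter>?A) G"
    using car by (intro subgroups_Inter) (auto simp: normal_imp_subgroup)
  then show ?thesis
    unfolding normal_closure_def normal_inv_iff by (auto simp: normal_inv_iff)
qed

lemma presented_group_is_group:
  assumes "R \<subseteq> carrier free_group" shows "group (presented_group R)"
  unfolding presented_group_def
  by (rule normal.factorgroup_is_group[OF group.normal_closure_normal[OF free_group_is_group assms]])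

end

theory Submission
  imports Defs "HOL-Algebra.Multiplicative_Group" "HOL-Number_Theory.Cong"
begin

text \<open>
  Let \<open>G\<close> be a powerfully nilpotent \<open>p\<close>-group with two generators and \<open>F = G\<^sup>p\<close>.  The first term of
  the defining chain that is not contained in \<open>F\<close> provides a generator that is central modulo
  \<open>F\<^sup>p\<close>, so \<open>[G, G] \<le> F\<^sup>p\<close>.  Going down a central series of \<open>G\<close>, this yields
  generators \<open>g\<close>, \<open>h\<close> for which \<open>[g, h]\<close> is a power of the \<open>p\<^sup>2\<close>-th power of \<open>g\<close>: if this holds only up
  to a central element of order \<open>p\<close>, then \<open>[g, h]\<close>, being an element of \<open>F\<^sup>p\<close>, is a power of
  the \<open>p\<^sup>2\<close>-th power of a new generator \<open>h\<^sup>j g\<^sup>i\<close>.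
  Hence \<open>G\<close> is metacyclic, and since all conjugation exponents are \<open>1\<close> modulo \<open>p\<^sup>2\<close>, geometric sums in them
  have the same \<open>p\<close>-adic valuation as their number of terms.  This allows one to normalise
  \<open>[a, b]\<close> and \<open>b\<^sup>j\<close>, to split the extension when \<open>m \<le> l\<close>, and, when \<open>l \<le> r\<close> and \<open>l < m\<close>, to exchange the
  roles of \<open>a\<close> and \<open>b\<close> first.

  The parameters are recovered from \<open>|G|\<close>, \<open>|[G, G]|\<close> and the exponents of \<open>G\<close> and
  \<open>G / [G, G]\<close>.
\<close>


section \<open>Geometric sums modulo prime powers\<close>

text \<open>The modulus \<open>p^2\<close> makes the valuation statement hold for all primes: for
  \<open>p = 2\<close> the exponent \<open>q = 3\<close> is 1 modulo \<open>p\<close>, but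
  \<open>geo 3 2 = 4\<close> has one factor 2 too many. Such sums enter as the exponent of
  \<open>a\<close> in powers of \<open>b a^i\<close> and through
  \<open>q^d = 1 + (q - 1) * geo q d\<close>.

  Relators bound a presented group only from above, by counting the normal forms
  \<open>b^j a^i\<close>. An explicit group on pairs of exponents shows that the bound is attained.
  After that, any group that is generated by two elements satisfying the relations and has the right
  order is the presented group, so classifying an abstract group means choosing generators and
  counting.

  Family (I) is treated as the case \<open>l = n\<close> of the relation
  \<open>b^(p^m) = a^(p^l)\<close>, whose right side is then trivial.

  Exchanging \<open>a\<close> and \<open>b\<close> does not loop: it happens when \<open>b\<close>
  has larger order than \<open>a\<close>, and the new pair then satisfies \<open>m' < l'\<close>, so
  its extension splits.

  For uniqueness, order and abelianisation determine \<open>r\<close> and \<open>m\<close> only as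
  an unordered pair; the exponent of the group decides which is which.\<close>

definition geo :: "nat \<Rightarrow> nat \<Rightarrow> nat" where
  "geo q d = (\<Sum>k<d. q ^ k)"

lemma geo_simps [simp]: "geo q 0 = 0" "geo q (Suc d) = geo q d + q ^ d"
  by (simp_all add: geo_def)

lemma geo_one [simp]: "geo 1 d = d" "geo (Suc 0) d = d"
  by (simp_all add: geo_def)

lemma geo_add: "geo q (d + e) = geo q d + q ^ d * geo q e"
  by (induction e) (simp_all add: algebra_simps power_add)

lemma geo_mult: "geo q (d * e) = geo q d * geo (q ^ d) e"
proof (induction e)
  case (Suc e)
  have "geo q (d * Suc e) = geo q (d * e) + q ^ (d * e) * geo q d"
    using geo_add[of q "d * e" d] by (simp add: add.commute)
  with Suc show ?case by (simp add: power_mult algebra_simps)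
qed simp

lemma geo_cong:
  assumes "[q = q'] (mod k)" shows "[geo q d = geo q' d] (mod k)"
  unfolding geo_def by (intro cong_sum cong_pow assms)

lemma power_eq_geo: "(1 + x) ^ d = 1 + x * geo (1 + x) d" for x :: nat
  by (induction d) (simp_all add: algebra_simps)

context
  fixes p :: nat
  assumes prime_p: "Factorial_Ring.prime p"
begin

lemma cong_one_p:
  assumes "[q = 1] (mod p ^ 2)" shows "[q = 1] (mod p)"
  by (rule cong_dvd_modulus_nat[OF assms]) simp

text \<open>By \<open>geo_mult\<close>, one more factor \<open>p\<close> in the number of terms
  multiplies the sum by a sum of \<open>p\<close> terms that are all 1 modulo \<open>p\<close>. A
  lower bound for the valuation thus follows from a congruence modulo \<open>p\<close>.\<close>

lemma dvd_geo_prime_power: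
  assumes "[q = 1] (mod p)" shows "p ^ t dvd geo q (p ^ t)"
proof (induction t)
  case (Suc t)
  have "[q ^ (p ^ t) = 1] (mod p)"
    using cong_pow[OF assms, of "p ^ t"] by simp
  then have "[geo (q ^ (p ^ t)) p = geo 1 p] (mod p)"
    by (rule geo_cong)
  then have "p dvd geo (q ^ (p ^ t)) p"
    by (simp add: cong_def mod_eq_0_iff_dvd)
  with Suc have "p ^ t * p dvd geo q (p ^ t) * geo (q ^ (p ^ t)) p"
    by (rule mult_dvd_mono)
  then show ?case by (simp add: geo_mult[symmetric] mult.commute)
qed simp

lemma geo_prime_power:
  assumes "[q = 1] (mod p ^ 2)"
  obtains u where "geo q (p ^ t) = p ^ t * u" "[u = 1] (mod p)"
proof -
  have "\<exists>u. geo q (p ^ t) = p ^ t * u \<and> [u = 1] (mod p)"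
  proof (induction t)
    case 0
    show ?case by (intro exI[of _ 1]) simp
  next
    case (Suc t)
    then obtain u where u: "geo q (p ^ t) = p ^ t * u" "[u = 1] (mod p)" by blast
    have "[q ^ (p ^ t) = 1] (mod p ^ 2)"
      using cong_pow[OF assms, of "p ^ t"] by simp
    \<comment> \<open>Working modulo \<open>p^2\<close> leaves a congruence modulo \<open>p\<close>
      after the factor \<open>p\<close> is cancelled; this is what makes the cofactor a
      unit.\<close>
    then have c: "[geo (q ^ (p ^ t)) p = p] (mod p ^ 2)"
      using geo_cong[of _ 1 _ p] by simp
    then have "[geo (q ^ (p ^ t)) p = p] (mod p)"
      by (rule cong_dvd_modulus_nat) simp
    then have "p dvd geo (q ^ (p ^ t)) p"
      by (simp add: cong_def mod_eq_0_iff_dvd)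
    then obtain v where v: "geo (q ^ (p ^ t)) p = p * v" by blast
    have "[p * v = p * 1] (mod p * p)"
      using c v by (simp add: power2_eq_square)
    then have "[v = 1] (mod p)"
      using prime_gt_0_nat[OF prime_p] by (simp add: cong_def mod_mult_mult1 del: mult_1_right)
    with u have "[u * v = 1] (mod p)"
      using cong_mult by fastforce
    moreover have "geo q (p ^ Suc t) = p ^ Suc t * (u * v)"
      using geo_mult[of q "p ^ t" p] u v by (simp add: mult_ac)
    ultimately show ?case by blast
  qed
  then show ?thesis using that by blast
qed

lemma not_dvd_cong_one:
  assumes "[u = 1] (mod p)" shows "\<not> p dvd u"
proof
  assume "p dvd u"
  then have "p dvd 1" using assms cong_dvd_iff by blast
  then show False using prime_p not_prime_unit by blast
qed

lemma prime_power_dvd_times_iff: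
  assumes "\<not> p dvd w" shows "p ^ t dvd p ^ s * w \<longleftrightarrow> t \<le> s"
proof -
  have "coprime (p ^ t) w"
    using assms prime_p prime_imp_coprime by (simp add: prime_imp_coprime)
  then have "p ^ t dvd p ^ s * w \<longleftrightarrow> p ^ t dvd p ^ s"
    by (simp add: coprime_dvd_mult_left_iff)
  then show ?thesis
    using prime_gt_1_nat[OF prime_p] by (simp add: dvd_power_iff_le)
qed

lemma coprime_power_iff: "coprime u (p ^ t) \<longleftrightarrow> \<not> p dvd u \<or> t = 0"
proof -
  have "coprime u p \<longleftrightarrow> \<not> p dvd u"
    using prime_p prime_imp_coprime[of p u] by (metis coprime_absorb_right coprime_commute not_prime_unit)
  then show ?thesis by (simp add: coprime_power_right_iff disj_commute)
qed

lemma geo_cong_p: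
  assumes "[q = 1] (mod p)" shows "[geo q d = d] (mod p)"
  using geo_cong[OF assms] by simp

text \<open>For \<open>d = p^s * v\<close> with \<open>v\<close> prime to \<open>p\<close>,
  \<open>geo_mult\<close> splits the sum into \<open>geo q (p^s)\<close>, of valuation exactly
  \<open>s\<close>, and a sum of \<open>v\<close> terms, which is \<open>v\<close> modulo
  \<open>p\<close> and hence a unit.\<close>

lemma prime_power_dvd_geo_iff:
  assumes q: "[q = 1] (mod p ^ 2)"
  shows "p ^ t dvd geo q d \<longleftrightarrow> p ^ t dvd d"
proof (cases "d = 0")
  case False
  then obtain s v where d: "d = p ^ s * v" and v: "\<not> p dvd v"
    using multiplicity_decompose'[of d p] prime_p not_prime_unit by metis
  obtain u where u: "geo q (p ^ s) = p ^ s * u" "[u = 1] (mod p)"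
    using geo_prime_power[OF q] by blast
  have "[q ^ (p ^ s) = 1] (mod p)"
    using cong_pow[OF cong_one_p[OF q], of "p ^ s"] by simp
  from geo_cong_p[OF this] have "\<not> p dvd geo (q ^ (p ^ s)) v"
    using v cong_dvd_iff by blast
  with not_dvd_cong_one[OF u(2)] have w: "\<not> p dvd u * geo (q ^ (p ^ s)) v"
    using prime_p prime_dvd_mult_iff by blast
  have "geo q d = p ^ s * (u * geo (q ^ (p ^ s)) v)"
    using geo_mult[of q "p ^ s" v] u(1) by (simp add: d mult.assoc)
  then have "p ^ t dvd geo q d \<longleftrightarrow> t \<le> s"
    using prime_power_dvd_times_iff[OF w] by simp
  then show ?thesis
    using prime_power_dvd_times_iff[OF v, of t s] by (simp add: d)
qed simp

text \<open>Two values differ by \<open>q^i * geo q (j - i)\<close>, which has the valuation of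
  \<open>j - i\<close>. So the values at \<open>k < p^N\<close> are distinct modulo
  \<open>p^N\<close> and exhaust the residues. This later selects the power of \<open>b\<close> that
  turns the commutator into \<open>a^(p^r)\<close>.\<close>

lemma geo_surj_mod:
  assumes q: "[q = 1] (mod p ^ 2)"
  obtains k where "[geo q k = c] (mod p ^ N)"
proof -
  have pos: "0 < p ^ N" using prime_gt_0_nat[OF prime_p] by simp
  let ?f = "\<lambda>k. geo q k mod p ^ N"
  have le: "i = j" if "i \<le> j" "j < p ^ N" "?f i = ?f j" for i j
  proof -
    have eq: "geo q j = geo q i + q ^ i * geo q (j - i)"
      using geo_add[of q i "j - i"] that by simp
    have "[geo q i + q ^ i * geo q (j - i) = geo q i + 0] (mod p ^ N)"
      using that(3) unfolding eq by (simp add: cong_def)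
    then have "p ^ N dvd q ^ i * geo q (j - i)"
      by (metis cong_0_iff cong_add_lcancel_nat)
    moreover have "coprime (p ^ N) (q ^ i)"
      using not_dvd_cong_one[OF cong_one_p[OF q]] coprime_power_iff[of q N]
      by (metis coprime_commute coprime_power_right_iff)
    ultimately have "p ^ N dvd geo q (j - i)"
      by (simp add: coprime_dvd_mult_right_iff)
    then have "p ^ N dvd j - i"
      using prime_power_dvd_geo_iff[OF q] by blast
    then have "j - i = 0"
      using that(2) by (meson dvd_imp_le leD le_less_trans diff_le_self not_gr_zero)
    then show ?thesis using that(1) by simp
  qed
  have "inj_on ?f {..<p ^ N}"
  proof (rule inj_onI)
    fix i j assume "i \<in> {..<p ^ N}" "j \<in> {..<p ^ N}" "?f i = ?f j"
    then show "i = j" using le[of i j] le[of j i] by (cases "i \<le> j") auto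
  qed
  then have "?f ` {..<p ^ N} = {..<p ^ N}"
    by (intro endo_inj_surj) (use pos in auto)
  then have "c mod p ^ N \<in> ?f ` {..<p ^ N}"
    using pos by auto
  then show ?thesis using that by (auto simp: cong_def)
qed

lemma inverse_mod_prime_power:
  assumes "\<not> p dvd u"
  obtains v where "[u * v = 1] (mod p ^ N)" "\<not> p dvd v"
proof -
  \<comment> \<open>With \<open>Suc N\<close> the congruence also holds modulo \<open>p\<close> when
    \<open>N = 0\<close>, so that \<open>v\<close> is prime to \<open>p\<close> in every
    case.\<close>
  have "coprime u (p ^ Suc N)"
    using assms coprime_power_iff by blast
  then obtain v where v: "[u * v = 1] (mod p ^ Suc N)"
    using cong_solve_coprime_nat by (metis One_nat_def)
  then have "[u * v = 1] (mod p ^ N)" "[u * v = 1] (mod p)"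
    by (auto intro: cong_dvd_modulus_nat)
  moreover from this(2) have "\<not> p dvd v"
    using not_dvd_cong_one[of "u * v"] by auto
  ultimately show ?thesis using that by blast
qed

end


section \<open>Universal properties of free and presented groups\<close>

definition word_eval :: "('a, 'b) monoid_scheme \<Rightarrow> ('g \<Rightarrow> 'a) \<Rightarrow> 'g word \<Rightarrow> 'a" where
  "word_eval H f w =
     foldr (\<lambda>(x, s) y. (if s then f x else inv\<^bsub>H\<^esub> f x) \<otimes>\<^bsub>H\<^esub> y) w \<one>\<^bsub>H\<^esub>"

text \<open>The choice of a representative does not matter, by
  \<open>word_eval_free_equiv\<close>.\<close>

definition free_extension :: "('a, 'b) monoid_scheme \<Rightarrow> ('g \<Rightarrow> 'a) \<Rightarrow> 'g word set \<Rightarrow> 'a" where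
  "free_extension H f C = word_eval H f (SOME w. w \<in> C)"

lemma carrier_free_group: "carrier free_group = range (\<lambda>w. free_equiv `` {w})"
  by (auto simp: free_group_def quotient_def)

lemma one_free_group: "\<one>\<^bsub>free_group\<^esub> = free_equiv `` {[]}"
  by (simp add: free_group_def)

context group
begin

context
  fixes f :: "'g \<Rightarrow> 'a"
  assumes f: "range f \<subseteq> carrier G"
begin

lemma assignment_closed [simp]: "f x \<in> carrier G"
  using f by auto

lemma word_eval_Nil [simp]: "word_eval G f [] = \<one>"
  by (simp add: word_eval_def)

lemma word_eval_Cons [simp]:
  "word_eval G f ((x, s) # w) = (if s then f x else inv f x) \<otimes> word_eval G f w"
  by (simp add: word_eval_def)

lemma word_eval_closed [simp]: "word_eval G f w \<in> carrier G"
  by (induction w) auto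

lemma word_eval_append: "word_eval G f (v @ w) = word_eval G f v \<otimes> word_eval G f w"
  by (induction v) (auto simp: m_assoc)

lemma word_eval_free_cancel:
  assumes "(v, w) \<in> free_cancel" shows "word_eval G f v = word_eval G f w"
proof -
  from assms obtain u x s t where "v = u @ [(x, s), (x, \<not> s)] @ t" "w = u @ t"
    by (auto simp: free_cancel_def)
  then show ?thesis
    by (cases s) (simp_all add: word_eval_append m_assoc[symmetric])
qed

lemma word_eval_free_equiv:
  assumes "(v, w) \<in> free_equiv" shows "word_eval G f v = word_eval G f w"
  using assms unfolding free_equiv_def
  by (induction rule: rtrancl_induct) (auto dest: word_eval_free_cancel)

lemma free_extension_class [simp]: "free_extension G f (free_equiv `` {w}) = word_eval G f w"
proof -
  have "w \<in> free_equiv `` {w}" by (simp add: free_equiv_def)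
  then have "(SOME v. v \<in> free_equiv `` {w}) \<in> free_equiv `` {w}" by (rule someI)
  then show ?thesis
    by (auto simp: free_extension_def dest: word_eval_free_equiv)
qed

lemma free_extension_gen [simp]: "free_extension G f (free_gen x) = f x"
  by (simp add: free_gen_def)

lemma free_extension_hom: "free_extension G f \<in> hom free_group G"
  by (rule homI) (auto simp: carrier_free_group free_mult_class word_eval_append)

end

text \<open>The kernel of the extension is normal and contains \<open>R\<close>, hence contains the
  normal closure, so the extension is constant on its cosets.\<close>

lemma presented_group_universal:
  fixes f :: "'g \<Rightarrow> 'a"
  assumes f: "range f \<subseteq> carrier G" and R: "R \<subseteq> carrier free_group"
    and one: "\<And>u. u \<in> R \<Longrightarrow> free_extension G f u = \<one>"
  obtains \<phi> where "\<phi> \<in> hom (presented_group R) G"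
    "\<And>x. \<phi> (normal_closure free_group R #>\<^bsub>free_group\<^esub> free_gen x) = f x"
proof -
  interpret F: group "free_group :: 'g word set monoid" by (rule free_group_is_group)
  interpret h: group_hom free_group G "free_extension G f"
    using free_extension_hom[OF f] F.group_axioms group_axioms
    by (simp add: group_hom_def group_hom_axioms_def)
  let ?N = "normal_closure free_group R"
  interpret N: normal ?N free_group
    by (rule F.normal_closure_normal[OF R])
  have "R \<subseteq> kernel free_group G (free_extension G f)"
    using R one by (auto simp: kernel_def)
  then have N_ker: "?N \<subseteq> kernel free_group G (free_extension G f)"
    unfolding normal_closure_def using h.normal_kernel by blast
  have eq: "free_extension G f x = free_extension G f y"
    if x: "x \<in> carrier free_group" and y: "y \<in> carrier free_group"
      and "?N #>\<^bsub>free_group\<^esub> x = ?N #>\<^bsub>free_group\<^esub> y" for x y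
  proof -
    have "x \<in> ?N #>\<^bsub>free_group\<^esub> y"
      using that F.rcos_self[OF x N.subgroup_axioms] by simp
    then obtain n where "n \<in> ?N" "x = n \<otimes>\<^bsub>free_group\<^esub> y"
      by (auto simp: r_coset_def)
    then show ?thesis
      using N_ker y by (auto simp: kernel_def)
  qed
  obtain \<phi> where "\<phi> \<in> hom (free_group Mod ?N) G"
    "\<And>x. x \<in> carrier free_group \<Longrightarrow> \<phi> (?N #>\<^bsub>free_group\<^esub> x) = free_extension G f x"
    using FactGroup_universal[OF free_extension_hom[OF f] N.normal_axioms eq] by blast
  with that show ?thesis
    by (simp add: presented_group_def free_gen_closed f)
qed

end

lemma free_group_generated:
  "generate (free_group :: 'g word set monoid) (range free_gen) = carrier free_group"
proof -
  interpret F: group "free_group :: 'g word set monoid" by (rule free_group_is_group)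
  have gens: "range free_gen \<subseteq> carrier (free_group :: 'g word set monoid)"
    by (simp add: image_subset_iff free_gen_closed)
  have "free_equiv `` {w} \<in> generate free_group (range free_gen)" for w :: "'g word"
  proof (induction w)
    case Nil
    show ?case by (simp add: generate.one flip: one_free_group)
  next
    case (Cons c w)
    obtain x s where c: "c = (x, s)" by force
    have pos: "free_equiv `` {[(x, True)]} \<in> generate free_group (range free_gen)"
      by (rule generate.incl) (auto simp: free_gen_def)
    have "([(x, False), (x, \<not> False)] , []) \<in> free_equiv"
      unfolding free_equiv_def free_cancel_def by (rule r_into_rtrancl) force
    then have "free_equiv `` {[(x, False), (x, True)]} = free_equiv `` {[]}"
      using equiv_class_eq[OF equiv_free_equiv] by fastforce
    then have "free_equiv `` {[(x, False)]} \<otimes>\<^bsub>free_group\<^esub> free_gen x = \<one>\<^bsub>free_group\<^esub>"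
      by (simp add: free_gen_def free_mult_class one_free_group)
    then have "inv\<^bsub>free_group\<^esub> free_gen x = free_equiv `` {[(x, False)]}"
      by (rule F.inv_equality) (simp_all add: free_gen_closed, simp add: carrier_free_group)
    then have neg: "free_equiv `` {[(x, False)]} \<in> generate free_group (range free_gen)"
      using generate.inv[of "free_gen x" "range free_gen" free_group] by simp
    have "free_equiv `` {[(x, s)]} \<otimes>\<^bsub>free_group\<^esub> free_equiv `` {w}
        \<in> generate free_group (range free_gen)"
      using pos neg by (cases s) (auto intro: generate.eng Cons.IH)
    then show ?case by (simp add: c free_mult_class)
  qed
  then show ?thesis
    using F.generate_incl[OF gens] by (auto simp: carrier_free_group)
qed

text \<open>
  The common shape of both families: \<open>k = 0\<close> gives \<open>b\<^sup>y = 1\<close>.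
\<close>

definition two_gen_relators :: "nat \<Rightarrow> nat \<Rightarrow> nat \<Rightarrow> nat \<Rightarrow> gen word set set" where
  "two_gen_relators x y k z =
     { relator (fa [^]\<^bsub>free_group\<^esub> x) \<one>\<^bsub>free_group\<^esub>,
       relator (fb [^]\<^bsub>free_group\<^esub> y) (fa [^]\<^bsub>free_group\<^esub> k),
       relator (commutator free_group fa fb) (fa [^]\<^bsub>free_group\<^esub> z) }"

lemma two_gen_relators_cases:
  assumes "u \<in> two_gen_relators x y k z"
  obtains "u = relator (fa [^]\<^bsub>free_group\<^esub> x) \<one>\<^bsub>free_group\<^esub>"
  | "u = relator (fb [^]\<^bsub>free_group\<^esub> y) (fa [^]\<^bsub>free_group\<^esub> k)"
  | "u = relator (commutator free_group fa fb) (fa [^]\<^bsub>free_group\<^esub> z)"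
  using assms by (auto simp: two_gen_relators_def)

lemma group_I_presentation:
  "group_I p n m r = presented_group (two_gen_relators (p ^ n) (p ^ m) 0 (p ^ r))"
  by (simp add: group_I_def two_gen_relators_def)

lemma group_II_presentation:
  "group_II p n m l r = presented_group (two_gen_relators (p ^ n) (p ^ m) (p ^ l) (p ^ r))"
  by (simp add: group_II_def two_gen_relators_def)

text \<open>The relation \<open>[a, b] = a\<^sup>z\<close> in the form in which it moves powers of \<open>a\<close> to the right.\<close>

definition satisfies_relations ::
    "('a, 'b) monoid_scheme \<Rightarrow> 'a \<Rightarrow> 'a \<Rightarrow> nat \<Rightarrow> nat \<Rightarrow> nat \<Rightarrow> nat \<Rightarrow> bool" where
  "satisfies_relations G a b x y k z \<longleftrightarrow> a \<in> carrier G \<and> b \<in> carrier G \<and>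
     a [^]\<^bsub>G\<^esub> x = \<one>\<^bsub>G\<^esub> \<and> b [^]\<^bsub>G\<^esub> y = a [^]\<^bsub>G\<^esub> k \<and>
     a \<otimes>\<^bsub>G\<^esub> b = b \<otimes>\<^bsub>G\<^esub> a [^]\<^bsub>G\<^esub> (1 + z)"

lemma (in group) commutator_closed [simp]:
  "x \<in> carrier G \<Longrightarrow> y \<in> carrier G \<Longrightarrow> commutator G x y \<in> carrier G"
  by (simp add: commutator_def)

lemma (in group) commutator_eq_iff:
  assumes "x \<in> carrier G" "y \<in> carrier G" "c \<in> carrier G"
  shows "commutator G x y = c \<longleftrightarrow> x \<otimes> y = y \<otimes> (x \<otimes> c)"
proof -
  have "commutator G x y = inv (y \<otimes> x) \<otimes> (x \<otimes> y)"
    using assms by (simp add: commutator_def inv_mult_group m_assoc)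
  then show ?thesis
    using assms inv_solve_left'[of c "y \<otimes> x" "x \<otimes> y"] by (auto simp: m_assoc)
qed

lemma (in group) relation_iff_commutator:
  assumes "a \<in> carrier G" "b \<in> carrier G"
  shows "a \<otimes> b = b \<otimes> a [^] (1 + z :: nat) \<longleftrightarrow> commutator G a b = a [^] z"
  using assms nat_pow_Suc2[of a z] by (simp add: commutator_eq_iff)

lemma (in group) satisfies_relations_iff_commutator:
  "satisfies_relations G a b x y k z \<longleftrightarrow> a \<in> carrier G \<and> b \<in> carrier G \<and>
     a [^] x = \<one> \<and> b [^] y = a [^] k \<and> commutator G a b = a [^] z"
  unfolding satisfies_relations_def using relation_iff_commutator by metis

lemma two_gen_relators_closed: "two_gen_relators x y k z \<subseteq> carrier free_group"
proof -
  interpret F: group "free_group :: gen word set monoid" by (rule free_group_is_group)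
  show ?thesis
    by (simp add: two_gen_relators_def relator_def commutator_def free_gen_closed)
qed

text \<open>Later arguments handle the presented groups through these three properties and do not
  return to words or cosets.\<close>

lemma two_gen_presentation:
  obtains a b where "satisfies_relations (presented_group (two_gen_relators x y k z)) a b x y k z"
    "generate (presented_group (two_gen_relators x y k z)) {a, b}
       = carrier (presented_group (two_gen_relators x y k z))"
    "\<And>(H :: ('c, 'd) monoid_scheme) c d. group H \<Longrightarrow> satisfies_relations H c d x y k z \<Longrightarrow>
      \<exists>\<phi> \<in> hom (presented_group (two_gen_relators x y k z)) H. \<phi> a = c \<and> \<phi> b = d"
proof -
  interpret F: group "free_group :: gen word set monoid" by (rule free_group_is_group)
  let ?R = "two_gen_relators x y k z"
  let ?N = "normal_closure free_group ?R" and ?P = "presented_group ?R"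
  interpret P: group ?P by (rule presented_group_is_group[OF two_gen_relators_closed])
  interpret N: normal ?N free_group
    by (rule F.normal_closure_normal[OF two_gen_relators_closed])
  let ?\<pi> = "\<lambda>u. ?N #>\<^bsub>free_group\<^esub> u"
  interpret pi: group_hom free_group ?P ?\<pi>
    using N.r_coset_hom_Mod F.group_axioms P.group_axioms
    by (simp add: group_hom_def group_hom_axioms_def presented_group_def)
  have R_N: "?R \<subseteq> ?N" by (auto simp: normal_closure_def)
  have fab: "fa \<in> carrier free_group" "fb \<in> carrier free_group"
    by (rule free_gen_closed)+
  have rel: "?\<pi> u = ?\<pi> v"
    if "relator u v \<in> ?R" and u: "u \<in> carrier free_group" and v: "v \<in> carrier free_group" for u v
  proof -
    have "u \<otimes>\<^bsub>free_group\<^esub> inv\<^bsub>free_group\<^esub> v \<in> ?N"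
      using that(1) R_N by (auto simp: relator_def)
    then have "u \<in> ?\<pi> v"
      using N.rcos_module[OF F.group_axioms v u] by simp
    then show ?thesis
      using F.repr_independence[OF _ v N.subgroup_axioms] by simp
  qed
  let ?a = "?\<pi> fa" and ?b = "?\<pi> fb"
  have ab: "?a \<in> carrier ?P" "?b \<in> carrier ?P"
    using fab by (auto intro: pi.hom_closed)
  have mem: "relator (fa [^]\<^bsub>free_group\<^esub> x) \<one>\<^bsub>free_group\<^esub> \<in> ?R"
    "relator (fb [^]\<^bsub>free_group\<^esub> y) (fa [^]\<^bsub>free_group\<^esub> k) \<in> ?R"
    "relator (commutator free_group fa fb) (fa [^]\<^bsub>free_group\<^esub> z) \<in> ?R"
    by (simp_all add: two_gen_relators_def)
  have "?a [^]\<^bsub>?P\<^esub> x = \<one>\<^bsub>?P\<^esub>"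
    using rel[OF mem(1)] fab pi.hom_one by (simp add: pi.hom_nat_pow[symmetric])
  moreover have "?b [^]\<^bsub>?P\<^esub> y = ?a [^]\<^bsub>?P\<^esub> k"
    using rel[OF mem(2)] fab by (simp add: pi.hom_nat_pow[symmetric])
  moreover have "commutator ?P ?a ?b = ?a [^]\<^bsub>?P\<^esub> z"
  proof -
    have "?\<pi> (commutator free_group fa fb) = ?\<pi> (fa [^]\<^bsub>free_group\<^esub> z)"
      by (rule rel[OF mem(3)]) (use fab in \<open>simp_all add: commutator_def\<close>)
    then show ?thesis
      using fab by (simp add: commutator_def pi.hom_nat_pow[symmetric])
  qed
  ultimately have 1: "satisfies_relations ?P ?a ?b x y k z"
    using ab by (simp add: P.satisfies_relations_iff_commutator)
  have "(UNIV :: gen set) = {gen_a, gen_b}"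
    using gen.exhaust by blast
  then have gens: "range free_gen = {fa, fb}"
    by (metis image_insert image_empty)
  have "generate ?P (?\<pi> ` {fa, fb}) = ?\<pi> ` generate free_group {fa, fb}"
    using fab by (intro pi.generate_img) auto
  also have "\<dots> = ?\<pi> ` carrier free_group"
    using free_group_generated[where ?'g = gen] by (simp add: gens)
  also have "\<dots> = carrier ?P"
    by (simp add: presented_group_def carrier_FactGroup)
  finally have 2: "generate ?P {?a, ?b} = carrier ?P" by simp
  have 3: "\<exists>\<phi> \<in> hom ?P H. \<phi> ?a = c \<and> \<phi> ?b = d"
    if "group H" and cd: "satisfies_relations H c d x y k z" for H :: "('c, 'd) monoid_scheme" and c d
  proof -
    interpret H: group H by fact
    let ?f = "case_gen c d"
    have cd': "c \<in> carrier H" "d \<in> carrier H"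
      using cd by (auto simp: satisfies_relations_def)
    then have f: "range ?f \<subseteq> carrier H"
      by (auto split: gen.splits)
    interpret h: group_hom free_group H "free_extension H ?f"
      using H.free_extension_hom[OF f] F.group_axioms H.group_axioms
      by (simp add: group_hom_def group_hom_axioms_def)
    have rels: "c [^]\<^bsub>H\<^esub> x = \<one>\<^bsub>H\<^esub>" "d [^]\<^bsub>H\<^esub> y = c [^]\<^bsub>H\<^esub> k"
      "commutator H c d = c [^]\<^bsub>H\<^esub> z"
      using cd by (simp_all add: H.satisfies_relations_iff_commutator)
    have ext: "free_extension H ?f fa = c" "free_extension H ?f fb = d"
      by (simp_all add: H.free_extension_gen[OF f])
    have "free_extension H ?f (commutator free_group fa fb) = commutator H c d"
      using fab by (simp add: commutator_def ext)
    moreover have "free_extension H ?f (relator u v) = \<one>\<^bsub>H\<^esub>"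
      if "u \<in> carrier free_group" "v \<in> carrier free_group"
        "free_extension H ?f u = free_extension H ?f v" for u v
      using that by (simp add: relator_def)
    ultimately have "free_extension H ?f u = \<one>\<^bsub>H\<^esub>" if "u \<in> ?R" for u
      using that fab
      by (elim two_gen_relators_cases) (simp_all add: h.hom_nat_pow ext rels F.commutator_closed)
    then obtain \<phi> where "\<phi> \<in> hom ?P H" "\<And>g. \<phi> (?\<pi> (free_gen g)) = ?f g"
      using H.presented_group_universal[OF f two_gen_relators_closed] by blast
    then show ?thesis by (intro bexI[of _ \<phi>]) auto
  qed
  from that[OF 1 2 3] show ?thesis .
qed


section \<open>A model of the presented groups\<close>

text \<open>
  The pair \<open>(j, i)\<close> stands for \<open>b\<^sup>j a\<^sup>i\<close>; a carry in the exponent of \<open>b\<close> is moved into that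
  of \<open>a\<close> by \<open>b\<^sup>Y = a\<^sup>k\<close>, and \<open>a\<^sup>i b\<^sup>j = b\<^sup>j a\<^sup>e\<close> with \<open>e = i * q ^ j\<close>.
\<close>

definition model_group :: "nat \<Rightarrow> nat \<Rightarrow> nat \<Rightarrow> nat \<Rightarrow> (nat \<times> nat) monoid" where
  "model_group X Y k q =
     \<lparr> carrier = {..<Y} \<times> {..<X},
       monoid.mult = (\<lambda>(j, i) (j', i'). ((j + j') mod Y, (i * q ^ j' + i' + k * ((j + j') div Y)) mod X)),
       one = (0, 0) \<rparr>"

text \<open>Both congruences are forced by \<open>b^Y = a^k\<close>: this element commutes with
  \<open>a\<close>, so \<open>q^Y\<close> acts as 1, and it commutes with \<open>b\<close>, so
  conjugation by \<open>b\<close> fixes \<open>a^k\<close>.\<close>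

locale model_parameters =
  fixes X Y k q :: nat
  assumes X: "1 < X" and Y: "1 < Y"
    and qY: "[q ^ Y = 1] (mod X)" and kq: "[k * q = k] (mod X)"
begin

abbreviation "M \<equiv> model_group X Y k q"

lemma power_mod_Y: "[q ^ (j mod Y) = q ^ j] (mod X)"
proof -
  have "q ^ j = (q ^ Y) ^ (j div Y) * q ^ (j mod Y)"
    by (simp flip: power_mult power_add)
  moreover have "[(q ^ Y) ^ (j div Y) * q ^ (j mod Y) = 1 * q ^ (j mod Y)] (mod X)"
    using cong_pow[OF qY, of "j div Y"] by (intro cong_mult) auto
  ultimately show ?thesis by (simp add: cong_sym)
qed

lemma k_power: "[k * q ^ j = k] (mod X)"
proof (induction j)
  case (Suc j)
  have "[k * q * q ^ j = k * q ^ j] (mod X)"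
    using kq by (rule cong_mult) simp
  with Suc show ?case by (simp add: mult.assoc cong_trans)
qed simp

text \<open>Both sides count all carries in adding three exponents; each equals
  \<open>(j + j' + j'') div Y\<close>.\<close>

lemma carry_assoc:
  "(j + j') div Y + ((j + j') mod Y + j'') div Y = (j' + j'') div Y + (j + (j' + j'') mod Y) div Y"
proof -
  have carry: "x div Y + (x mod Y + y) div Y = (x + y) div Y" for x y
  proof -
    have "x + y = (x mod Y + y) + (x div Y) * Y"
      using mod_mult_div_eq[of x Y] by (simp add: algebra_simps)
    moreover have "((x mod Y + y) + (x div Y) * Y) div Y = x div Y + (x mod Y + y) div Y"
      using Y by (intro div_mult_self1) simp
    ultimately show ?thesis by (simp only:)
  qed
  from carry[of "j + j'" j''] carry[of "j' + j''" j] show ?thesis by (simp add: add_ac)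
qed

lemma model_mult: "(j, i) \<otimes>\<^bsub>M\<^esub> (j', i') =
    ((j + j') mod Y, (i * q ^ j' + i' + k * ((j + j') div Y)) mod X)"
  by (simp add: model_group_def)

text \<open>Three effects have to match: a carry is not changed by a later conjugation
  (\<open>k_power\<close>), the number of carries does not depend on the bracketing
  (\<open>carry_assoc\<close>), and exponents of \<open>q\<close> may be reduced modulo
  \<open>Y\<close> (\<open>power_mod_Y\<close>).\<close>

lemma model_assoc:
  "((j, i) \<otimes>\<^bsub>M\<^esub> (j', i')) \<otimes>\<^bsub>M\<^esub> (j'', i'') = (j, i) \<otimes>\<^bsub>M\<^esub> ((j', i') \<otimes>\<^bsub>M\<^esub> (j'', i''))"
proof -
  let ?c = "(j + j') div Y" and ?c1 = "((j + j') mod Y + j'') div Y"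
  let ?d = "(j' + j'') div Y" and ?d1 = "(j + (j' + j'') mod Y) div Y"
  let ?L = "(i * q ^ j' + i' + k * ?c) * q ^ j'' + i'' + k * ?c1"
  let ?R = "i * q ^ ((j' + j'') mod Y) + (i' * q ^ j'' + i'' + k * ?d) + k * ?d1"
  have "[?L = (i * q ^ j' + i') * q ^ j'' + i'' + (k * q ^ j'' * ?c + k * ?c1)] (mod X)"
    by (simp add: algebra_simps)
  also have "[(i * q ^ j' + i') * q ^ j'' + i'' + (k * q ^ j'' * ?c + k * ?c1)
      = (i * q ^ j' + i') * q ^ j'' + i'' + (k * ?c + k * ?c1)] (mod X)"
    by (intro cong_add cong_mult k_power) auto
  also have "k * ?c + k * ?c1 = k * ?d + k * ?d1"
    using carry_assoc[of j j' j''] by (simp flip: distrib_left)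
  also have "(i * q ^ j' + i') * q ^ j'' + i'' + (k * ?d + k * ?d1)
      = i * q ^ (j' + j'') + (i' * q ^ j'' + i'' + k * ?d) + k * ?d1"
    by (simp add: algebra_simps power_add)
  also have "[\<dots> = ?R] (mod X)"
    by (intro cong_add cong_mult cong_sym[OF power_mod_Y]) auto
  finally have LR: "[?L = ?R] (mod X)" .
  have "[(i * q ^ j' + i' + k * ?c) mod X * q ^ j'' + i'' + k * ?c1 = ?L] (mod X)"
    by (intro cong_add cong_mult) (auto simp: cong_def)
  moreover have "[i * q ^ ((j' + j'') mod Y) + (i' * q ^ j'' + i'' + k * ?d) mod X + k * ?d1 = ?R] (mod X)"
    by (intro cong_add cong_mult) (auto simp: cong_def)
  ultimately have "[(i * q ^ j' + i' + k * ?c) mod X * q ^ j'' + i'' + k * ?c1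
      = i * q ^ ((j' + j'') mod Y) + (i' * q ^ j'' + i'' + k * ?d) mod X + k * ?d1] (mod X)"
    using LR by (meson cong_sym cong_trans)
  then show ?thesis
    by (simp add: model_mult cong_def mod_add_left_eq mod_add_right_eq add.assoc)
qed

sublocale M: group M
proof (rule groupI)
  have pos: "0 < X" "0 < Y" using X Y by auto
  show "\<one>\<^bsub>M\<^esub> \<in> carrier M" using pos by (simp add: model_group_def)
  fix x assume x: "x \<in> carrier M"
  then obtain j i where ji: "x = (j, i)" "j < Y" "i < X"
    by (auto simp: model_group_def)
  have one: "\<one>\<^bsub>M\<^esub> = (0, 0)" by (simp add: model_group_def)
  show "\<one>\<^bsub>M\<^esub> \<otimes>\<^bsub>M\<^esub> x = x"
    using ji by (simp add: one model_mult)
  show "\<exists>y\<in>carrier M. y \<otimes>\<^bsub>M\<^esub> x = \<one>\<^bsub>M\<^esub>"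
  proof
    let ?j = "(Y - j) mod Y"
    let ?e = "i + k * ((?j + j) div Y)"
    \<comment> \<open>This solves \<open>?i * q^j + ?e = 0\<close> modulo \<open>X\<close>;
      \<open>q^(Y - j)\<close> is the inverse of \<open>q^j\<close> because
      \<open>q^Y = 1\<close>.\<close>
    let ?i = "(X - ?e mod X) * q ^ (Y - j) mod X"
    have "[?i * q ^ j = (X - ?e mod X) * q ^ (Y - j) * q ^ j] (mod X)"
      by (intro cong_mult) (auto simp: cong_def)
    also have "(X - ?e mod X) * q ^ (Y - j) * q ^ j = (X - ?e mod X) * q ^ Y"
      using ji by (simp add: mult.assoc flip: power_add)
    also have "[\<dots> = (X - ?e mod X) * 1] (mod X)"
      by (intro cong_mult qY) auto
    finally have "[?i * q ^ j + ?e = (X - ?e mod X) + ?e mod X] (mod X)"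
      by (intro cong_add) (auto simp: cong_def)
    then have "(?i * q ^ j + ?e) mod X = 0"
      using pos by (simp add: cong_def)
    moreover have "(?j + j) mod Y = 0"
      using ji by (simp add: mod_add_left_eq)
    ultimately show "(?j, ?i) \<otimes>\<^bsub>M\<^esub> x = \<one>\<^bsub>M\<^esub>"
      by (simp only: ji(1) model_mult one add.assoc)
    show "(?j, ?i) \<in> carrier M" using pos by (simp add: model_group_def)
  qed
  fix y assume y: "y \<in> carrier M"
  show "x \<otimes>\<^bsub>M\<^esub> y \<in> carrier M"
    using pos by (auto simp: model_group_def split: prod.splits)
  fix z assume z: "z \<in> carrier M"
  show "x \<otimes>\<^bsub>M\<^esub> y \<otimes>\<^bsub>M\<^esub> z = x \<otimes>\<^bsub>M\<^esub> (y \<otimes>\<^bsub>M\<^esub> z)"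
    by (cases x, cases y, cases z) (simp only: model_assoc)
qed

lemma model_pow_a: "(0, Suc 0) [^]\<^bsub>M\<^esub> i = (0, i mod X)"
  by (induction i) (use X in \<open>auto simp: model_mult mod_Suc_eq\<close>, simp add: model_group_def)

lemma model_pow_b: "j < Y \<Longrightarrow> (Suc 0, 0) [^]\<^bsub>M\<^esub> j = (j, 0)"
  by (induction j) (use X Y in \<open>auto simp: model_mult\<close>, simp add: model_group_def)

lemma model_relations:
  assumes "q = 1 + z"
  shows "satisfies_relations M (0, Suc 0) (Suc 0, 0) X Y k z"
proof -
  \<comment> \<open>No carry occurs up to the exponent \<open>Y - 1\<close>; the last factor
    produces exactly one, which contributes \<open>k\<close>.\<close>
  have "(Suc 0, 0) [^]\<^bsub>M\<^esub> Y = (Suc 0, 0) [^]\<^bsub>M\<^esub> (Y - 1) \<otimes>\<^bsub>M\<^esub> (Suc 0, 0)"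
    using Y M.nat_pow_Suc[of "(Suc 0, 0)" "Y - 1"] by simp
  also have "\<dots> = (0, k mod X)"
    using Y by (simp add: model_pow_b model_mult)
  finally have "(Suc 0, 0) [^]\<^bsub>M\<^esub> Y = (0, Suc 0) [^]\<^bsub>M\<^esub> k"
    by (simp add: model_pow_a)
  moreover have "(0, Suc 0) \<otimes>\<^bsub>M\<^esub> (Suc 0, 0) = (Suc 0, 0) \<otimes>\<^bsub>M\<^esub> (0, Suc 0) [^]\<^bsub>M\<^esub> (1 + z)"
    using Y assms[symmetric] by (simp only: model_pow_a) (simp add: model_mult)
  ultimately show ?thesis
    using X Y by (simp add: satisfies_relations_def model_pow_a del: M.nat_pow_Suc)
      (simp add: model_group_def)
qed

lemma model_generated: "generate M {(0, Suc 0), (Suc 0, 0)} = carrier M"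
proof
  have ab: "{(0, Suc 0), (Suc 0, 0)} \<subseteq> carrier M" using X Y by (simp add: model_group_def)
  show "generate M {(0, Suc 0), (Suc 0, 0)} \<subseteq> carrier M"
    by (rule M.generate_incl[OF ab])
  show "carrier M \<subseteq> generate M {(0, Suc 0), (Suc 0, 0)}"
  proof
    fix x assume "x \<in> carrier M"
    then obtain j i where ji: "x = (j, i)" "j < Y" "i < X"
      by (auto simp: model_group_def)
    interpret S: subgroup "generate M {(0, Suc 0), (Suc 0, 0)}" M
      by (rule M.generate_is_subgroup[OF ab])
    have S_pow: "y [^]\<^bsub>M\<^esub> (n :: nat) \<in> generate M {(0, Suc 0), (Suc 0, 0)}"
      if "y \<in> generate M {(0, Suc 0), (Suc 0, 0)}" for y n
      by (induction n) (use that in \<open>auto intro: generate.one generate.eng\<close>)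
    have "x = (Suc 0, 0) [^]\<^bsub>M\<^esub> j \<otimes>\<^bsub>M\<^esub> (0, Suc 0) [^]\<^bsub>M\<^esub> i"
      using ji by (simp add: model_pow_a model_pow_b model_mult)
    then show "x \<in> generate M {(0, Suc 0), (Suc 0, 0)}"
      by (simp add: S_pow generate.incl)
  qed
qed

lemma card_model: "card (carrier M) = X * Y"
  by (simp add: model_group_def)

end


section \<open>Generated subgroups and commutators\<close>

lemma geo_Suc_left: "geo q (Suc d) = 1 + q * geo q d"
  using geo_add[of q 1 d] by simp

context group
begin

lemma subgroup_nat_pow_closed:
  assumes "subgroup H G" "h \<in> H" shows "h [^] (k :: nat) \<in> H"
  using assms by (induction k) (auto intro: subgroup.one_closed subgroup.m_closed)

text \<open>The inverse of \<open>x\<close> is \<open>x^(order G - 1)\<close>. Sets of normal forms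
  therefore have to be checked for products only.\<close>

lemma subgroup_of_finite_order:
  assumes H: "H \<subseteq> carrier G" and one: "\<one> \<in> H"
    and mult: "\<And>x y. x \<in> H \<Longrightarrow> y \<in> H \<Longrightarrow> x \<otimes> y \<in> H"
    and fin: "finite (carrier G)"
  shows "subgroup H G"
proof (rule subgroupI[OF H])
  show "H \<noteq> {}" using one by blast
  fix x assume x: "x \<in> H"
  then have xG: "x \<in> carrier G" using H by blast
  have pow: "x [^] (k :: nat) \<in> H" for k
    by (induction k) (auto simp: one x mult)
  have "x [^] (order G - 1) \<otimes> x = x [^] order G"
    using fin order_gt_0_iff_finite nat_pow_Suc[of x "order G - 1"] by simp
  also have "\<dots> = \<one>" by (rule pow_order_eq_1[OF xG])
  finally have "inv x = x [^] (order G - 1)"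
    using xG by (intro inv_equality) auto
  then show "inv x \<in> H" using pow by simp
qed (use mult in blast)

lemma nat_pow_comm_pow:
  assumes "x \<otimes> y = y \<otimes> x" "x \<in> carrier G" "y \<in> carrier G"
  shows "x [^] (i :: nat) \<otimes> y [^] (j :: nat) = y [^] j \<otimes> x [^] i"
  using group_commutes_pow[OF group_commutes_pow[OF assms, of i, symmetric], of j] assms by simp

text \<open>In a finite group the natural powers already form the cyclic subgroup
  (\<open>cyc_subgroup\<close>), which keeps all exponents in the type on which \<open>geo\<close>
  and divisibility are used.\<close>

definition cyc :: "'a \<Rightarrow> 'a set" where
  "cyc x = range (\<lambda>k :: nat. x [^] k)"

lemma cycI: "x [^] (k :: nat) \<in> cyc x"
  by (simp add: cyc_def)

lemma cyc_pow_mult [intro]: "x \<in> carrier G \<Longrightarrow> d dvd k \<Longrightarrow> x [^] (k :: nat) \<in> cyc (x [^] d)"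
  by (auto simp: cycI simp flip: nat_pow_pow elim!: dvdE)

lemma cycE: "y \<in> cyc x \<Longrightarrow> (\<And>k :: nat. y = x [^] k \<Longrightarrow> thesis) \<Longrightarrow> thesis"
  by (auto simp: cyc_def)

lemma cyc_subgroup:
  assumes "finite (carrier G)" "x \<in> carrier G" shows "subgroup (cyc x) G"
proof (rule subgroup_of_finite_order)
  show "\<one> \<in> cyc x" using cycI[of x 0] by simp
qed (use assms in \<open>auto simp: cyc_def nat_pow_mult\<close>)

text \<open>The elements \<open>g\<close> with \<open>N g\<close> contained in \<open>g N\<close>
  are closed under products, hence form a subgroup of the finite group, and this subgroup contains
  \<open>S\<close>.\<close>

lemma normal_of_generators:
  assumes fin: "finite (carrier G)" and N: "subgroup N G"
    and S: "S \<subseteq> carrier G" "generate G S = carrier G"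
    and conj: "\<And>x s. x \<in> N \<Longrightarrow> s \<in> S \<Longrightarrow> \<exists>x' \<in> N. x \<otimes> s = s \<otimes> x'"
  shows "N \<lhd> G"
proof -
  interpret N: subgroup N G by (rule N)
  let ?C = "{g \<in> carrier G. \<forall>x \<in> N. \<exists>x' \<in> N. x \<otimes> g = g \<otimes> x'}"
  have "subgroup ?C G"
  proof (rule subgroup_of_finite_order[OF _ _ _ fin])
    fix g h assume g: "g \<in> ?C" and h: "h \<in> ?C"
    have "\<exists>x' \<in> N. x \<otimes> (g \<otimes> h) = g \<otimes> h \<otimes> x'" if x: "x \<in> N" for x
    proof -
      obtain x1 where x1: "x1 \<in> N" "x \<otimes> g = g \<otimes> x1" using g x by blast
      obtain x2 where x2: "x2 \<in> N" "x1 \<otimes> h = h \<otimes> x2" using h x1 by blast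
      have "x \<otimes> (g \<otimes> h) = (x \<otimes> g) \<otimes> h" using g h x by (simp add: m_assoc)
      also have "\<dots> = g \<otimes> h \<otimes> x2" using g h x1 x2 by (simp add: m_assoc)
      finally show ?thesis using x2 by blast
    qed
    with g h show "g \<otimes> h \<in> ?C" by simp
  qed auto
  then have "carrier G \<subseteq> ?C"
    using generate_subgroup_incl[of S ?C] S conj by blast
  then have conj': "\<exists>x' \<in> N. x \<otimes> g = g \<otimes> x'" if "x \<in> N" "g \<in> carrier G" for x g
    using that by blast
  show ?thesis
  proof (rule normal_invI[OF N])
    fix g x assume g: "g \<in> carrier G" and x: "x \<in> N"
    then obtain x' where x': "x' \<in> N" "x \<otimes> inv g = inv g \<otimes> x'"
      using conj'[of x "inv g"] by auto
    then have "g \<otimes> x \<otimes> inv g = x'"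
      using g x by (simp add: m_assoc) (simp flip: m_assoc)
    with x' show "g \<otimes> x \<otimes> inv g \<in> N" by simp
  qed
qed

lemma commutator_eq_one_iff:
  assumes "x \<in> carrier G" "y \<in> carrier G"
  shows "commutator G x y = \<one> \<longleftrightarrow> x \<otimes> y = y \<otimes> x"
  using assms by (simp add: commutator_eq_iff)

lemma commutator_swap:
  assumes "x \<in> carrier G" "y \<in> carrier G"
  shows "commutator G y x = inv (commutator G x y)"
  using assms by (simp add: commutator_def inv_mult_group m_assoc)

lemma commutator_mult_right:
  assumes "x \<in> carrier G" "y \<in> carrier G" "w \<in> carrier G"
  shows "commutator G x (y \<otimes> w) = commutator G x w \<otimes> (inv w \<otimes> commutator G x y \<otimes> w)"
proof -
  have "x \<otimes> (inv x \<otimes> u) = u" "w \<otimes> (inv w \<otimes> u) = u" if "u \<in> carrier G" for u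
    using assms that by (simp_all flip: m_assoc)
  then show ?thesis
    using assms by (simp add: commutator_def inv_mult_group m_assoc)
qed

text \<open>For fixed \<open>x\<close>, the elements \<open>y\<close> with \<open>[x, y]\<close> in
  \<open>N\<close> are closed under products: \<open>[x, y w]\<close> is \<open>[x, w]\<close> times
  a conjugate of \<open>[x, y]\<close>.\<close>

lemma commutator_generate_right:
  assumes fin: "finite (carrier G)" and N: "N \<lhd> G" and x: "x \<in> carrier G"
    and S: "S \<subseteq> carrier G" and comm: "\<And>s. s \<in> S \<Longrightarrow> commutator G x s \<in> N"
    and y: "y \<in> generate G S"
  shows "commutator G x y \<in> N"
proof -
  interpret N: normal N G by (rule N)
  let ?C = "{y \<in> carrier G. commutator G x y \<in> N}"
  have "subgroup ?C G"
  proof (rule subgroup_of_finite_order[OF _ _ _ fin])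
    show "\<one> \<in> ?C" using x by (simp add: commutator_def)
  qed (use x in \<open>auto simp: commutator_mult_right intro!: N.m_closed N.inv_op_closed1\<close>)
  then have "generate G S \<subseteq> ?C"
    using generate_subgroup_incl[of S ?C] S comm by blast
  with y show ?thesis by blast
qed

text \<open>The passage from generators to all elements is made in the right argument, then, after
  \<open>commutator_swap\<close>, in the other one.\<close>

lemma commutators_in_normal:
  assumes fin: "finite (carrier G)" and N: "N \<lhd> G"
    and S: "S \<subseteq> carrier G" "generate G S = carrier G"
    and comm: "\<And>s t. s \<in> S \<Longrightarrow> t \<in> S \<Longrightarrow> commutator G s t \<in> N"
    and x: "x \<in> carrier G" and y: "y \<in> carrier G"
  shows "commutator G x y \<in> N"
proof -
  interpret N: normal N G by (rule N)
  have "commutator G s z \<in> N" if "s \<in> S" "z \<in> carrier G" for s z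
    using commutator_generate_right[OF fin N _ S(1), of s z] S comm that by blast
  then have "commutator G z s \<in> N" if "s \<in> S" "z \<in> carrier G" for s z
    using that S commutator_swap[of s z] by auto
  then show ?thesis
    using commutator_generate_right[OF fin N x S(1), of y] S x y by blast
qed

lemma commutators_in_normal_pair:
  assumes fin: "finite (carrier G)" and N: "N \<lhd> G"
    and ab: "a \<in> carrier G" "b \<in> carrier G" "generate G {a, b} = carrier G"
    and comm: "commutator G a b \<in> N"
    and xy: "x \<in> carrier G" "y \<in> carrier G"
  shows "commutator G x y \<in> N"
proof (rule commutators_in_normal[OF fin N _ ab(3) _ xy])
  interpret N: normal N G by (rule N)
  have "commutator G u u = \<one>" if "u \<in> carrier G" for u
    using that by (simp add: commutator_eq_one_iff)
  then show "commutator G s t \<in> N" if "s \<in> {a, b}" "t \<in> {a, b}" for s t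
    using that comm commutator_swap[OF ab(1,2)] ab(1,2) by auto
qed (use ab in auto)

lemma commutator_subgroup_subset:
  assumes "subgroup N G" "\<And>x y. x \<in> H \<Longrightarrow> y \<in> K \<Longrightarrow> commutator G x y \<in> N"
  shows "commutator_subgroup G H K \<subseteq> N"
  unfolding commutator_subgroup_def using assms by (intro generate_subgroup_incl) auto

lemma commutator_in_subgroup:
  "x \<in> H \<Longrightarrow> y \<in> K \<Longrightarrow> commutator G x y \<in> commutator_subgroup G H K"
  unfolding commutator_subgroup_def by (rule generate.incl) blast

lemma power_in_power_subgroup: "x \<in> H \<Longrightarrow> x [^] (k :: nat) \<in> power_subgroup G H k"
  unfolding power_subgroup_def by (rule generate.incl) blast

lemma power_subgroup_is_subgroup:
  "H \<subseteq> carrier G \<Longrightarrow> subgroup (power_subgroup G H k) G"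
  unfolding power_subgroup_def by (rule generate_is_subgroup) auto

lemma power_subgroup_subset:
  assumes "subgroup N G" "\<And>x. x \<in> H \<Longrightarrow> x [^] (k :: nat) \<in> N"
  shows "power_subgroup G H k \<subseteq> N"
  unfolding power_subgroup_def using assms by (intro generate_subgroup_incl) auto

end

text \<open>
  The exponent \<open>t\<close> of a central element \<open>z\<close> measures the failure of \<open>cyc a\<close> to be normal;
  \<open>z = 1\<close> is the metacyclic case.
\<close>

locale twisted_pair = group G for G (structure) +
  fixes a b z :: 'a and q t :: nat
  assumes a [simp]: "a \<in> carrier G" and b [simp]: "b \<in> carrier G" and z [simp]: "z \<in> carrier G"
    and za: "z \<otimes> a = a \<otimes> z" and zb: "z \<otimes> b = b \<otimes> z"
    and twist: "a \<otimes> b = b \<otimes> (a [^] q \<otimes> z [^] t)"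
begin

lemma pow_a_b: "a [^] i \<otimes> b = b \<otimes> (a [^] (i * q) \<otimes> z [^] (i * t))" for i :: nat
proof (induction i)
  case (Suc i)
  have "a [^] Suc i \<otimes> b = a [^] i \<otimes> b \<otimes> (a [^] q \<otimes> z [^] t)"
    by (simp add: m_assoc twist)
  also have "\<dots> = b \<otimes> (a [^] (i * q) \<otimes> (z [^] (i * t) \<otimes> a [^] q) \<otimes> z [^] t)"
    by (simp add: Suc m_assoc)
  also have "z [^] (i * t) \<otimes> a [^] q = a [^] q \<otimes> z [^] (i * t)"
    by (rule nat_pow_comm_pow[OF za]) auto
  also have "b \<otimes> (a [^] (i * q) \<otimes> (a [^] q \<otimes> z [^] (i * t)) \<otimes> z [^] t)
      = b \<otimes> ((a [^] (i * q) \<otimes> a [^] q) \<otimes> (z [^] (i * t) \<otimes> z [^] t))"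
    by (simp add: m_assoc)
  also have "\<dots> = b \<otimes> (a [^] (Suc i * q) \<otimes> z [^] (Suc i * t))"
    by (simp add: nat_pow_mult add.commute)
  finally show ?case .
qed simp

lemma pow_a_pow_b:
  "a [^] i \<otimes> b [^] j = b [^] j \<otimes> (a [^] (i * q ^ j) \<otimes> z [^] (i * t * geo q j))" for i j :: nat
proof (induction j)
  case (Suc j)
  have "a [^] i \<otimes> b [^] Suc j = b [^] j \<otimes> (a [^] (i * q ^ j) \<otimes> (z [^] (i * t * geo q j) \<otimes> b))"
    using Suc by (simp add: m_assoc flip: m_assoc[of "a [^] i"])
  also have "z [^] (i * t * geo q j) \<otimes> b = b \<otimes> z [^] (i * t * geo q j)"
    by (rule group_commutes_pow[OF zb]) auto
  also have "b [^] j \<otimes> (a [^] (i * q ^ j) \<otimes> (b \<otimes> z [^] (i * t * geo q j)))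
      = b [^] j \<otimes> (a [^] (i * q ^ j) \<otimes> b) \<otimes> z [^] (i * t * geo q j)"
    by (simp add: m_assoc)
  also have "\<dots> = b [^] Suc j \<otimes> (a [^] (i * q ^ j * q)
      \<otimes> (z [^] (i * q ^ j * t) \<otimes> z [^] (i * t * geo q j)))"
    by (simp add: pow_a_b m_assoc)
  also have "z [^] (i * q ^ j * t) \<otimes> z [^] (i * t * geo q j) = z [^] (i * t * geo q (Suc j))"
    by (simp add: nat_pow_mult algebra_simps)
  finally show ?case by (simp add: mult_ac)
qed simp

definition elt :: "nat \<Rightarrow> nat \<Rightarrow> nat \<Rightarrow> 'a" where
  "elt j i k = b [^] j \<otimes> (a [^] i \<otimes> z [^] k)"

lemma elt_closed [simp]: "elt j i k \<in> carrier G"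
  by (simp add: elt_def)

lemma elt_mult:
  "elt j i k \<otimes> elt j' i' k' = elt (j + j') (i * q ^ j' + i') (k + k' + i * t * geo q j')"
proof -
  have zb': "z [^] e \<otimes> b [^] f = b [^] f \<otimes> z [^] e" and za': "z [^] e \<otimes> a [^] f = a [^] f \<otimes> z [^] e"
    for e f :: nat
    by (auto intro: nat_pow_comm_pow za zb)
  have zb'': "z [^] e \<otimes> (b [^] f \<otimes> u) = b [^] f \<otimes> (z [^] e \<otimes> u)"
    and za'': "z [^] e \<otimes> (a [^] f \<otimes> u) = a [^] f \<otimes> (z [^] e \<otimes> u)"
    and ab'': "a [^] e \<otimes> (b [^] f \<otimes> u) = b [^] f \<otimes> (a [^] (e * q ^ f) \<otimes> (z [^] (e * t * geo q f) \<otimes> u))"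
    and aa'': "a [^] e \<otimes> (a [^] f \<otimes> u) = a [^] (e + f) \<otimes> u"
    and bb'': "b [^] e \<otimes> (b [^] f \<otimes> u) = b [^] (e + f) \<otimes> u"
    if "u \<in> carrier G" for e f :: nat and u
    using zb'[of e f] za'[of e f] pow_a_pow_b[of e f] that
    by (auto simp: nat_pow_mult simp flip: m_assoc)
  show ?thesis
    by (simp add: elt_def m_assoc zb'' za'' ab'' aa'' bb'' nat_pow_mult add_ac)
qed

text \<open>Multiplying the \<open>M\<close>-th power by one more factor moves
  \<open>a^(i * geo (q^j) M)\<close> past \<open>b^j\<close>. Each such move yields
  \<open>z^(i * t * geo q j * geo (q^j) M)\<close>, hence the double sum.\<close>

lemma elt_pow: "elt j i k [^] N = elt (j * N) (i * geo (q ^ j) N)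
    (k * N + i * t * geo q j * (\<Sum>M<N. geo (q ^ j) M))" for N :: nat
proof (induction N)
  case (Suc N)
  have "i * geo (q ^ j) N * q ^ j + i = i * geo (q ^ j) (Suc N)"
    by (simp only: geo_Suc_left) (simp add: algebra_simps)
  moreover have "k * N + i * t * geo q j * (\<Sum>M<N. geo (q ^ j) M) + k + i * geo (q ^ j) N * t * geo q j
      = k * Suc N + i * t * geo q j * (\<Sum>M<Suc N. geo (q ^ j) M)"
    by (simp add: algebra_simps)
  moreover have "j * N + j = j * Suc N" by simp
  ultimately show ?case
    by (simp only: Suc elt_mult nat_pow_Suc)
qed (simp add: elt_def)

end


section \<open>Normal forms\<close>

locale presented_pair = group G for G (structure) +
  fixes a b :: 'a and X Y k z :: nat
  assumes rels: "satisfies_relations G a b X Y k z"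
    and gen: "generate G {a, b} = carrier G"
    and X: "0 < X" and Y: "0 < Y"
begin

text \<open>With \<open>z = 1\<close> the third exponent of \<open>elt\<close> disappears, and the
  product and power formulas specialise to the forms \<open>b^j a^i\<close>.\<close>

sublocale twisted_pair G a b \<one> "1 + z" 0
  using rels by unfold_locales (auto simp: satisfies_relations_def)

lemma a_X: "a [^] X = \<one>" and b_Y: "b [^] Y = a [^] k"
  using rels by (auto simp: satisfies_relations_def)

lemma elt_eq: "elt j i e = b [^] j \<otimes> a [^] i"
  by (simp add: elt_def)

lemma mult_form:
  "(b [^] j \<otimes> a [^] i) \<otimes> (b [^] j' \<otimes> a [^] i') = b [^] (j + j') \<otimes> a [^] (i * (1 + z) ^ j' + i')"
  for i j i' j' :: nat
  using elt_mult[of j i 0 j' i' 0] by (simp only: elt_eq)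

lemma pow_form:
  "(b [^] j \<otimes> a [^] i) [^] N = b [^] (j * N) \<otimes> a [^] (i * geo ((1 + z) ^ j) N)" for i j N :: nat
  using elt_pow[of j i 0 N] by (simp only: elt_eq)

lemma a_mod: "a [^] i = a [^] (i mod X)"
proof -
  have "a [^] i = (a [^] X) [^] (i div X) \<otimes> a [^] (i mod X)"
    by (simp add: nat_pow_pow nat_pow_mult)
  then show ?thesis by (simp add: a_X)
qed

lemma reduce_form: "b [^] j \<otimes> a [^] i = b [^] (j mod Y) \<otimes> a [^] ((k * (j div Y) + i) mod X)"
proof -
  have "b [^] j = b [^] (j mod Y) \<otimes> (b [^] Y) [^] (j div Y)"
    by (simp add: nat_pow_pow nat_pow_mult add.commute)
  also have "(b [^] Y) [^] (j div Y) = a [^] (k * (j div Y))"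
    by (simp add: b_Y nat_pow_pow)
  finally show ?thesis
    by (simp add: m_assoc nat_pow_mult a_mod[symmetric])
qed

lemma form_exists:
  assumes "g \<in> carrier G"
  obtains j i where "g = b [^] j \<otimes> a [^] i" "j < Y" "i < X"
proof -
  \<comment> \<open>Both generators have finite order, so their inverses are natural powers and fit
    the form \<open>b^j a^i\<close>.\<close>
  have inv_eq: "\<exists>n :: nat. inv x = x [^] n"
    if "x \<in> carrier G" "x [^] N = \<one>" "0 < N" for x and N :: nat
  proof
    have "x [^] (N - 1) \<otimes> x = \<one>"
      using that nat_pow_Suc[of x "N - 1"] by simp
    then show "inv x = x [^] (N - 1)"
      using that by (intro inv_equality) auto
  qed
  have b_YX: "b [^] (Y * X) = \<one>"
  proof -
    have "b [^] (Y * X) = (b [^] Y) [^] X"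
      by (rule nat_pow_pow[symmetric]) simp
    also have "\<dots> = (a [^] X) [^] k"
      by (simp add: b_Y nat_pow_pow mult.commute)
    finally have "b [^] (Y * X) = (a [^] X) [^] k" .
    then show ?thesis by (simp add: a_X)
  qed
  have form: "\<exists>(j :: nat) (i :: nat). g = b [^] j \<otimes> a [^] i" if "g \<in> generate G {a, b}" for g
    using that
  proof (induction rule: generate.induct)
    case one
    show ?case by (intro exI[of _ 0]) simp
  next
    case (incl h)
    have "a = b [^] (0 :: nat) \<otimes> a [^] (1 :: nat)" "b = b [^] (1 :: nat) \<otimes> a [^] (0 :: nat)"
      by simp_all
    with incl show ?case by blast
  next
    case (inv h)
    have "\<exists>i :: nat. inv a = a [^] i" "\<exists>j :: nat. inv b = b [^] j"
      using inv_eq[OF a a_X X] inv_eq[OF b b_YX] X Y by auto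
    then obtain i j :: nat where "inv a = b [^] (0 :: nat) \<otimes> a [^] i" "inv b = b [^] j \<otimes> a [^] (0 :: nat)"
      by auto
    with inv show ?case by blast
  next
    case (eng h1 h2)
    then obtain j i j' i' :: nat where "h1 = b [^] j \<otimes> a [^] i" "h2 = b [^] j' \<otimes> a [^] i'" by blast
    then have "h1 \<otimes> h2 = b [^] (j + j') \<otimes> a [^] (i * (1 + z) ^ j' + i')"
      by (simp only: mult_form)
    then show ?case by (intro exI)
  qed
  have "g \<in> generate G {a, b}"
    using assms by (simp only: gen)
  from form[OF this] obtain j i :: nat where "g = b [^] j \<otimes> a [^] i"
    by blast
  then have "g = b [^] (j mod Y) \<otimes> a [^] ((k * (j div Y) + i) mod X)"
    by (rule trans[OF _ reduce_form])
  with that X Y show ?thesis by simp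
qed

lemma carrier_eq: "carrier G = (\<lambda>(j, i). b [^] j \<otimes> a [^] i) ` ({..<Y} \<times> {..<X})"
proof
  show "carrier G \<subseteq> (\<lambda>(j, i). b [^] j \<otimes> a [^] i) ` ({..<Y} \<times> {..<X})"
  proof
    fix g assume "g \<in> carrier G"
    then obtain j i where "g = b [^] j \<otimes> a [^] i" "j < Y" "i < X"
      by (rule form_exists)
    then show "g \<in> (\<lambda>(j, i). b [^] j \<otimes> a [^] i) ` ({..<Y} \<times> {..<X})"
      by force
  qed
qed auto

lemma finite_carrier: "finite (carrier G)"
  by (simp add: carrier_eq)

lemma order_le: "order G \<le> X * Y"
proof -
  have "card (carrier G) \<le> card ({..<Y} \<times> {..<X})"
    unfolding carrier_eq by (rule card_image_le) simp
  then show ?thesis by (simp add: order_def mult.commute)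
qed

end

text \<open>There are \<open>X * Y\<close> normal forms, so this order says that no two of them
  coincide: the group has not collapsed.\<close>

locale faithful_pair = presented_pair +
  assumes order: "order G = X * Y"
begin

lemma form_unique:
  assumes "b [^] j \<otimes> a [^] i = b [^] j' \<otimes> a [^] i'" "j < Y" "j' < Y" "i < X" "i' < X"
  shows "j = j'" "i = i'"
proof -
  have "inj_on (\<lambda>(j, i). b [^] j \<otimes> a [^] i) ({..<Y} \<times> {..<X})"
    using order by (intro eq_card_imp_inj_on) (auto simp: order_def carrier_eq[symmetric] mult.commute)
  from inj_onD[OF this, of "(j, i)" "(j', i')"] assms show "j = j'" "i = i'" by auto
qed

lemma b_pow_eq_a_pow_dvd:
  fixes i j :: nat
  assumes "b [^] j = a [^] i" shows "Y dvd j"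
proof -
  have "b [^] (j mod Y) \<otimes> a [^] (k * (j div Y) mod X) = b [^] (0 :: nat) \<otimes> a [^] (i mod X)"
    using reduce_form[of j 0] reduce_form[of 0 i] assms by simp
  from form_unique(1)[OF this] X Y show ?thesis by auto
qed

lemma a_pow_one_iff: "a [^] i = \<one> \<longleftrightarrow> X dvd i"
proof
  assume "a [^] i = \<one>"
  then have "b [^] (0 :: nat) \<otimes> a [^] (i mod X) = b [^] (0 :: nat) \<otimes> a [^] (0 :: nat)"
    by (simp flip: a_mod)
  from form_unique(2)[OF this] X Y show "X dvd i" by auto
next
  assume "X dvd i"
  then show "a [^] i = \<one>" using a_mod[of i] by (simp add: mod_eq_0_iff_dvd)
qed

end

lemma order_two_gen_presentation_le:
  assumes "0 < X" "0 < Y"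
  shows "finite (carrier (presented_group (two_gen_relators X Y k z)))"
    "order (presented_group (two_gen_relators X Y k z)) \<le> X * Y"
proof -
  let ?P = "presented_group (two_gen_relators X Y k z)"
  interpret P: group ?P by (rule presented_group_is_group[OF two_gen_relators_closed])
  obtain a b where "satisfies_relations ?P a b X Y k z" "generate ?P {a, b} = carrier ?P"
    by (rule two_gen_presentation)
  then interpret presented_pair ?P a b X Y k z
    using assms by unfold_locales
  show "finite (carrier ?P)" by (rule finite_carrier)
  show "order ?P \<le> X * Y" by (rule order_le)
qed

text \<open>The universal property gives a surjection onto \<open>G\<close> from the presented
  group. Its order is at most \<open>X * Y\<close>, the order of \<open>G\<close>, so the surjection
  is injective.\<close>

lemma (in faithful_pair) iso_presented_group:
  "G \<cong> presented_group (two_gen_relators X Y k z)"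
proof -
  let ?P = "presented_group (two_gen_relators X Y k z)"
  interpret P: group ?P by (rule presented_group_is_group[OF two_gen_relators_closed])
  have "\<exists>\<phi> \<in> hom ?P G. \<phi> ` carrier ?P = carrier G"
  proof (rule two_gen_presentation[where ?'c = 'a and ?'d = 'b and x = X and y = Y and k = k and z = z])
    fix c d
    assume cd: "satisfies_relations ?P c d X Y k z" "generate ?P {c, d} = carrier ?P"
      and univ: "\<And>(H :: ('a, 'b) monoid_scheme) c' d'. group H \<Longrightarrow> satisfies_relations H c' d' X Y k z \<Longrightarrow>
        \<exists>\<phi> \<in> hom ?P H. \<phi> c = c' \<and> \<phi> d = d'"
    obtain \<phi> where \<phi>: "\<phi> \<in> hom ?P G" "\<phi> c = a" "\<phi> d = b"
      using univ[OF group_axioms rels] by blast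
    interpret \<phi>: group_hom ?P G \<phi>
      using \<phi> P.group_axioms group_axioms by (simp add: group_hom_def group_hom_axioms_def)
    have "\<phi> ` carrier ?P = generate G (\<phi> ` {c, d})"
      using cd \<phi>.generate_img[of "{c, d}"] by (simp add: satisfies_relations_def)
    then have "\<phi> ` carrier ?P = carrier G" by (simp add: \<phi> gen)
    with \<phi>(1) show ?thesis by blast
  qed
  then obtain \<phi> where \<phi>: "\<phi> \<in> hom ?P G" "\<phi> ` carrier ?P = carrier G" by blast
  have "card (carrier ?P) \<le> card (carrier G)"
    using order_two_gen_presentation_le(2)[OF X Y] order by (simp add: order_def)
  then have "card (\<phi> ` carrier ?P) = card (carrier ?P)"
    using order_two_gen_presentation_le(1)[OF X Y] card_image_le[of "carrier ?P" \<phi>] \<phi>(2) by fastforce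
  then have "inj_on \<phi> (carrier ?P)"
    by (rule eq_card_imp_inj_on[OF order_two_gen_presentation_le(1)[OF X Y]])
  with \<phi> have "\<phi> \<in> iso ?P G"
    by (simp add: iso_def bij_betw_def)
  then show ?thesis
    using P.iso_set_sym by (auto simp: is_iso_def)
qed

text \<open>The model is itself a faithful pair, hence isomorphic to the presented group, and its
  order is transferred.\<close>

lemma two_gen_presentation_faithful:
  assumes "1 < X" "1 < Y" "[(1 + z) ^ Y = 1] (mod X)" "[k * (1 + z) = k] (mod X)"
  obtains a b where "faithful_pair (presented_group (two_gen_relators X Y k z)) a b X Y k z"
proof -
  let ?P = "presented_group (two_gen_relators X Y k z)"
  interpret P: group ?P by (rule presented_group_is_group[OF two_gen_relators_closed])
  interpret M: model_parameters X Y k "1 + z"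
    using assms by unfold_locales
  interpret M: faithful_pair M.M "(0, Suc 0)" "(Suc 0, 0)" X Y k z
    using M.model_relations[of z] M.model_generated M.card_model assms
    by unfold_locales (simp_all add: order_def)
  have "order ?P = X * Y"
    using iso_same_card[OF M.iso_presented_group] M.order by (simp add: order_def)
  moreover obtain a b where "satisfies_relations ?P a b X Y k z" "generate ?P {a, b} = carrier ?P"
    by (rule two_gen_presentation)
  ultimately have "faithful_pair ?P a b X Y k z"
    using assms by unfold_locales auto
  then show ?thesis by (rule that)
qed


section \<open>The listed groups\<close>

text \<open>The two families in one condition: \<open>l = n\<close> is family (I), where
  \<open>b^(p^m) = a^(p^n) = 1\<close>, and \<open>l < n\<close> is family (II), where
  \<open>n \<le> m + r\<close> already follows from \<open>l < m\<close> and
  \<open>n \<le> l + r\<close>.\<close>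

definition canonical :: "nat \<Rightarrow> nat \<Rightarrow> nat \<Rightarrow> nat \<Rightarrow> bool" where
  "canonical n m l r \<longleftrightarrow> 2 \<le> r \<and> r < l \<and> l \<le> n \<and> n \<le> m + r \<and> (l < n \<longrightarrow> l < m \<and> n \<le> l + r)"

definition params_of :: "nat \<Rightarrow> nat \<Rightarrow> nat \<Rightarrow> nat \<Rightarrow> params" where
  "params_of n m l r = (if l = n then Fam_I n m r else Fam_II n m l r)"

lemma param_list_eq: "param_list = {params_of n m l r | n m l r. canonical n m l r}"
proof (intro subset_antisym subsetI)
  fix i assume "i \<in> param_list"
  then consider n m r where "i = Fam_I n m r" "n - r \<le> m" "2 \<le> r" "r \<le> n - 1"
    | n m l r where "i = Fam_II n m l r" "2 \<le> r" "r < l" "l \<le> n - 1" "n - r \<le> l" "l < m"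
    unfolding param_list_def by blast
  then show "i \<in> {params_of n m l r | n m l r. canonical n m l r}"
  proof cases
    case 1
    then have "i = params_of n m n r" "canonical n m n r"
      by (auto simp: params_of_def canonical_def)
    then show ?thesis by blast
  next
    case 2
    then have "i = params_of n m l r" "canonical n m l r"
      by (auto simp: params_of_def canonical_def)
    then show ?thesis by blast
  qed
next
  fix i assume "i \<in> {params_of n m l r | n m l r. canonical n m l r}"
  then obtain n m l r where i: "i = params_of n m l r" and c: "canonical n m l r" by blast
  have pos: "0 < n" "0 < m" "0 < l" "0 < r" using c by (auto simp: canonical_def)
  show "i \<in> param_list"
  proof (cases "l = n")
    case True
    then have "n - r \<le> m" "2 \<le> r" "r \<le> n - 1" using c by (auto simp: canonical_def)
    with pos True i show ?thesis unfolding param_list_def params_of_def by auto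
  next
    case False
    then have "2 \<le> r" "r < l" "l \<le> n - 1" "n - r \<le> l" "l < m" using c by (auto simp: canonical_def)
    with pos False i show ?thesis unfolding param_list_def params_of_def by auto
  qed
qed

lemma listed_order_params_of: "listed_order p (params_of n m l r) = p ^ n * p ^ m"
  by (simp add: params_of_def power_add)

locale powerful_pair = faithful_pair G a b "p ^ n" "p ^ m" "p ^ l" "p ^ r"
  for G (structure) and a b and p n m l r :: nat +
  assumes prime_p: "Factorial_Ring.prime p" and canonical: "canonical n m l r"
begin

lemma p_gt_1: "1 < p" using prime_gt_1_nat[OF prime_p] .

lemma p_power_dvd_iff: "p ^ i dvd p ^ j \<longleftrightarrow> i \<le> j"
  using p_gt_1 by (simp add: dvd_power_iff_le)

lemma r_bounds: "2 \<le> r" "r < n" "r < l" "l \<le> n" "n \<le> m + r"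
  using canonical by (auto simp: canonical_def)

lemma cong_one: "[(1 + p ^ r) ^ j = 1] (mod p)"
proof -
  have "[1 + p ^ r = 1 + 0] (mod p)"
    using r_bounds by (intro cong_add) (auto simp: cong_0_iff intro: dvd_power)
  from cong_pow[OF this, of j] show ?thesis by simp
qed

section \<open>The listed groups are powerfully nilpotent\<close>

lemma commute_b: "(a [^] i) \<otimes> b = b \<otimes> a [^] (i * (1 + p ^ r))" for i :: nat
  using pow_a_b[of i] by simp

lemma cyc_normal: "cyc (a [^] (d :: nat)) \<lhd> G"
proof (rule normal_of_generators[OF finite_carrier cyc_subgroup[OF finite_carrier] _ gen])
  fix x s assume x: "x \<in> cyc (a [^] d)" and s: "s \<in> {a, b}"
  from x obtain k where k: "x = a [^] (d * k)"
    by (rule cycE) (simp add: nat_pow_pow)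
  show "\<exists>x' \<in> cyc (a [^] d). x \<otimes> s = s \<otimes> x'"
  proof (cases "s = a")
    case True
    then show ?thesis using x k nat_pow_comm_pow[of a a "d * k" 1] by auto
  next
    case False
    have "a [^] (d * k * (1 + p ^ r)) \<in> cyc (a [^] d)" by (rule cyc_pow_mult) auto
    with False s k show ?thesis using commute_b[of "d * k"] by auto
  qed
qed auto

lemma commutator_ab: "commutator G a b = a [^] (p ^ r)"
  using rels by (simp add: satisfies_relations_iff_commutator)

lemma commutator_in_cyc:
  "x \<in> carrier G \<Longrightarrow> y \<in> carrier G \<Longrightarrow> commutator G x y \<in> cyc (a [^] (p ^ r))"
  using commutators_in_normal_pair[OF finite_carrier cyc_normal a b gen, of "p ^ r"]
    commutator_ab cycI[of "a [^] (p ^ r)" 1] by simp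

text \<open>Since \<open>r \<ge> 2\<close>, commutation gains a factor \<open>p^2\<close> in the
  exponent: in \<open>is_powerfully_nilpotent\<close> one factor \<open>p\<close> pays for the step
  down the chain and one for the \<open>p\<close>-th power.\<close>

lemma commutator_a_pow:
  assumes "y \<in> carrier G"
  shows "commutator G (a [^] (p ^ e * k)) y \<in> cyc (a [^] (p ^ (e + 2)))"
proof (rule commutator_generate_right[OF finite_carrier cyc_normal])
  let ?x = "a [^] (p ^ e * k)"
  have "?x \<otimes> a = a \<otimes> ?x" by (rule group_commutes_pow) auto
  then have "commutator G ?x a = (a [^] (p ^ (e + 2))) [^] (0 :: nat)"
    by (simp add: commutator_eq_one_iff)
  then have "commutator G ?x a \<in> cyc (a [^] (p ^ (e + 2)))"
    by (simp only: cycI)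
  moreover have "commutator G ?x b = a [^] (p ^ e * k * p ^ r)"
    using commute_b[of "p ^ e * k"] by (simp add: commutator_eq_iff nat_pow_mult)
  moreover have "p ^ (e + 2) dvd p ^ e * k * p ^ r"
    unfolding power_add using r_bounds by (intro mult_dvd_mono le_imp_power_dvd) auto
  ultimately show "commutator G ?x s \<in> cyc (a [^] (p ^ (e + 2)))" if "s \<in> {a, b}" for s
    using that cyc_pow_mult[OF a] by fastforce
qed (use assms gen in auto)

lemma cyc_subset_power_subgroup:
  assumes "\<And>k :: nat. a [^] (d * k) \<in> H"
  shows "cyc (a [^] (d * e)) \<subseteq> power_subgroup G H e"
proof
  fix x assume "x \<in> cyc (a [^] (d * e))"
  then obtain k :: nat where "x = (a [^] (d * e)) [^] k" by (rule cycE)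
  then have "x = (a [^] (d * k)) [^] e"
    by (simp add: nat_pow_pow mult_ac)
  then show "x \<in> power_subgroup G H e"
    using power_in_power_subgroup assms by simp
qed

lemma cyc_dvd_mono: "d dvd e \<Longrightarrow> cyc (a [^] (e :: nat)) \<subseteq> cyc (a [^] d)"
  by (auto elim!: cycE simp: nat_pow_pow intro!: cyc_pow_mult)

lemma is_p_group: "p_group p G"
  unfolding p_group_def using finite_carrier order by (auto simp flip: power_add)

lemma is_powerful: "powerful p G"
  unfolding powerful_def
proof (intro conjI is_p_group)
  let ?e = "if p = 2 then 4 else p"
  \<comment> \<open>This covers both definitions of powerful: \<open>?e\<close> is
    \<open>p^2\<close> for \<open>p = 2\<close> and \<open>p\<close> otherwise.\<close>
  have "?e dvd p ^ 2" by (simp add: power2_eq_square)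
  then have "?e dvd p ^ r"
    using r_bounds le_imp_power_dvd dvd_trans by blast
  then have "cyc (a [^] (p ^ r)) \<subseteq> cyc (a [^] (1 * ?e))"
    by (intro cyc_dvd_mono) simp
  also have "\<dots> \<subseteq> power_subgroup G (carrier G) ?e"
    by (rule cyc_subset_power_subgroup) simp
  finally show "commutator_subgroup G (carrier G) (carrier G) \<subseteq> power_subgroup G (carrier G) ?e"
    using commutator_subgroup_subset[OF normal_imp_subgroup[OF cyc_normal]] commutator_in_cyc
    by (meson subset_trans)
qed

lemma is_powerfully_nilpotent: "powerfully_nilpotent p G"
  unfolding powerfully_nilpotent_def
proof (intro conjI is_powerful exI)
  \<comment> \<open>Below the top the chain runs through the powers of \<open>a\<close>. At the top
    \<open>G\<close> takes the place of \<open>cyc a\<close>: \<open>[G, G]\<close> lies in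
    \<open>cyc (a^(p^2))\<close>, the \<open>p\<close>-th powers of the preceding term.\<close>
  let ?H = "\<lambda>i. if i = n then carrier G else cyc (a [^] (p ^ (n - i)))"
  have n: "0 < n" using r_bounds by simp
  have cyc_1: "cyc \<one> = {\<one>}" by (auto simp: cyc_def)
  then show "?H 0 = {\<one>}" using n a_X by simp
  show "?H n = carrier G" by simp
  show "\<forall>i\<le>n. subgroup (?H i) G"
    using subgroup_self cyc_subgroup[OF finite_carrier] by simp
  show "\<forall>i\<in>{1..n}. ?H (i - 1) \<subseteq> ?H i"
  proof
    fix i assume i: "i \<in> {1..n}"
    then have "p ^ (n - i) dvd p ^ (n - (i - 1))" by (intro le_imp_power_dvd) auto
    then show "?H (i - 1) \<subseteq> ?H i"
      using i cyc_dvd_mono subgroup.subset[OF cyc_subgroup[OF finite_carrier]] by auto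
  qed
  show "\<forall>i\<in>{1..n}. commutator_subgroup G (?H i) (carrier G) \<subseteq> power_subgroup G (?H (i - 1)) p"
  proof
    fix i assume i: "i \<in> {1..n}"
    let ?N = "cyc (a [^] (p ^ (n - i + 2)))"
    have "commutator G x y \<in> ?N" if "x \<in> ?H i" "y \<in> carrier G" for x y
    proof (cases "i = n")
      case True
      then have "commutator G x y \<in> cyc (a [^] (p ^ r))"
        using that commutator_in_cyc by simp
      also have "\<dots> \<subseteq> ?N"
        using True r_bounds by (intro cyc_dvd_mono le_imp_power_dvd) simp
      finally show ?thesis .
    next
      case False
      with that obtain k where "x = a [^] (p ^ (n - i) * k)"
        by (auto elim!: cycE simp: nat_pow_pow)
      then show ?thesis using commutator_a_pow that by simp
    qed
    then have "commutator_subgroup G (?H i) (carrier G) \<subseteq> ?N"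
      by (intro commutator_subgroup_subset normal_imp_subgroup[OF cyc_normal])
    also have "n - i + 2 = Suc (n - (i - 1))"
      using i by auto
    also have "p ^ Suc (n - (i - 1)) = p ^ (n - (i - 1)) * p"
      by simp
    also have "cyc (a [^] (p ^ (n - (i - 1)) * p)) \<subseteq> power_subgroup G (?H (i - 1)) p"
    proof (rule cyc_subset_power_subgroup)
      show "a [^] (p ^ (n - (i - 1)) * k) \<in> ?H (i - 1)" for k
        using i by (auto intro: cyc_pow_mult)
    qed
    finally show "commutator_subgroup G (?H i) (carrier G) \<subseteq> power_subgroup G (?H (i - 1)) p" .
  qed
qed

lemma not_commutative: "\<not> comm_group G"
proof
  assume "comm_group G"
  then have "a \<otimes> b = b \<otimes> a"
    by (simp add: comm_group.axioms(1) comm_monoid.m_comm comm_group_def)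
  then have "commutator G a b = \<one>"
    by (simp add: commutator_eq_one_iff)
  then have "a [^] (p ^ r) = \<one>"
    by (simp add: commutator_ab)
  then show False using a_pow_one_iff p_power_dvd_iff r_bounds by simp
qed

section \<open>Exponents of the group and of its commutator quotient\<close>

lemma b_prime_power:
  assumes "m \<le> e" shows "b [^] (j * p ^ e) = a [^] (p ^ l * (p ^ (e - m) * j))"
proof -
  have "j * p ^ e = p ^ m * (p ^ (e - m) * j)"
    using assms power_add[of p m "e - m"] by simp
  then have "b [^] (j * p ^ e) = (b [^] (p ^ m)) [^] (p ^ (e - m) * j)"
    by (simp only: nat_pow_pow[OF b])
  then show ?thesis by (simp add: b_Y nat_pow_pow)
qed

text \<open>The order of \<open>a\<close> is \<open>p^n\<close> and that of \<open>b\<close> is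
  \<open>p^(m + n - l)\<close>, and \<open>dvd_geo_prime_power\<close> transfers the bound to all
  products. So \<open>max n (m + n - l)\<close> is the logarithm of the exponent of
  \<open>G\<close>.\<close>

lemma trivial_power_iff: "(\<forall>g \<in> carrier G. g [^] (p ^ e) = \<one>) \<longleftrightarrow> n \<le> e \<and> m + n \<le> e + l"
proof
  assume *: "\<forall>g \<in> carrier G. g [^] (p ^ e) = \<one>"
  then have "a [^] (p ^ e) = \<one>" by auto
  then have n: "n \<le> e" by (simp only: a_pow_one_iff p_power_dvd_iff)
  have be: "b [^] (p ^ e) = \<one>" using * by auto
  then have "p ^ m dvd p ^ e" using b_pow_eq_a_pow_dvd[of "p ^ e" 0] by simp
  then have m: "m \<le> e" by (simp only: p_power_dvd_iff)
  then have "a [^] (p ^ (l + (e - m))) = \<one>"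
    using b_prime_power[of e 1] be unfolding power_add by simp
  then have "n \<le> l + (e - m)" by (simp only: a_pow_one_iff p_power_dvd_iff)
  with n m show "n \<le> e \<and> m + n \<le> e + l" by simp
next
  assume e: "n \<le> e \<and> m + n \<le> e + l"
  then have m: "m \<le> e" "n \<le> l + (e - m)" using r_bounds by auto
  show "\<forall>g \<in> carrier G. g [^] (p ^ e) = \<one>"
  proof
    fix g assume "g \<in> carrier G"
    then obtain j i :: nat where g: "g = b [^] j \<otimes> a [^] i" by (rule form_exists)
    have "b [^] (j * p ^ e) = a [^] (p ^ (l + (e - m)) * j)"
      using b_prime_power[OF m(1)] by (simp add: power_add mult.assoc)
    also have "\<dots> = \<one>"
      using m by (auto simp: a_pow_one_iff le_imp_power_dvd)
    finally have "b [^] (j * p ^ e) = \<one>" .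
    moreover have "p ^ n dvd i * geo ((1 + p ^ r) ^ j) (p ^ e)"
      using dvd_geo_prime_power[OF prime_p cong_one] e le_imp_power_dvd dvd_trans by (meson dvd_mult)
    ultimately show "g [^] (p ^ e) = \<one>"
      using a_pow_one_iff by (simp only: g pow_form) simp
  qed
qed

text \<open>Modulo the derived subgroup \<open>cyc (a^(p^r))\<close> the orders of \<open>a\<close>
  and \<open>b\<close> are \<open>p^r\<close> and \<open>p^m\<close>, as \<open>r < l\<close>. So
  \<open>max r m\<close> is the logarithm of the exponent of the abelianisation.\<close>

lemma power_in_derived_iff:
  "(\<forall>g \<in> carrier G. g [^] (p ^ e) \<in> cyc (a [^] (p ^ r))) \<longleftrightarrow> r \<le> e \<and> m \<le> e"
proof
  assume *: "\<forall>g \<in> carrier G. g [^] (p ^ e) \<in> cyc (a [^] (p ^ r))"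
  from *[rule_format, OF b] obtain k where "b [^] (p ^ e) = a [^] (p ^ r * k)"
    by (auto elim!: cycE simp: nat_pow_pow)
  then have m: "m \<le> e" using b_pow_eq_a_pow_dvd p_power_dvd_iff by metis
  from *[rule_format, OF a] obtain k :: nat where "a [^] (p ^ e) = (a [^] (p ^ r)) [^] k"
    by (rule cycE)
  \<comment> \<open>The exponent \<open>p^(n - r)\<close> kills \<open>a^(p^r)\<close>, so the
    equation becomes a statement on the order of \<open>a\<close>.\<close>
  then have "(a [^] (p ^ e)) [^] (p ^ (n - r)) = (a [^] (p ^ r * p ^ (n - r))) [^] k"
    by (simp add: nat_pow_pow mult_ac)
  also have "p ^ r * p ^ (n - r) = p ^ n" using r_bounds by (simp flip: power_add)
  finally have "a [^] (p ^ (e + (n - r))) = \<one>"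
    by (simp add: a_X nat_pow_pow power_add)
  then have "n \<le> e + (n - r)" by (simp only: a_pow_one_iff p_power_dvd_iff)
  with m r_bounds show "r \<le> e \<and> m \<le> e" by simp
next
  assume e: "r \<le> e \<and> m \<le> e"
  show "\<forall>g \<in> carrier G. g [^] (p ^ e) \<in> cyc (a [^] (p ^ r))"
  proof
    fix g assume "g \<in> carrier G"
    then obtain j i :: nat where g: "g = b [^] j \<otimes> a [^] i" by (rule form_exists)
    have "b [^] (j * p ^ e) = a [^] (p ^ l * (p ^ (e - m) * j))"
      using b_prime_power e by blast
    then have "g [^] (p ^ e) = a [^] (p ^ l * (p ^ (e - m) * j) + i * geo ((1 + p ^ r) ^ j) (p ^ e))"
      by (simp only: g pow_form nat_pow_mult[OF a])
    moreover have "p ^ r dvd p ^ l * (p ^ (e - m) * j)"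
      using r_bounds by (intro dvd_mult2 le_imp_power_dvd) simp
    moreover have "p ^ r dvd i * geo ((1 + p ^ r) ^ j) (p ^ e)"
      using dvd_geo_prime_power[OF prime_p cong_one] e le_imp_power_dvd dvd_trans by (meson dvd_mult)
    ultimately show "g [^] (p ^ e) \<in> cyc (a [^] (p ^ r))"
      by (simp add: cyc_pow_mult)
  qed
qed

end

section \<open>Recovering the parameters from the group\<close>

lemma derived_cyc_subset:
  assumes "powerful_pair G a b p n m l r" "powerful_pair G c d p n' m' l' r'"
  shows "group.cyc G (a [^]\<^bsub>G\<^esub> (p ^ r)) \<subseteq> group.cyc G (c [^]\<^bsub>G\<^esub> (p ^ r'))"
proof -
  interpret A: powerful_pair G a b p n m l r by fact
  interpret C: powerful_pair G c d p n' m' l' r' by fact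
  have "a [^]\<^bsub>G\<^esub> (p ^ r) \<in> A.cyc (c [^]\<^bsub>G\<^esub> (p ^ r'))"
    using C.commutator_in_cyc[OF A.a A.b] A.commutator_ab by simp
  then show ?thesis
    by (auto elim!: A.cycE simp: A.nat_pow_pow intro!: A.cyc_pow_mult)
qed

text \<open>The derived subgroup is generated by \<open>a^(p^r)\<close>, of order
  \<open>p^(n - r)\<close>, and also by \<open>c^(p^r')\<close>, so it is killed by
  \<open>p^(n' - r')\<close>.\<close>

lemma derived_length_le:
  assumes "powerful_pair G a b p n m l r" "powerful_pair G c d p n' m' l' r'"
  shows "n - r \<le> n' - r'"
proof -
  interpret A: powerful_pair G a b p n m l r by fact
  interpret C: powerful_pair G c d p n' m' l' r' by fact
  have "a [^]\<^bsub>G\<^esub> (p ^ r) \<in> A.cyc (c [^]\<^bsub>G\<^esub> (p ^ r'))"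
    using derived_cyc_subset[OF assms] A.cycI[of "a [^]\<^bsub>G\<^esub> (p ^ r)" 1] by auto
  then obtain k where "a [^]\<^bsub>G\<^esub> (p ^ r) = c [^]\<^bsub>G\<^esub> (p ^ r' * k)"
    by (auto elim!: A.cycE simp: A.nat_pow_pow)
  then have "(a [^]\<^bsub>G\<^esub> (p ^ r)) [^]\<^bsub>G\<^esub> (p ^ (n' - r')) = c [^]\<^bsub>G\<^esub> (p ^ r' * p ^ (n' - r') * k)"
    by (simp add: A.nat_pow_pow mult_ac)
  also have "p ^ r' * p ^ (n' - r') = p ^ n'" using C.r_bounds by (simp flip: power_add)
  finally have "a [^]\<^bsub>G\<^esub> (p ^ (r + (n' - r'))) = \<one>\<^bsub>G\<^esub>"
    using C.a_pow_one_iff by (simp add: A.nat_pow_pow power_add)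
  then have "n \<le> r + (n' - r')" by (simp only: A.a_pow_one_iff A.p_power_dvd_iff)
  then show ?thesis by simp
qed

text \<open>This separates the families: the exponent is given by \<open>max n m\<close> for (I) and
  is larger for (II). The bound \<open>m + (n - r)\<close> comes from \<open>r < l\<close> and
  serves \<open>canonical_not_swapped\<close>.\<close>

lemma canonical_exponent:
  assumes "canonical n m l r"
  shows "l = n \<Longrightarrow> max n (m + n - l) = max n m"
    "l < n \<Longrightarrow> max n (m + n - l) = m + n - l \<and> max n m < m + n - l \<and> m + n - l < m + (n - r)"
  using assms by (auto simp: canonical_def)

text \<open>For \<open>r < m\<close>, the case \<open>l' < n'\<close> would give
  \<open>l' < r < m < l'\<close>. So \<open>l' = n'\<close> and the second exponent is given by
  \<open>n' = m + (n - r)\<close>, which exceeds the first one.\<close>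

lemma canonical_not_swapped:
  assumes c: "canonical n m l r" "canonical n' r l' m"
    and n: "n - r = n' - m" and E: "max n (m + n - l) = max n' (r + n' - l')"
  shows "\<not> r < m"
proof
  assume "r < m"
  have l': "l' = n'" using c(2) \<open>r < m\<close> by (auto simp: canonical_def)
  have E': "max n (m + n - l) = max n' r" using E l' canonical_exponent(1)[OF c(2)] by simp
  have "n = r + (n - r)" "n' = m + (n - r)" "0 < n - r"
    using c n by (auto simp: canonical_def)
  then show False
    using E' canonical_exponent[OF c(1)] \<open>r < m\<close> c(1)
    by (cases "l = n") (auto simp: canonical_def max_def split: if_splits)
qed

lemma canonical_invariants:
  assumes c: "canonical n m l r" "canonical n' m' l' r'"
    and 1: "n + m = n' + m'" and 2: "n - r = n' - r'" and 3: "max r m = max r' m'"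
    and 4: "max n (m + n - l) = max n' (m' + n' - l')"
  shows "r = r' \<and> n = n' \<and> m = m' \<and> l = l'"
proof -
  have n: "n = r + (n - r)" "n' = r' + (n - r)"
    using c 2 by (auto simp: canonical_def)
  then have sum: "r + m = r' + m'" using 1 by linarith
  have same: "r = r'"
  proof (rule ccontr)
    assume "r \<noteq> r'"
    \<comment> \<open>Sum and maximum determine \<open>r\<close> and \<open>m\<close> up to
      order.\<close>
    then have "r' = m" "m' = r"
      using 3 sum by (auto simp: max_def split: if_splits)
    with canonical_not_swapped[of n m l r n' l'] canonical_not_swapped[of n' r l' m n l] c 2 4 \<open>r \<noteq> r'\<close>
    show False by simp
  qed
  then have eq: "n = n'" "m = m'" using n sum by auto
  have "l \<le> n" "l' \<le> n" using c eq by (auto simp: canonical_def)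
  then have "l = l'"
    using canonical_exponent[OF c(1)] canonical_exponent[OF c(2)] 4 eq
    by (cases "l = n"; cases "l' = n") auto
  with same eq show ?thesis by simp
qed

text \<open>
  \<open>n + m\<close>, \<open>n - r\<close>, \<open>max r m\<close> and \<open>max n (m + n - l)\<close> are determined by \<open>|G|\<close>, \<open>|[G, G]|\<close>
  and the exponents of \<open>G / [G, G]\<close> and \<open>G\<close>.
\<close>

lemma powerful_pair_unique:
  assumes "powerful_pair G a b p n m l r" "powerful_pair G c d p n' m' l' r'"
  shows "n = n'" "m = m'" "l = l'" "r = r'"
proof -
  interpret A: powerful_pair G a b p n m l r by fact
  interpret C: powerful_pair G c d p n' m' l' r' by fact
  have "p ^ (n + m) = p ^ (n' + m')"
    using A.order C.order by (simp add: power_add)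
  then have 1: "n + m = n' + m'" using A.p_gt_1 by simp
  have cyc_eq: "A.cyc (a [^]\<^bsub>G\<^esub> (p ^ r)) = A.cyc (c [^]\<^bsub>G\<^esub> (p ^ r'))"
    using derived_cyc_subset[OF assms] derived_cyc_subset[OF assms(2,1)] by (rule subset_antisym)
  have 2: "n - r = n' - r'"
    using derived_length_le[OF assms] derived_length_le[OF assms(2,1)] by (rule le_antisym)
  have 3: "r \<le> e \<and> m \<le> e \<longleftrightarrow> r' \<le> e \<and> m' \<le> e" for e
    using A.power_in_derived_iff[of e] C.power_in_derived_iff[of e] cyc_eq by simp
  have 4: "n \<le> e \<and> m + n \<le> e + l \<longleftrightarrow> n' \<le> e \<and> m' + n' \<le> e + l'" for e
    using A.trivial_power_iff[of e] C.trivial_power_iff[of e] by simp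
  have 3: "max r m = max r' m'"
    using 3[of "max r m"] 3[of "max r' m'"] by auto
  have 4: "max n (m + n - l) = max n' (m' + n' - l')"
    using 4[of "max n (m + n - l)"] 4[of "max n' (m' + n' - l')"] by arith
  have "r = r' \<and> n = n' \<and> m = m' \<and> l = l'"
    using canonical_invariants[OF A.canonical C.canonical 1 2 3 4] by blast
  then show "n = n'" "m = m'" "l = l'" "r = r'" by auto
qed

lemma (in group) satisfies_relations_exponent_cong:
  assumes "a [^] k = a [^] k'"
  shows "satisfies_relations G a b X Y k z \<longleftrightarrow> satisfies_relations G a b X Y k' z"
  using assms by (auto simp: satisfies_relations_def)

lemma listed_group_params_of:
  "listed_group p (params_of n m l r)
     = presented_group (two_gen_relators (p ^ n) (p ^ m) (if l = n then 0 else p ^ l) (p ^ r))"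
  by (simp add: params_of_def group_I_presentation group_II_presentation)

text \<open>The model requires \<open>(1 + p^r)^(p^m) = 1\<close> modulo \<open>p^n\<close>, which
  follows from \<open>p^m dvd geo (1 + p^r) (p^m)\<close> and \<open>n \<le> m + r\<close>, and
  \<open>p^l * (1 + p^r) = p^l\<close>, which follows from \<open>n \<le> l + r\<close>.\<close>

lemma listed_group_powerful_pair:
  assumes p: "Factorial_Ring.prime p" and c: "canonical n m l r"
  obtains a b where "powerful_pair (listed_group p (params_of n m l r)) a b p n m l r"
proof -
  have p1: "1 < p" using prime_gt_1_nat[OF p] .
  let ?k = "if l = n then 0 else p ^ l"
  let ?L = "listed_group p (params_of n m l r)"
  have pos: "0 < n" "0 < m" "2 \<le> r" "n \<le> m + r" using c by (auto simp: canonical_def)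
  have "p ^ 2 dvd p ^ r" using pos by (intro le_imp_power_dvd)
  then have "[1 + p ^ r = 1 + 0] (mod p ^ 2)"
    by (intro cong_add) (auto simp: cong_0_iff)
  then have "p ^ m dvd geo (1 + p ^ r) (p ^ m)"
    using prime_power_dvd_geo_iff[OF p] by simp
  then have "p ^ n dvd p ^ r * geo (1 + p ^ r) (p ^ m)"
    using pos le_imp_power_dvd[of n "r + m" p] by (simp add: power_add) (meson dvd_trans mult_dvd_mono dvd_refl)
  then have "[1 + p ^ r * geo (1 + p ^ r) (p ^ m) = 1 + 0] (mod p ^ n)"
    by (intro cong_add) (auto simp: cong_0_iff)
  then have 1: "[(1 + p ^ r) ^ (p ^ m) = 1] (mod p ^ n)"
    by (simp only: power_eq_geo add_0_right)
  have 2: "[?k * (1 + p ^ r) = ?k] (mod p ^ n)"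
  proof (cases "l = n")
    case False
    then have "p ^ n dvd p ^ (l + r)"
      using c by (intro le_imp_power_dvd) (auto simp: canonical_def)
    then have "[p ^ l + p ^ l * p ^ r = p ^ l + 0] (mod p ^ n)"
      by (intro cong_add) (auto simp: cong_0_iff power_add)
    with False show ?thesis by (simp add: algebra_simps)
  qed simp
  obtain a b where ab: "faithful_pair ?L a b (p ^ n) (p ^ m) ?k (p ^ r)"
    using two_gen_presentation_faithful[OF _ _ 1 2] pos one_less_power[OF p1]
    unfolding listed_group_params_of by blast
  interpret faithful_pair ?L a b "p ^ n" "p ^ m" ?k "p ^ r" by (rule ab)
  \<comment> \<open>For \<open>l = n\<close> the exponents 0 and \<open>p^n\<close> give the same
    power of \<open>a\<close>.\<close>
  have "satisfies_relations ?L a b (p ^ n) (p ^ m) (p ^ l) (p ^ r)"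
    using rels satisfies_relations_exponent_cong[of a ?k "p ^ l"] a_X by (auto split: if_splits)
  then have "powerful_pair ?L a b p n m l r"
    using gen X Y order p c by unfold_locales
  then show ?thesis by (rule that)
qed

lemma (in powerful_pair) iso_listed_group: "G \<cong> listed_group p (params_of n m l r)"
proof -
  let ?k = "if l = n then 0 else p ^ l"
  interpret faithful_pair G a b "p ^ n" "p ^ m" ?k "p ^ r"
    using rels satisfies_relations_exponent_cong[of a ?k "p ^ l"] a_X gen X Y order
    by unfold_locales (auto split: if_splits)
  show ?thesis
    unfolding listed_group_params_of by (rule iso_presented_group)
qed

lemma (in powerful_pair) iso_powerful_pair:
  assumes "G \<cong> H" "group H"
  obtains c d where "powerful_pair H c d p n m l r"
proof -
  obtain \<phi> where \<phi>: "\<phi> \<in> iso G H" using assms(1) by (auto simp: is_iso_def)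
  interpret H: group H by fact
  interpret \<phi>: group_hom G H \<phi>
    using \<phi> by unfold_locales (simp add: iso_def)
  have "satisfies_relations H (\<phi> a) (\<phi> b) (p ^ n) (p ^ m) (p ^ l) (p ^ r)"
    using arg_cong[OF a_X, of \<phi>] arg_cong[OF b_Y, of \<phi>] arg_cong[OF commute_b[of 1], of \<phi>]
    by (simp add: satisfies_relations_def \<phi>.hom_nat_pow del: nat_pow_Suc)
  moreover have "generate H {\<phi> a, \<phi> b} = carrier H"
    using \<phi>.generate_img[of "{a, b}"] gen \<phi> by (simp add: iso_def bij_betw_def)
  moreover have "order H = p ^ n * p ^ m"
    using iso_same_card[OF assms(1)] order by (simp add: order_def)
  ultimately have "powerful_pair H (\<phi> a) (\<phi> b) p n m l r"
    using X Y prime_p canonical by unfold_locales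
  then show ?thesis by (rule that)
qed

section \<open>The rank of a non-abelian group with two generators\<close>

lemma cyclic_commute:
  assumes "group G" "generate G {g} = carrier G" "g \<in> carrier G"
  shows "comm_group G"
proof -
  interpret group G by fact
  show ?thesis
  proof (rule group_comm_groupI)
    fix x y assume "x \<in> carrier G" "y \<in> carrier G"
    then obtain i j :: int where "x = g [^]\<^bsub>G\<^esub> i" "y = g [^]\<^bsub>G\<^esub> j"
      using generate_pow[OF assms(3)] assms(2) by auto
    then show "x \<otimes>\<^bsub>G\<^esub> y = y \<otimes>\<^bsub>G\<^esub> x"
      using assms(3) by (simp add: add.commute flip: int_pow_mult)
  qed
qed

lemma group_rank_two_generators:
  assumes "group G" and ab: "a \<in> carrier G" "b \<in> carrier G" "generate G {a, b} = carrier G"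
    and nc: "\<not> comm_group G"
  shows "group_rank G = 2"
  unfolding group_rank_def
proof (rule Least_equality)
  interpret group G by fact
  have "a \<noteq> b"
  proof
    assume "a = b"
    with ab(3) have "generate G {a} = carrier G" by simp
    from cyclic_commute[OF assms(1) this ab(1)] nc show False by simp
  qed
  with ab show "\<exists>S \<subseteq> carrier G. finite S \<and> card S = 2 \<and> generate G S = carrier G"
    by (intro exI[of _ "{a, b}"]) auto
  fix k assume "\<exists>S \<subseteq> carrier G. finite S \<and> card S = k \<and> generate G S = carrier G"
  then obtain S where S: "S \<subseteq> carrier G" "finite S" "card S = k" "generate G S = carrier G" by blast
  show "2 \<le> k"
  proof (rule ccontr)
    assume "\<not> 2 \<le> k"
    then consider "card S = 0" | "card S = 1" using S by linarith
    then obtain g where "g \<in> carrier G" "generate G {g} = carrier G"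
    proof cases
      case 1
      then have "generate G {\<one>\<^bsub>G\<^esub>} = carrier G"
        using S generate_empty generate_one by simp
      then show ?thesis using that by blast
    next
      case 2
      then obtain g where "S = {g}" using card_1_singletonE by blast
      then show ?thesis using that S by blast
    qed
    then show False using cyclic_commute[OF assms(1)] nc by blast
  qed
qed


section \<open>Normalising a metacyclic presentation\<close>

context group
begin

lemma pow_cong:
  assumes "x \<in> carrier G" "x [^] (N :: nat) = \<one>" "[i = j] (mod N)"
  shows "x [^] i = x [^] j"
proof -
  have "x [^] k = x [^] (k mod N)" for k
  proof -
    have "x [^] k = (x [^] N) [^] (k div N) \<otimes> x [^] (k mod N)"
      using assms(1) by (simp add: nat_pow_pow nat_pow_mult)
    then show ?thesis using assms by simp
  qed
  from this[of i] this[of j] show ?thesis using assms(3) by (simp add: cong_def)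
qed

lemma nat_pow_one_plus: "x \<in> carrier G \<Longrightarrow> x [^] (1 + k :: nat) = x \<otimes> x [^] k"
  using nat_pow_Suc2[of x k] by simp

lemma left_cancel_iff:
  "x \<in> carrier G \<Longrightarrow> y \<in> carrier G \<Longrightarrow> z \<in> carrier G \<Longrightarrow> x \<otimes> y = x \<otimes> z \<longleftrightarrow> y = z"
  by simp

lemma generate_pair_eq_carrier:
  assumes "generate G {a, b} = carrier G" "c \<in> carrier G" "d \<in> carrier G"
    and "a \<in> generate G {c, d}" "b \<in> generate G {c, d}"
  shows "generate G {c, d} = carrier G"
proof -
  have sub: "subgroup (generate G {c, d}) G"
    using assms by (intro generate_is_subgroup) auto
  then have "generate G {a, b} \<subseteq> generate G {c, d}"
    using assms generate_subgroup_incl[of "{a, b}"] by simp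
  with assms(1) subgroup.subset[OF sub] show ?thesis by simp
qed

lemma nat_pow_in_generate:
  assumes "S \<subseteq> carrier G" "x \<in> generate G S" shows "x [^] (k :: nat) \<in> generate G S"
  using subgroup_nat_pow_closed[OF generate_is_subgroup] assms by blast

end

locale prime_power_group = group G for G (structure) +
  fixes p E :: nat
  assumes prime_p: "Factorial_Ring.prime p" and order: "order G = p ^ E"
begin

lemma p_gt_1: "1 < p" using prime_gt_1_nat[OF prime_p] .

lemma p_power_dvd_iff: "p ^ i dvd p ^ j \<longleftrightarrow> i \<le> j"
  using p_gt_1 by (simp add: dvd_power_iff_le)

lemma finite_carrier: "finite (carrier G)"
  using order order_gt_0_iff_finite p_gt_1 by simp

lemma pow_order: "x \<in> carrier G \<Longrightarrow> x [^] (p ^ E) = \<one>"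
  using pow_order_eq_1[of x] order by simp

lemma pow_unit_inverse:
  assumes "\<not> p dvd k" "x \<in> carrier G"
  obtains k' where "\<not> p dvd k'" "(x [^] k) [^] (k' :: nat) = x"
proof -
  obtain k' where k': "[k * k' = 1] (mod p ^ E)" "\<not> p dvd k'"
    using inverse_mod_prime_power[OF prime_p assms(1)] by blast
  have "(x [^] k) [^] k' = x [^] (1 :: nat)"
    using pow_cong[OF assms(2) pow_order[OF assms(2)] k'(1)] assms(2) by (simp add: nat_pow_pow)
  with k'(2) assms(2) that show ?thesis by simp
qed

lemma ord_prime_power:
  assumes "x \<in> carrier G"
  obtains n where "\<And>i :: nat. x [^] i = \<one> \<longleftrightarrow> p ^ n dvd i"
proof -
  have "ord x dvd p ^ E" using ord_dvd_group_order[OF assms] order by simp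
  then obtain n where "ord x = p ^ n" using divides_primepow_nat[OF prime_p] by blast
  with that pow_eq_id[OF assms] show ?thesis by simp
qed

lemma split_prime_power:
  assumes "0 < i" obtains s w where "i = p ^ s * w" "\<not> p dvd w"
  using multiplicity_decompose'[of i p] assms prime_p not_prime_unit by (metis not_gr_zero)

lemma subgroup_pow_unit:
  assumes "subgroup H G" "x \<in> carrier G" "\<not> p dvd k" "x [^] k \<in> H" shows "x \<in> H"
  using pow_unit_inverse[OF assms(3,2)] subgroup_nat_pow_closed[OF assms(1,4)] by metis

text \<open>If \<open>x^(p^s * w)\<close> lies in \<open>H\<close> with \<open>w\<close> prime to
  \<open>p\<close>, then so does \<open>x^(p^s)\<close>; hence the least \<open>p\<close>-power
  exponent that leads into \<open>H\<close> divides all others.\<close>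

lemma coset_order_prime_power:
  assumes H: "subgroup H G" and x: "x \<in> carrier G"
  obtains m where "\<And>j :: nat. x [^] j \<in> H \<longleftrightarrow> p ^ m dvd j"
proof -
  let ?P = "\<lambda>m. x [^] (p ^ m) \<in> H"
  have "?P E" using pow_order[OF x] subgroup.one_closed[OF H] by simp
  define m where "m = (LEAST m. ?P m)"
  have m: "?P m" unfolding m_def by (rule LeastI[of ?P, OF \<open>?P E\<close>])
  have "x [^] j \<in> H \<longleftrightarrow> p ^ m dvd j" for j :: nat
  proof
    assume j: "x [^] j \<in> H"
    show "p ^ m dvd j"
    proof (cases "j = 0")
      case False
      then obtain s w where sw: "j = p ^ s * w" "\<not> p dvd w"
        using split_prime_power by blast
      then have "(x [^] (p ^ s)) [^] w \<in> H" using j x by (simp add: nat_pow_pow)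
      then have "?P s" using subgroup_pow_unit[OF H _ sw(2)] x by simp
      then have "m \<le> s" unfolding m_def by (rule Least_le)
      then show ?thesis unfolding sw(1) by (intro dvd_mult2 le_imp_power_dvd)
    qed simp
  next
    assume "p ^ m dvd j"
    then obtain d where "j = p ^ m * d" by blast
    then have "x [^] j = (x [^] (p ^ m)) [^] d" using x by (simp add: nat_pow_pow)
    then show "x [^] j \<in> H" using m subgroup_nat_pow_closed[OF H] by simp
  qed
  then show ?thesis by (rule that)
qed

end

text \<open>An intermediate stage: the relations have the final shape, while \<open>l\<close> is not
  yet compared with \<open>r\<close> and \<open>m\<close>.\<close>

locale normalized_pair = faithful_pair G a b "p ^ n" "p ^ m" "p ^ l" "p ^ r"
  for G (structure) and a b and p n m l r :: nat +
  assumes prime_p: "Factorial_Ring.prime p" and r: "2 \<le> r" "r < n" and l: "l \<le> n"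
begin

sublocale prime_power_group G p "n + m"
  using prime_p order by unfold_locales (simp_all add: power_add)

lemma q_cong: "[1 + p ^ r = 1] (mod p ^ 2)"
proof -
  have "p ^ 2 dvd p ^ r" using r by (intro le_imp_power_dvd)
  then have "[1 + p ^ r = 1 + 0] (mod p ^ 2)" by (intro cong_add) (auto simp: cong_0_iff)
  then show ?thesis by simp
qed

text \<open>The element \<open>a^(p^l) = b^(p^m)\<close> commutes with \<open>b\<close>, so its
  commutator \<open>a^(p^l * p^r)\<close> is trivial.\<close>

lemma n_le_l_r: "n \<le> l + r"
proof -
  have "a [^] (p ^ l) \<otimes> b = b \<otimes> a [^] (p ^ l)"
    using group_commutes_pow[of b b "p ^ m"] by (simp flip: b_Y)
  then have "b \<otimes> a [^] (p ^ l) \<otimes> a [^] (p ^ l * p ^ r) = b \<otimes> a [^] (p ^ l) \<otimes> \<one>"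
    using pow_a_b[of "p ^ l"] by (simp add: nat_pow_mult m_assoc)
  then have "a [^] (p ^ (l + r)) = \<one>"
    using left_cancel_iff[of "b \<otimes> a [^] (p ^ l)" "a [^] (p ^ l * p ^ r)" \<one>] by (simp add: power_add)
  then show ?thesis by (simp only: a_pow_one_iff p_power_dvd_iff)
qed

text \<open>The element \<open>b^(p^m)\<close> is a power of \<open>a\<close>, so conjugation by it
  fixes \<open>a\<close>. Thus \<open>p^n\<close> divides \<open>(1 + p^r)^(p^m) - 1\<close>, which
  has valuation \<open>r + m\<close>.\<close>

lemma n_le_m_r: "n \<le> m + r"
proof -
  have "a \<otimes> b [^] (p ^ m) = b [^] (p ^ m) \<otimes> a"
    unfolding b_Y using nat_pow_comm_pow[of a a 1 "p ^ l"] by simp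
  moreover have "a \<otimes> b [^] (p ^ m) = b [^] (p ^ m) \<otimes> a [^] ((1 + p ^ r) ^ (p ^ m))"
    using pow_a_pow_b[of 1 "p ^ m"] by simp
  ultimately have "b [^] (p ^ m) \<otimes> a = b [^] (p ^ m) \<otimes> a [^] (1 + p ^ r * geo (1 + p ^ r) (p ^ m))"
    by (simp only: power_eq_geo)
  then have "a \<otimes> a [^] (p ^ r * geo (1 + p ^ r) (p ^ m)) = a \<otimes> \<one>"
    by (simp add: nat_pow_Suc2 del: nat_pow_Suc)
  then have "a [^] (p ^ r * geo (1 + p ^ r) (p ^ m)) = \<one>"
    using left_cancel_iff[of a _ \<one>] by simp
  then have "p ^ (n - r) * p ^ r dvd geo (1 + p ^ r) (p ^ m) * p ^ r"
    using r by (simp add: a_pow_one_iff mult.commute flip: power_add)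
  then have "p ^ (n - r) dvd geo (1 + p ^ r) (p ^ m)"
    using p_gt_1 by simp
  then have "n - r \<le> m"
    using prime_power_dvd_geo_iff[OF prime_p q_cong] p_power_dvd_iff by blast
  then show ?thesis by simp
qed

lemma b_pow_one_imp:
  assumes "b [^] (p ^ e) = \<one>" shows "m + n \<le> e + l"
proof -
  have "p ^ m dvd p ^ e" using b_pow_eq_a_pow_dvd[of "p ^ e" 0] assms by simp
  then have m: "m \<le> e" by (simp only: p_power_dvd_iff)
  then have "p ^ e = p ^ m * p ^ (e - m)" by (simp flip: power_add)
  then have "b [^] (p ^ e) = (b [^] (p ^ m)) [^] (p ^ (e - m))" by (simp add: nat_pow_pow)
  then have "a [^] (p ^ (l + (e - m))) = \<one>"
    using assms unfolding power_add by (simp add: b_Y nat_pow_pow)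
  then have "n \<le> l + (e - m)" by (simp only: a_pow_one_iff p_power_dvd_iff)
  with m show ?thesis by simp
qed

lemma split_extension:
  assumes "m \<le> l"
  obtains c where "powerful_pair G a c p n m n r"
proof -
  obtain u where u: "geo (1 + p ^ r) (p ^ m) = p ^ m * u" "[u = 1] (mod p)"
    using geo_prime_power[OF prime_p q_cong] by blast
  then obtain v where v: "[u * v = 1] (mod p ^ n)"
    using inverse_mod_prime_power[OF prime_p not_dvd_cong_one[OF prime_p]] by blast
  \<comment> \<open>The exponent of \<open>a\<close> in \<open>?c^(p^m)\<close> is
    \<open>p^l + ?i * geo (1 + p^r) (p^m)\<close>. The sum is \<open>p^m * u\<close>,
    \<open>v\<close> inverts \<open>u\<close>, and \<open>p^n - 1\<close> stands for -1, so this
    exponent vanishes modulo \<open>p^n\<close>.\<close>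
  let ?i = "p ^ (l - m) * (v * (p ^ n - 1))"
  let ?c = "b \<otimes> a [^] ?i"
  have c: "?c \<in> carrier G" by simp
  have "[u * v * (p ^ n - 1) = 1 * (p ^ n - 1)] (mod p ^ n)"
    using v by (intro cong_mult) auto
  then have "[1 + u * v * (p ^ n - 1) = 1 + 1 * (p ^ n - 1)] (mod p ^ n)"
    by (intro cong_add) auto
  then have "p ^ n dvd 1 + u * v * (p ^ n - 1)"
    using p_gt_1 by (simp add: cong_def mod_eq_0_iff_dvd)
  moreover have "p ^ l + ?i * geo (1 + p ^ r) (p ^ m) = p ^ l * (1 + u * v * (p ^ n - 1))"
  proof -
    have "p ^ (l - m) * p ^ m = p ^ l" using assms by (simp flip: power_add)
    then have "p ^ (l - m) * w * (p ^ m * u) = p ^ l * (u * w)" for w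
      by (metis mult.assoc mult.commute)
    from this[of "v * (p ^ n - 1)"] show ?thesis
      unfolding u(1) by (simp only: distrib_left mult_1_right mult.assoc)
  qed
  ultimately have dvd: "p ^ n dvd p ^ l + ?i * geo (1 + p ^ r) (p ^ m)"
    by (simp only:) (rule dvd_mult)
  have "?c [^] (p ^ m) = b [^] (p ^ m) \<otimes> a [^] (?i * geo (1 + p ^ r) (p ^ m))"
    using pow_form[of 1 ?i "p ^ m"] by simp
  also have "\<dots> = a [^] (p ^ l + ?i * geo (1 + p ^ r) (p ^ m))"
    by (simp add: b_Y nat_pow_mult)
  \<comment> \<open>The identity is written as \<open>a^(p^n)\<close> to record the new value
    \<open>l = n\<close>.\<close>
  also have "\<dots> = a [^] (p ^ n)"
    using a_X a_pow_one_iff[THEN iffD2, OF dvd] by (simp only:)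
  finally have c_pow: "?c [^] (p ^ m) = a [^] (p ^ n)" .
  have "a \<otimes> ?c = b \<otimes> (a [^] (1 + p ^ r) \<otimes> a [^] ?i)"
    using pow_a_b[of 1] by (simp add: m_assoc flip: m_assoc[of a b])
  also have "a [^] (1 + p ^ r) \<otimes> a [^] ?i = a [^] ?i \<otimes> a [^] (1 + p ^ r)"
    by (rule nat_pow_comm_pow) auto
  also have "b \<otimes> (a [^] ?i \<otimes> a [^] (1 + p ^ r)) = ?c \<otimes> a [^] (1 + p ^ r)"
    by (rule m_assoc[symmetric]) auto
  finally have "satisfies_relations G a ?c (p ^ n) (p ^ m) (p ^ n) (p ^ r)"
    using c_pow a_X c by (simp add: satisfies_relations_def)
  moreover have "generate G {a, ?c} = carrier G"
  proof (rule generate_pair_eq_carrier[OF gen])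
    have S: "{a, ?c} \<subseteq> carrier G" by simp
    show aS: "a \<in> generate G {a, ?c}" by (rule generate.incl) simp
    have "inv (a [^] ?i) \<in> generate G {a, ?c}"
      using generate_m_inv_closed[OF S] nat_pow_in_generate[OF S aS] by blast
    moreover have "?c \<in> generate G {a, ?c}" by (rule generate.incl) simp
    ultimately have "?c \<otimes> inv (a [^] ?i) \<in> generate G {a, ?c}" by (rule generate.eng[rotated])
    then show "b \<in> generate G {a, ?c}" by (simp add: m_assoc)
  qed auto
  moreover have "canonical n m n r"
    using r n_le_m_r by (simp add: canonical_def)
  ultimately have "powerful_pair G a ?c p n m n r"
    using X Y faithful_pair_axioms prime_p by unfold_locales (auto simp: faithful_pair_axioms_def faithful_pair_def)
  then show ?thesis by (rule that)
qed

lemma canonical_form: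
  assumes "r < l \<or> l = n \<or> m \<le> l"
  obtains c l' where "powerful_pair G a c p n m l' r"
proof (cases "l = n \<or> (l < m \<and> r < l)")
  case True
  then have "canonical n m l r"
    using r l n_le_l_r n_le_m_r by (auto simp: canonical_def)
  then have "powerful_pair G a b p n m l r"
    using faithful_pair_axioms prime_p by (simp add: powerful_pair_def powerful_pair_axioms_def)
  then show ?thesis by (rule that)
next
  case False
  then have "m \<le> l" using assms by auto
  then show ?thesis using split_extension that by blast
qed

end


context prime_power_group
begin

text \<open>Replacing \<open>b\<close> by \<open>b^k\<close> makes the commutator
  \<open>a^(p^r)\<close>; replacing \<open>a\<close> by \<open>a^v\<close> then removes the unit
  from \<open>b^(k * p^m) = a^(p^l * v)\<close>. Exponents prime to \<open>p\<close> preserve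
  generation, and the second change keeps the conjugation exponent \<open>1 + p^r\<close>.\<close>

lemma normalize_pair:
  assumes ab: "a \<in> carrier G" "b \<in> carrier G" "generate G {a, b} = carrier G"
    and twist: "a \<otimes> b = b \<otimes> a [^] (1 + p ^ 2 * s)" and nc: "a \<otimes> b \<noteq> b \<otimes> a"
  obtains k v n m l r where "normalized_pair G (a [^] v) (b [^] k) p n m l r"
    "\<not> p dvd (k :: nat)" "\<not> p dvd (v :: nat)"
proof -
  obtain n where n: "\<And>i :: nat. a [^] i = \<one> \<longleftrightarrow> p ^ n dvd i"
    using ord_prime_power[OF ab(1)] by blast
  have ns: "\<not> p ^ n dvd p ^ 2 * s"
  proof
    assume "p ^ n dvd p ^ 2 * s"
    then have "a [^] (p ^ 2 * s) = \<one>" using n by blast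
    then have "a [^] (1 + p ^ 2 * s) = a" using ab by (simp only: nat_pow_one_plus r_one)
    then show False using twist nc by simp
  qed
  then have "0 < s" by (cases s) auto
  then obtain e u where eu: "s = p ^ e * u" "\<not> p dvd u"
    using split_prime_power by blast
  define r where "r = 2 + e"
  have s: "p ^ 2 * s = p ^ r * u" by (simp add: eu(1) r_def power_add power2_eq_square)
  have r: "2 \<le> r" "r < n"
  proof -
    show "r < n"
    proof (rule ccontr)
      assume "\<not> r < n"
      then have "p ^ n dvd p ^ r * u" by (intro dvd_mult2 le_imp_power_dvd) simp
      with ns show False unfolding s by blast
    qed
  qed (simp add: r_def)
  let ?q = "1 + p ^ r * u"
  have "p ^ 2 dvd p ^ r * u" using r by (intro dvd_mult2 le_imp_power_dvd)
  then have "[?q = 1 + 0] (mod p ^ 2)" by (intro cong_add) (auto simp: cong_0_iff)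
  then have q: "[?q = 1] (mod p ^ 2)" by simp
  obtain u' where u': "[u * u' = 1] (mod p ^ n)" "\<not> p dvd u'"
    using inverse_mod_prime_power[OF prime_p eu(2)] by blast
  \<comment> \<open>As \<open>?q^k = 1 + p^r * u * geo ?q k\<close>, the sum has to invert
    \<open>u\<close>.\<close>
  obtain k where k: "[geo ?q k = u'] (mod p ^ n)"
    using geo_surj_mod[OF prime_p q] by blast
  \<comment> \<open>Modulo \<open>p\<close> the sum is \<open>k\<close>, so \<open>k\<close>
    inherits from \<open>u'\<close> that it is prime to \<open>p\<close>.\<close>
  have "p dvd p ^ n" using r by simp
  then have "[geo ?q k = u'] (mod p)" using k cong_dvd_modulus_nat by blast
  moreover have "[geo ?q k = k] (mod p)"
    by (rule geo_cong_p[OF prime_p cong_one_p[OF prime_p q]])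
  ultimately have kp: "\<not> p dvd k"
    using u'(2) cong_dvd_iff by blast
  have "[u * geo ?q k = u * u'] (mod p ^ n)" using k by (intro cong_mult) auto
  with u'(1) have "[u * geo ?q k = 1] (mod p ^ n)" by (rule cong_trans[rotated])
  then have "[1 + p ^ r * (u * geo ?q k) = 1 + p ^ r * 1] (mod p ^ n)"
    by (intro cong_add cong_mult) auto
  then have qk: "[?q ^ k = 1 + p ^ r] (mod p ^ n)"
    by (simp only: power_eq_geo mult.assoc mult_1_right)
  define d where "d = b [^] k"
  have d: "d \<in> carrier G" using ab by (simp add: d_def)
  interpret T: twisted_pair G a b \<one> ?q 0
    using ab twist by unfold_locales (simp_all add: s)
  have "a \<otimes> d = d \<otimes> a [^] (?q ^ k)"
    using T.pow_a_pow_b[of 1 k] by (simp add: d_def)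
  also have "a [^] (?q ^ k) = a [^] (1 + p ^ r)"
    by (rule pow_cong[OF ab(1) n[THEN iffD2, OF dvd_refl] qk])
  finally have ad: "a \<otimes> d = d \<otimes> a [^] (1 + p ^ r)" .
  obtain m where m: "\<And>j :: nat. d [^] j \<in> cyc a \<longleftrightarrow> p ^ m dvd j"
    using coset_order_prime_power[OF cyc_subgroup[OF finite_carrier ab(1)] d] by blast
  obtain l v where lv: "l \<le> n" "\<not> p dvd v" "d [^] (p ^ m) = a [^] (p ^ l * v)"
  proof -
    obtain i :: nat where i: "d [^] (p ^ m) = a [^] i"
      using m[of "p ^ m"] by (auto elim: cycE)
    show ?thesis
    proof (cases "p ^ n dvd i")
      case True
      \<comment> \<open>A trivial power of \<open>d\<close> is recorded as \<open>l = n\<close>,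
        \<open>v = 1\<close>.\<close>
      then have "a [^] i = \<one>" "a [^] (p ^ n * 1) = \<one>" using n by simp_all
      then have "d [^] (p ^ m) = a [^] (p ^ n * 1)" using i by simp
      then show ?thesis using that[of n 1] p_gt_1 by simp
    next
      case False
      then have "0 < i" by (cases i) auto
      then obtain l v where "i = p ^ l * v" "\<not> p dvd v" using split_prime_power by blast
      with False i that[of l v] show ?thesis
        by (meson dvd_mult2 le_imp_power_dvd nat_le_linear)
    qed
  qed
  define c where "c = a [^] v"
  have c: "c \<in> carrier G" using ab by (simp add: c_def)
  have c_one: "c [^] i = \<one> \<longleftrightarrow> p ^ n dvd i" for i :: nat
  proof -
    have "coprime (p ^ n) v" using lv(2) coprime_power_iff[OF prime_p, of v n] by (simp add: coprime_commute)
    then show ?thesis using ab n by (simp add: c_def nat_pow_pow coprime_dvd_mult_right_iff)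
  qed
  interpret T': twisted_pair G a d \<one> "1 + p ^ r" 0
    using ab d ad by unfold_locales simp_all
  have "a [^] v \<otimes> d = d \<otimes> a [^] (v * (1 + p ^ r))"
    using T'.pow_a_b[of v] ab by simp
  then have "c \<otimes> d = d \<otimes> c [^] (1 + p ^ r)"
    by (simp only: c_def nat_pow_pow[OF ab(1)])
  moreover have "c [^] (p ^ n) = \<one>" using c_one by simp
  moreover have "d [^] (p ^ m) = c [^] (p ^ l)"
    using ab lv(3) by (simp add: c_def nat_pow_pow mult.commute)
  ultimately have rels: "satisfies_relations G c d (p ^ n) (p ^ m) (p ^ l) (p ^ r)"
    using c d unfolding satisfies_relations_def by blast
  have gen: "generate G {c, d} = carrier G"
  proof (rule generate_pair_eq_carrier[OF ab(3) c d])
    have sub: "subgroup (generate G {c, d}) G" using c d by (intro generate_is_subgroup) auto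
    show "a \<in> generate G {c, d}"
      using subgroup_pow_unit[OF sub ab(1) lv(2)] by (simp add: c_def generate.incl)
    show "b \<in> generate G {c, d}"
      using subgroup_pow_unit[OF sub ab(2) kp] by (simp add: d_def generate.incl)
  qed
  interpret P: presented_pair G c d "p ^ n" "p ^ m" "p ^ l" "p ^ r"
    using rels gen p_gt_1 by unfold_locales auto
  have c_cyc: "c [^] i \<in> cyc a" for i :: nat
    using ab by (simp add: c_def nat_pow_pow cycI)
  have le: "j = j'"
    if "d [^] j \<otimes> c [^] i = d [^] j' \<otimes> c [^] i'" "j \<le> j'" "j' < p ^ m" for j j' i i' :: nat
  proof -
    have "d [^] j' = d [^] j \<otimes> d [^] (j' - j)" using that d by (simp add: nat_pow_mult)
    then have "d [^] j \<otimes> c [^] i = d [^] j \<otimes> (d [^] (j' - j) \<otimes> c [^] i')"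
      using that c d by (simp add: m_assoc)
    then have "c [^] i = d [^] (j' - j) \<otimes> c [^] i'"
      using c d by simp
    then have "d [^] (j' - j) = c [^] i \<otimes> inv (c [^] i')"
      using c d by (simp add: m_assoc)
    also have "\<dots> \<in> cyc a"
      using cyc_subgroup[OF finite_carrier ab(1)] c_cyc
      by (meson subgroup.m_closed subgroup.m_inv_closed)
    finally have "p ^ m dvd j' - j" using m by simp
    moreover have "j' - j < p ^ m" using that by simp
    ultimately have "j' - j = 0" using nat_dvd_not_less by blast
    then show ?thesis using that by simp
  qed
  have le': "i = i'" if "c [^] i = c [^] i'" "i \<le> i'" "i' < p ^ n" for i i' :: nat
  proof -
    have "c [^] i \<otimes> c [^] (i' - i) = c [^] i'"
      using that(2) c by (simp add: nat_pow_mult)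
    also have "\<dots> = c [^] i \<otimes> \<one>"
      using that(1) c by simp
    finally have "c [^] (i' - i) = \<one>" using c left_cancel_iff[of "c [^] i" _ \<one>] by simp
    then have "p ^ n dvd i' - i" using c_one by simp
    moreover have "i' - i < p ^ n" using that by simp
    ultimately have "i' - i = 0" using nat_dvd_not_less by blast
    then show ?thesis using that by simp
  qed
  have "inj_on (\<lambda>(j, i). d [^] j \<otimes> c [^] i) ({..<p ^ m} \<times> {..<p ^ n})"
  proof (rule inj_onI)
    fix x y
    assume x: "x \<in> {..<p ^ m} \<times> {..<p ^ n}" and y: "y \<in> {..<p ^ m} \<times> {..<p ^ n}"
      and xy: "(case x of (j, i) \<Rightarrow> d [^] j \<otimes> c [^] i) = (case y of (j, i) \<Rightarrow> d [^] j \<otimes> c [^] i)"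
    obtain j i j' i' where eqs: "x = (j, i)" "y = (j', i')" by (cases x, cases y)
    have ji: "j \<in> {..<p ^ m}" "i \<in> {..<p ^ n}" "j' \<in> {..<p ^ m}" "i' \<in> {..<p ^ n}"
      and eq: "d [^] j \<otimes> c [^] i = d [^] j' \<otimes> c [^] i'"
      using x y xy unfolding eqs by simp_all
    have "j = j'"
    proof (cases "j \<le> j'")
      case True
      show ?thesis by (rule le[OF eq True]) (use ji in simp)
    next
      case False
      have "j' = j" by (rule le[OF eq[symmetric]]) (use ji False in simp_all)
      then show ?thesis by simp
    qed
    then have "c [^] i = c [^] i'" using eq c d by simp
    have "i = i'"
    proof (cases "i \<le> i'")
      case True
      show ?thesis by (rule le'[OF \<open>c [^] i = c [^] i'\<close> True]) (use ji in simp)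
    next
      case False
      have "i' = i" by (rule le'[OF \<open>c [^] i = c [^] i'\<close>[symmetric]]) (use ji False in simp_all)
      then show ?thesis by simp
    qed
    with \<open>j = j'\<close> show "x = y" by (simp add: eqs)
  qed
  then have "order G = p ^ n * p ^ m"
    unfolding order_def P.carrier_eq by (subst card_image) auto
  then have "normalized_pair G c d p n m l r"
    using prime_p r lv(1) by unfold_locales auto
  then show ?thesis using that kp lv(2) by (simp add: c_def d_def)
qed

lemma metacyclic_powerful_pair:
  assumes ab: "a \<in> carrier G" "b \<in> carrier G" "generate G {a, b} = carrier G"
    and twist: "a \<otimes> b = b \<otimes> a [^] (1 + p ^ 2 * s)" and nc: "a \<otimes> b \<noteq> b \<otimes> a"
  obtains c d n m l r where "powerful_pair G c d p n m l r"
proof -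
  obtain k v n m l r where kv: "normalized_pair G (a [^] v) (b [^] k) p n m l r"
    "\<not> p dvd (k :: nat)" "\<not> p dvd (v :: nat)"
    by (rule normalize_pair[OF assms])
  define A where "A = a [^] v"
  define B where "B = b [^] k"
  interpret P: normalized_pair G A B p n m l r
    using kv(1) by (simp only: A_def B_def)
  show ?thesis
  proof (cases "r < l \<or> l = n \<or> m \<le> l")
    case True
    obtain c l' where "powerful_pair G A c p n m l' r"
      by (rule P.canonical_form[OF True])
    then show ?thesis by (rule that)
  next
    case False
    then have lr: "l \<le> r" "l < n" "l < m" using P.l by auto
    \<comment> \<open>From \<open>A^(p^l) = B^(p^m)\<close> with \<open>l \<le> r\<close>, the
      commutator \<open>A^(p^r)\<close> is \<open>B^(p^?R)\<close>. Hence \<open>cyc B\<close> is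
      normal too, and the roles can be exchanged.\<close>
    let ?R = "m + (r - l)" and ?N = "m + (n - l)"
    have B_pow: "B [^] (p ^ (m + e)) = A [^] (p ^ (l + e))" for e
      by (simp add: power_add P.b_Y flip: nat_pow_pow)
    have R: "B [^] (p ^ ?R) = A [^] (p ^ r)" using B_pow[of "r - l"] lr by simp
    have N: "B [^] (p ^ ?N) = \<one>" using B_pow[of "n - l"] lr P.a_X by simp
    \<comment> \<open>Exchanging the generators inverts the commutator; \<open>?w\<close> acts as -1
      because \<open>B^(p^?N) = 1\<close>.\<close>
    let ?w = "p ^ ?N - 1"
    have "B [^] (p ^ ?R) \<otimes> B [^] (p ^ ?R * ?w) = B [^] (p ^ ?N * p ^ ?R)"
      using p_gt_1 by (simp add: nat_pow_mult algebra_simps)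
    also have "\<dots> = \<one>"
      using N by (simp flip: nat_pow_pow)
    finally have w: "B [^] (p ^ ?R) \<otimes> B [^] (p ^ ?R * ?w) = \<one>" .
    have AB: "A \<otimes> B = B \<otimes> (A \<otimes> B [^] (p ^ ?R))"
      using P.rels unfolding satisfies_relations_def R by (simp only: nat_pow_one_plus)
    have "A \<otimes> (B \<otimes> B [^] (p ^ ?R * ?w)) = (A \<otimes> B) \<otimes> B [^] (p ^ ?R * ?w)"
      by (simp add: m_assoc)
    also have "\<dots> = B \<otimes> (A \<otimes> (B [^] (p ^ ?R) \<otimes> B [^] (p ^ ?R * ?w)))"
      unfolding AB by (simp add: m_assoc)
    also have "\<dots> = B \<otimes> A" by (simp only: w) simp
    finally have BA: "B \<otimes> A = A \<otimes> B [^] (1 + p ^ ?R * ?w)"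
      by (simp only: nat_pow_one_plus[OF P.b])
    have "p ^ ?R * ?w = p ^ 2 * (p ^ (?R - 2) * ?w)"
    proof -
      have "?R = 2 + (?R - 2)" using lr P.r by arith
      then have "p ^ ?R = p ^ (2 + (?R - 2))" by (rule arg_cong)
      then have "p ^ ?R = p ^ 2 * p ^ (?R - 2)" by (simp only: power_add)
      then show ?thesis by (simp only: mult.assoc)
    qed
    with BA have BA': "B \<otimes> A = A \<otimes> B [^] (1 + p ^ 2 * (p ^ (?R - 2) * ?w))"
      by (simp only:)
    have BA_gen: "generate G {B, A} = carrier G" using P.gen by (simp add: insert_commute)
    have BA_nc: "B \<otimes> A \<noteq> A \<otimes> B"
    proof
      assume "B \<otimes> A = A \<otimes> B"
      then have "commutator G A B = \<one>" by (simp add: commutator_eq_one_iff)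
      then have "A [^] (p ^ r) = \<one>" using P.rels by (simp add: satisfies_relations_iff_commutator)
      then show False using P.a_pow_one_iff p_power_dvd_iff P.r by simp
    qed
    obtain k' v' n' m' l' r' where
      Q: "normalized_pair G (B [^] v') (A [^] k') p n' m' l' r'"
      and "\<not> p dvd (k' :: nat)" and v': "\<not> p dvd (v' :: nat)"
      by (rule normalize_pair[OF P.b P.a BA_gen BA' BA_nc])
    interpret Q: normalized_pair G "B [^] v'" "A [^] k'" p n' m' l' r' by (rule Q)
    have "(A [^] k') [^] (p ^ n) = (A [^] (p ^ n)) [^] k'"
      by (simp add: nat_pow_pow mult.commute)
    then have "(A [^] k') [^] (p ^ n) = \<one>" by (simp add: P.a_X)
    then have "m' + n' \<le> n + l'" by (rule Q.b_pow_one_imp)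
    moreover have "n < n'"
    proof (rule ccontr)
      assume "\<not> n < n'"
      then have "(B [^] v') [^] (p ^ n) = \<one>"
        using Q.a_pow_one_iff p_power_dvd_iff by simp
      moreover obtain v'' where "((B [^] v') [^] (v'' :: nat)) = B"
        using pow_unit_inverse[OF v' P.b] by blast
      ultimately have "B [^] (p ^ n) = \<one>"
        by (metis P.b nat_pow_closed nat_pow_one nat_pow_pow mult.commute)
      then have "m + n \<le> n + l" by (rule P.b_pow_one_imp)
      with lr show False by simp
    qed
    \<comment> \<open>\<open>m' + n' \<le> n + l'\<close> and \<open>n < n'\<close> give
      \<open>m' < l'\<close>, the splitting case.\<close>
    ultimately have "r' < l' \<or> l' = n' \<or> m' \<le> l'" by simp
    then obtain c l'' where "powerful_pair G (B [^] v') c p n' m' l'' r'"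
      by (rule Q.canonical_form)
    then show ?thesis by (rule that)
  qed
qed

end


section \<open>Powerfully nilpotent groups with two generators are metacyclic\<close>

text \<open>Modulo \<open>p\<close> the sum is \<open>N * (N - 1) / 2\<close>. The second factor
  \<open>p\<close> in \<open>N\<close> compensates the division by 2 when
  \<open>p = 2\<close>.\<close>

lemma prime_dvd_sum_geo:
  assumes p: "Factorial_Ring.prime p" and q: "[q = 1] (mod p)" and N: "p ^ 2 dvd N"
  shows "p dvd (\<Sum>M<N. geo q M)"
proof -
  have "[(\<Sum>M<N. geo q M) = \<Sum>{..<N}] (mod p)"
    by (intro cong_sum geo_cong_p[OF p q])
  moreover have "p dvd \<Sum>{..<N}"
  proof -
    have "N * (N - 1) = 2 * \<Sum>{..<N}"
    proof -
      have "even (N * (N - 1))" by (cases N) auto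
      then show ?thesis using Sum_Ico_nat[of 0 N] by (simp add: lessThan_atLeast0)
    qed
    then have "p ^ 2 dvd 2 * \<Sum>{..<N}" using N by (metis dvd_mult2)
    then have pp: "p * p dvd 2 * \<Sum>{..<N}" by (simp add: power2_eq_square)
    show ?thesis
    proof (cases "p = 2")
      case True
      then show ?thesis using pp by simp
    next
      case False
      then have "coprime p 2" using primes_coprime[OF p two_is_prime_nat] by simp
      moreover have "p dvd 2 * \<Sum>{..<N}" using pp dvd_mult_left by blast
      ultimately show ?thesis by (simp add: coprime_dvd_mult_right_iff)
    qed
  qed
  ultimately show ?thesis using cong_dvd_iff by blast
qed

lemma split_common_prime_power:
  assumes p: "Factorial_Ring.prime (p :: nat)" and "i \<noteq> 0 \<or> j \<noteq> 0"
  obtains e i' j' where "i = p ^ e * i'" "j = p ^ e * j'" "\<not> p dvd i' \<or> \<not> p dvd j'"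
proof -
  define d where "d = gcd i j"
  have "d \<noteq> 0" using assms(2) by (simp add: d_def)
  then obtain e w where w: "d = p ^ e * w" "\<not> p dvd w"
    using multiplicity_decompose'[of d p] p not_prime_unit by metis
  obtain i1 j1 where ij: "i = d * i1" "j = d * j1" "coprime i1 j1"
    using gcd_coprime_exists[of i j] \<open>d \<noteq> 0\<close> unfolding d_def by (metis mult.commute)
  have "i = p ^ e * (w * i1)" "j = p ^ e * (w * j1)"
    using ij(1,2) by (simp_all only: w(1) mult.assoc)
  moreover have "\<not> p dvd w * i1 \<or> \<not> p dvd w * j1"
  proof (rule ccontr)
    assume "\<not> ?thesis"
    then have "p dvd i1" "p dvd j1" using w(2) p prime_dvd_mult_iff by blast+
    then show False using ij(3) p coprime_common_divisor not_prime_unit by blast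
  qed
  ultimately show ?thesis by (rule that)
qed

context prime_power_group
begin

text \<open>
  Writing the commutator of \<open>g\<close> and \<open>h\<close>, which lies in \<open>(G\<^sup>p)\<^sup>p\<close>, as a power of a new
  generator \<open>h\<^sup>j g\<^sup>i\<close> absorbs the central element \<open>z\<close>.
\<close>

lemma absorb_central_element:
  assumes gh: "g \<in> carrier G" "h \<in> carrier G" "generate G {g, h} = carrier G"
    and z: "z \<in> carrier G" "\<And>x. x \<in> carrier G \<Longrightarrow> z \<otimes> x = x \<otimes> z" "z [^] p = \<one>"
    and twist: "commutator G g h = g [^] (p ^ 2 * s) \<otimes> z [^] (t :: nat)"
    and comm: "commutator G g h \<in> power_subgroup G (power_subgroup G (carrier G) p) p"
  obtains i j :: nat where "\<not> p dvd i \<or> \<not> p dvd j"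
    "\<forall>x \<in> carrier G. \<forall>y \<in> carrier G. commutator G x y \<in> cyc ((h [^] j \<otimes> g [^] i) [^] (p ^ 2))"
proof -
  let ?q = "1 + p ^ 2 * s"
  have twist': "g \<otimes> h = h \<otimes> (g [^] ?q \<otimes> z [^] t)"
  proof -
    have "g \<otimes> h = h \<otimes> (g \<otimes> (g [^] (p ^ 2 * s) \<otimes> z [^] t))"
      using twist gh z(1) by (simp add: commutator_eq_iff)
    also have "g \<otimes> (g [^] (p ^ 2 * s) \<otimes> z [^] t) = g [^] ?q \<otimes> z [^] t"
      unfolding nat_pow_one_plus[OF gh(1)] using gh z(1) by (simp add: m_assoc)
    finally show ?thesis .
  qed
  interpret T: twisted_pair G g h z ?q t
    using gh z twist' by unfold_locales auto
  have q2: "[?q = 1] (mod p ^ 2)"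
    using cong_add[of 1 1 "p ^ 2" "p ^ 2 * s" 0] by (simp add: cong_0_iff)
  have q: "[?q ^ j = 1] (mod p)" for j
    using cong_pow[OF cong_one_p[OF prime_p q2], of j] by simp
  have z_dvd: "z [^] k = \<one>" if "p dvd k" for k
  proof -
    from that obtain d where "k = p * d" by blast
    then have "z [^] k = (z [^] p) [^] d" using z(1) by (simp add: nat_pow_pow)
    then show ?thesis using z(3) by simp
  qed
  have elt_dvd: "T.elt j i k = T.elt j i 0" if "p dvd k" for j i k
    using z_dvd[OF that] by (simp add: T.elt_def)
  have elt_all: "\<exists>j i k. x = T.elt j i k" if "x \<in> carrier G" for x
  proof -
    let ?A = "{T.elt j i k | j i k. True}"
    have "subgroup ?A G"
    proof (rule subgroup_of_finite_order[OF _ _ _ finite_carrier])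
      have "\<one> = T.elt 0 0 0" by (simp add: T.elt_def)
      then show "\<one> \<in> ?A" by blast
      fix x y assume "x \<in> ?A" "y \<in> ?A"
      then show "x \<otimes> y \<in> ?A" using T.elt_mult by force
    qed auto
    moreover have "g = T.elt 0 1 0" "h = T.elt 1 0 0" using gh by (simp_all add: T.elt_def)
    then have "{g, h} \<subseteq> ?A" by blast
    ultimately have "carrier G \<subseteq> ?A" using generate_subgroup_incl gh(3) by metis
    with that show ?thesis by blast
  qed
  have geo_p: "p dvd geo (?q ^ j) p" for j
    using dvd_geo_prime_power[OF prime_p q, of 1 j] by simp
  \<comment> \<open>A set of normal forms containing \<open>G^p\<close>; here the exponent of
    \<open>z\<close> is still arbitrary.\<close>
  let ?F = "{T.elt (p * j) (p * i) k | j i k. True}"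
  have F: "power_subgroup G (carrier G) p \<subseteq> ?F"
  proof (rule power_subgroup_subset)
    show "subgroup ?F G"
    proof (rule subgroup_of_finite_order[OF _ _ _ finite_carrier])
      have "\<one> = T.elt (p * 0) (p * 0) 0" by (simp add: T.elt_def)
      then show "\<one> \<in> ?F" by blast
      fix x y assume "x \<in> ?F" "y \<in> ?F"
      then obtain j i k j' i' k' where "x = T.elt (p * j) (p * i) k" "y = T.elt (p * j') (p * i') k'"
        by blast
      then have "x \<otimes> y = T.elt (p * (j + j')) (p * (i * ?q ^ (p * j') + i'))
          (k + k' + p * i * t * geo ?q (p * j'))"
        by (simp only: T.elt_mult distrib_left mult.assoc)
      then show "x \<otimes> y \<in> ?F" by blast
    qed auto
    fix x assume "x \<in> carrier G"
    then obtain j i k where x: "x = T.elt j i k" using elt_all by blast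
    obtain d where "geo (?q ^ j) p = p * d" using geo_p by blast
    then have "x [^] p = T.elt (p * j) (p * (i * d))
        (k * p + i * t * geo ?q j * (\<Sum>M<p. geo (?q ^ j) M))"
      unfolding x T.elt_pow by (simp only: mult_ac)
    then show "x [^] p \<in> ?F" by blast
  qed
  \<comment> \<open>In \<open>p\<close>-th powers of elements of \<open>?F\<close>, and in products
    of the results, the exponent of \<open>z\<close> is a multiple of \<open>p\<close>. So
    \<open>z\<close> drops out, which leaves an expression for \<open>[g, h]\<close> in
    \<open>g\<close> and \<open>h\<close> alone.\<close>
  let ?F2 = "{T.elt (p ^ 2 * j) (p ^ 2 * i) 0 | j i. True}"
  have "power_subgroup G (power_subgroup G (carrier G) p) p \<subseteq> ?F2"
  proof (rule power_subgroup_subset)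
    show "subgroup ?F2 G"
    proof (rule subgroup_of_finite_order[OF _ _ _ finite_carrier])
      have "\<one> = T.elt (p ^ 2 * 0) (p ^ 2 * 0) 0" by (simp add: T.elt_def)
      then show "\<one> \<in> ?F2" by blast
      fix x y assume "x \<in> ?F2" "y \<in> ?F2"
      then obtain j i j' i' where "x = T.elt (p ^ 2 * j) (p ^ 2 * i) 0" "y = T.elt (p ^ 2 * j') (p ^ 2 * i') 0"
        by blast
      then have "x \<otimes> y = T.elt (p ^ 2 * (j + j')) (p ^ 2 * (i * ?q ^ (p ^ 2 * j') + i'))
          (0 + 0 + p ^ 2 * i * t * geo ?q (p ^ 2 * j'))"
        by (simp only: T.elt_mult distrib_left mult.assoc)
      also have "\<dots> = T.elt (p ^ 2 * (j + j')) (p ^ 2 * (i * ?q ^ (p ^ 2 * j') + i')) 0"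
        by (rule elt_dvd) (simp add: power2_eq_square)
      finally show "x \<otimes> y \<in> ?F2" by blast
    qed auto
    fix x assume "x \<in> power_subgroup G (carrier G) p"
    then obtain j i k where x: "x = T.elt (p * j) (p * i) k" using F by blast
    obtain d where d: "geo (?q ^ (p * j)) p = p * d" using geo_p by blast
    have "x [^] p = T.elt (p * j * p) (p * i * (p * d))
        (k * p + p * i * t * geo ?q (p * j) * (\<Sum>M<p. geo (?q ^ (p * j)) M))"
      unfolding x T.elt_pow d ..
    also have "\<dots> = T.elt (p * j * p) (p * i * (p * d)) 0"
      by (rule elt_dvd) (simp add: mult.assoc)
    also have "\<dots> = T.elt (p ^ 2 * j) (p ^ 2 * (i * d)) 0"
      by (simp only: power2_eq_square mult_ac)
    finally show "x [^] p \<in> ?F2" by blast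
  qed
  with comm obtain j i where ji: "commutator G g h = T.elt (p ^ 2 * j) (p ^ 2 * i) 0" by blast
  define c where "c = commutator G g h"
  have c: "c \<in> carrier G" using gh by (simp add: c_def)
  have "c \<otimes> g = g \<otimes> c"
  proof -
    have "g [^] (p ^ 2 * s) \<otimes> (z [^] t \<otimes> g) = g \<otimes> g [^] (p ^ 2 * s) \<otimes> z [^] t"
      using gh z nat_pow_comm_pow[of z g t 1] nat_pow_comm_pow[of g g "p ^ 2 * s" 1]
      by (simp flip: m_assoc)
    then show ?thesis using gh z(1) by (simp add: c_def twist m_assoc)
  qed
  have c_q: "c [^] ?q = g [^] (p ^ 2 * s * ?q) \<otimes> z [^] (t * ?q)"
    using gh z(1) pow_mult_distrib[of "g [^] (p ^ 2 * s)" "z [^] t" ?q]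
      nat_pow_comm_pow[of g z "p ^ 2 * s" t] z(2)[OF gh(1)]
    by (simp only: c_def twist nat_pow_pow nat_pow_closed)
  have "z [^] (t * ?q) = z [^] t \<otimes> z [^] (t * (p ^ 2 * s))"
    using z(1) by (simp add: nat_pow_mult algebra_simps)
  also have "z [^] (t * (p ^ 2 * s)) = \<one>" by (rule z_dvd) (simp add: power2_eq_square)
  finally have zq: "z [^] (t * ?q) = z [^] t" using z(1) by simp
  have "c \<otimes> h = g [^] (p ^ 2 * s) \<otimes> h \<otimes> z [^] t"
    using gh z nat_pow_comm_pow[of z h t 1] by (simp add: c_def twist m_assoc)
  also have "g [^] (p ^ 2 * s) \<otimes> h = h \<otimes> (g [^] (p ^ 2 * s * ?q) \<otimes> z [^] (p ^ 2 * s * t))"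
    by (rule T.pow_a_b)
  also have "z [^] (p ^ 2 * s * t) = \<one>" by (rule z_dvd) (simp add: power2_eq_square)
  also have "h \<otimes> (g [^] (p ^ 2 * s * ?q) \<otimes> \<one>) \<otimes> z [^] t = h \<otimes> c [^] ?q"
    unfolding c_q zq using gh z(1) by (simp add: m_assoc del: nat_pow_Suc)
  finally have ch: "c \<otimes> h = h \<otimes> c [^] ?q" .
  interpret C: twisted_pair G c h \<one> ?q 0
    using c gh ch by unfold_locales (simp_all del: nat_pow_Suc)
  \<comment> \<open>\<open>c\<close> commutes with \<open>g\<close>, and \<open>h\<close> conjugates
    it to \<open>c^?q\<close>, since the surplus powers of \<open>z\<close> have exponents divisible
    by \<open>p\<close>.\<close>
  have c_normal: "cyc c \<lhd> G"
  proof (rule normal_of_generators[OF finite_carrier cyc_subgroup[OF finite_carrier c] _ gh(3)])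
    fix x y assume "x \<in> cyc c" and y: "y \<in> {g, h}"
    then obtain k :: nat where k: "x = c [^] k" by (auto elim: cycE)
    have "c [^] k \<otimes> g = g \<otimes> c [^] k"
      using group_commutes_pow[OF \<open>c \<otimes> g = g \<otimes> c\<close> c gh(1)] .
    moreover have "c [^] k \<otimes> h = h \<otimes> c [^] (k * ?q)"
      using C.pow_a_b[of k] c by simp
    ultimately show "\<exists>x' \<in> cyc c. x \<otimes> y = y \<otimes> x'"
      using y k cycI by blast
  qed (use gh in auto)
  have comm_c: "commutator G x y \<in> cyc c" if "x \<in> carrier G" "y \<in> carrier G" for x y
    using commutators_in_normal_pair[OF finite_carrier c_normal gh _ that] cycI[of c 1] c
    by (simp add: c_def)
  show ?thesis
  proof (cases "i = 0 \<and> j = 0")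
    case True
    then have "c = \<one>" using ji by (simp add: c_def T.elt_def)
    then have "cyc c = {\<one>}" by (auto simp: cyc_def)
    moreover have "\<one> \<in> cyc x" for x using cycI[of x 0] by simp
    moreover have "\<not> p dvd 1" using p_gt_1 by simp
    ultimately show ?thesis using that[of 1 0] comm_c by (metis singletonD)
  next
    case False
    then obtain e i' j' where e: "i = p ^ e * i'" "j = p ^ e * j'" "\<not> p dvd i' \<or> \<not> p dvd j'"
      using split_common_prime_power[OF prime_p] by (metis (no_types))
    \<comment> \<open>Raising \<open>h^j' g^(i' * v)\<close> to the power \<open>?N\<close>
      multiplies the exponent of \<open>g\<close> by \<open>?N * u\<close>; \<open>v\<close> cancels
      the unit \<open>u\<close>. As \<open>p^2\<close> divides \<open>?N\<close>,
      \<open>prime_dvd_sum_geo\<close> makes the exponent of \<open>z\<close> a multiple of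
      \<open>p\<close>, so the result is \<open>c\<close>.\<close>
    let ?N = "p ^ (2 + e)"
    have "[?q ^ j' = 1] (mod p ^ 2)" using cong_pow[OF q2, of j'] by simp
    then obtain u where u: "geo (?q ^ j') ?N = ?N * u" "[u = 1] (mod p)"
      by (rule geo_prime_power[OF prime_p])
    obtain v where v: "[u * v = 1] (mod p ^ E)" "\<not> p dvd v"
      using inverse_mod_prime_power[OF prime_p not_dvd_cong_one[OF prime_p u(2)]] by blast
    have "p dvd (\<Sum>M<?N. geo (?q ^ j') M)"
      by (rule prime_dvd_sum_geo[OF prime_p q]) (intro le_imp_power_dvd, simp)
    then have "T.elt j' (i' * v) 0 [^] ?N = T.elt (j' * ?N) (i' * v * (?N * u)) 0"
      unfolding T.elt_pow u(1) by (intro elt_dvd) simp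
    also have "g [^] (i' * v * (?N * u)) = g [^] (i' * ?N)"
    proof (rule pow_cong[OF gh(1) pow_order[OF gh(1)]])
      have "[i' * ?N * (u * v) = i' * ?N * 1] (mod p ^ E)"
        using v(1) by (intro cong_mult) auto
      then show "[i' * v * (?N * u) = i' * ?N] (mod p ^ E)" by (simp add: mult_ac)
    qed
    then have "T.elt (j' * ?N) (i' * v * (?N * u)) 0 = T.elt (j' * ?N) (i' * ?N) 0"
      by (simp add: T.elt_def)
    also have "\<dots> = c"
      by (simp only: c_def ji e(1) e(2) power_add mult_ac)
    finally have "(h [^] j' \<otimes> g [^] (i' * v)) [^] ?N = c"
      using gh by (simp add: T.elt_def)
    then have "c = (h [^] j' \<otimes> g [^] (i' * v)) [^] (p ^ 2 * p ^ e)"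
      by (simp only: power_add)
    then have "c = ((h [^] j' \<otimes> g [^] (i' * v)) [^] (p ^ 2)) [^] (p ^ e)"
      using gh by (simp add: nat_pow_pow)
    then have "cyc c \<subseteq> cyc ((h [^] j' \<otimes> g [^] (i' * v)) [^] (p ^ 2))"
      using gh by (auto simp: nat_pow_pow elim!: cycE intro!: cyc_pow_mult)
    moreover have "\<not> p dvd i' * v \<or> \<not> p dvd j'"
      using e(3) v(2) prime_p prime_dvd_mult_iff by blast
    ultimately show ?thesis using that[of "i' * v" j'] comm_c by blast
  qed
qed

end


section \<open>Commutators and power subgroups in quotients\<close>

lemma (in normal) coset_eq_iff:
  assumes "x \<in> carrier G" "y \<in> carrier G"
  shows "H #> x = H #> y \<longleftrightarrow> inv y \<otimes> x \<in> H"
proof -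
  have "H #> x = H #> y \<longleftrightarrow> x \<in> H #> y"
    using assms rcos_self[OF _ subgroup_axioms] repr_independence[OF _ _ subgroup_axioms] by metis
  also have "\<dots> \<longleftrightarrow> x \<otimes> inv y \<in> H"
    using rcos_module[OF is_group] assms by blast
  also have "\<dots> \<longleftrightarrow> inv y \<otimes> x \<in> H"
  proof
    assume "x \<otimes> inv y \<in> H"
    then have "inv y \<otimes> (x \<otimes> inv y) \<otimes> y \<in> H" using assms by (intro inv_op_closed1)
    then show "inv y \<otimes> x \<in> H" using assms by (simp add: m_assoc)
  next
    assume "inv y \<otimes> x \<in> H"
    then have "y \<otimes> (inv y \<otimes> x) \<otimes> inv y \<in> H" using assms by (intro inv_op_closed2)
    then show "x \<otimes> inv y \<in> H" using assms by (simp flip: m_assoc)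
  qed
  finally show ?thesis .
qed

lemma (in normal) coset_hom: "group_hom G (G Mod H) (\<lambda>x. H #> x)"
  using factorgroup_is_group r_coset_hom_Mod is_group
  by (simp add: group_hom_def group_hom_axioms_def)

lemma (in group_hom) hom_commutator:
  "x \<in> carrier G \<Longrightarrow> y \<in> carrier G \<Longrightarrow> h (commutator G x y) = commutator H (h x) (h y)"
  by (simp add: commutator_def)

lemma (in group_hom) image_power_subgroup:
  assumes "S \<subseteq> carrier G"
  shows "h ` power_subgroup G S k = power_subgroup H (h ` S) k"
proof -
  have "h ` (\<lambda>x. x [^]\<^bsub>G\<^esub> k) ` S = (\<lambda>x. x [^]\<^bsub>H\<^esub> k) ` h ` S"
    using assms by (force simp: hom_nat_pow image_image)
  moreover have "(\<lambda>x. x [^]\<^bsub>G\<^esub> k) ` S \<subseteq> carrier G" using assms by auto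
  ultimately show ?thesis
    unfolding power_subgroup_def using generate_img[of "(\<lambda>x. x [^]\<^bsub>G\<^esub> k) ` S"] by simp
qed

lemma (in group) normal_power_subgroup:
  assumes "H \<lhd> G" shows "power_subgroup G H k \<lhd> G"
proof -
  interpret H: normal H G by fact
  have conj_pow: "g \<otimes> x [^] (j :: nat) \<otimes> inv g = (g \<otimes> x \<otimes> inv g) [^] j"
    if "g \<in> carrier G" "x \<in> carrier G" for g x j
  proof (induction j)
    case (Suc j)
    have "inv g \<otimes> (g \<otimes> y) = y" if "y \<in> carrier G" for y
      using that \<open>g \<in> carrier G\<close> by (simp flip: m_assoc)
    with that Suc[symmetric] show ?case by (simp add: m_assoc)
  qed (use that in simp)
  show ?thesis
    unfolding power_subgroup_def
  proof (rule normal_generateI)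
    fix y g assume "y \<in> (\<lambda>x. x [^] k) ` H" and g: "g \<in> carrier G"
    then obtain x where x: "x \<in> H" "y = x [^] k" by blast
    then have "g \<otimes> y \<otimes> inv g = (g \<otimes> x \<otimes> inv g) [^] k" using conj_pow g by simp
    moreover have "g \<otimes> x \<otimes> inv g \<in> H" using x g by (simp add: H.inv_op_closed2)
    ultimately show "g \<otimes> y \<otimes> inv g \<in> (\<lambda>x. x [^] k) ` H" by blast
  qed auto
qed

lemma (in group) power_subgroup_mono:
  assumes "H \<subseteq> K" shows "power_subgroup G H k \<subseteq> power_subgroup G K k"
  unfolding power_subgroup_def using assms by (intro mono_generate) auto

section \<open>Central chains, nongenerators and lifting generators along a central series\<close>

locale central_chain = prime_power_group +
  fixes H :: "nat \<Rightarrow> 'a set" and N :: nat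
  assumes H_bot: "H 0 = {\<one>}" and H_top: "H N = carrier G"
    and H_sub: "i \<le> N \<Longrightarrow> subgroup (H i) G"
    and H_comm: "1 \<le> i \<Longrightarrow> i \<le> N \<Longrightarrow> x \<in> H i \<Longrightarrow> y \<in> carrier G \<Longrightarrow> commutator G x y \<in> H (i - 1)"
begin

lemma chain_leaves:
  assumes "subgroup C G" "C \<noteq> carrier G"
  obtains i where "1 \<le> i" "i \<le> N" "\<not> H i \<subseteq> C" "H (i - 1) \<subseteq> C"
proof -
  define i where "i = (LEAST i. \<not> H i \<subseteq> C)"
  have N: "\<not> H N \<subseteq> C" using assms H_top subgroup.subset by blast
  then have i: "\<not> H i \<subseteq> C" unfolding i_def by (rule LeastI)
  have "i \<le> N" unfolding i_def using N by (rule Least_le)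
  moreover have "i \<noteq> 0"
    using i H_bot subgroup.one_closed[OF assms(1)] by (cases i) auto
  moreover have "H (i - 1) \<subseteq> C"
    using not_less_Least[of "i - 1" "\<lambda>i. \<not> H i \<subseteq> C"] \<open>i \<noteq> 0\<close> unfolding i_def by linarith
  ultimately show ?thesis using i that[of i] by simp
qed

text \<open>Take \<open>x\<close> outside \<open>C\<close> in the first chain term not contained in
  \<open>C\<close>: its powers have all commutators in the previous term, hence in \<open>C\<close>.
  The last \<open>p\<close>-power of \<open>x\<close> outside \<open>C\<close> serves as
  \<open>z\<close>. This is applied to maximal subgroups and to normal subgroups.\<close>

lemma central_element_modulo:
  assumes C: "subgroup C G" "C \<noteq> carrier G"
  obtains z where "z \<in> carrier G" "z \<notin> C" "z [^] p \<in> C"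
    "\<And>y. y \<in> carrier G \<Longrightarrow> commutator G z y \<in> C"
proof -
  obtain i where i: "1 \<le> i" "i \<le> N" "\<not> H i \<subseteq> C" "H (i - 1) \<subseteq> C"
    by (rule chain_leaves[OF C])
  then obtain x where x: "x \<in> H i" "x \<notin> C" by blast
  have xG: "x \<in> carrier G" using x subgroup.subset[OF H_sub[OF i(2)]] by blast
  obtain m where m: "\<And>j :: nat. x [^] j \<in> C \<longleftrightarrow> p ^ m dvd j"
    using coset_order_prime_power[OF C(1) xG] by blast
  have "m \<noteq> 0"
  proof
    assume "m = 0"
    then have "x [^] (1 :: nat) \<in> C" unfolding m by simp
    then show False using x xG by simp
  qed
  let ?z = "x [^] (p ^ (m - 1))"
  have "?z \<in> H i" using subgroup_nat_pow_closed[OF H_sub[OF i(2)] x(1)] .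
  then have "commutator G ?z y \<in> C" if "y \<in> carrier G" for y
    using H_comm[OF i(1,2)] that i(4) by blast
  moreover have "?z \<notin> C"
    unfolding m p_power_dvd_iff using \<open>m \<noteq> 0\<close> by simp
  moreover have "?z [^] p \<in> C"
  proof -
    have "p ^ (m - 1) * p = p ^ m" using \<open>m \<noteq> 0\<close> by (cases m) simp_all
    then show ?thesis using xG m[of "p ^ m"] by (simp add: nat_pow_pow)
  qed
  ultimately show ?thesis using that[of ?z] xG by simp
qed

text \<open>The element \<open>z\<close> normalises \<open>C\<close>, as its commutators lie in
  \<open>C\<close>, and \<open>z\<close> and \<open>C\<close> generate \<open>G\<close> by
  maximality. So \<open>C\<close> is normal, and \<open>G Mod C\<close> is generated by the coset of
  \<open>z\<close>, whose \<open>p\<close>-th power is trivial.\<close>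

lemma maximal_subgroup_contains_powers:
  assumes C: "subgroup C G" "C \<noteq> carrier G"
    and max: "\<And>D. subgroup D G \<Longrightarrow> C \<subset> D \<Longrightarrow> D = carrier G"
    and x: "x \<in> carrier G"
  shows "x [^] p \<in> C"
proof -
  obtain z where z: "z \<in> carrier G" "z \<notin> C" "z [^] p \<in> C"
    and comm: "\<And>y. y \<in> carrier G \<Longrightarrow> commutator G z y \<in> C"
    by (rule central_element_modulo[OF C]) blast
  interpret C: subgroup C G by fact
  have gen: "D = carrier G" if "subgroup D G" "insert z C \<subseteq> D" for D
    using max[OF that(1)] that(2) z(2) by blast
  have "C \<lhd> G"
  proof (rule normal_of_generators[OF finite_carrier C(1)])
    show S: "insert z C \<subseteq> carrier G" using z C.subset by simp
    show "generate G (insert z C) = carrier G"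
      using gen[OF generate_is_subgroup[OF S]] generate.incl[of _ "insert z C" G] by blast
    fix y s assume y: "y \<in> C" and s: "s \<in> insert z C"
    show "\<exists>x' \<in> C. y \<otimes> s = s \<otimes> x'"
    proof (cases "s = z")
      case True
      have "commutator G y z = inv (commutator G z y)" using commutator_swap[of z y] y z by simp
      then have "y \<otimes> commutator G y z \<in> C" using comm[of y] y by simp
      moreover have "y \<otimes> z = z \<otimes> (y \<otimes> commutator G y z)"
        using commutator_eq_iff[of y z "commutator G y z"] y z by simp
      ultimately show ?thesis using True by blast
    next
      case False
      then have "inv s \<otimes> y \<otimes> s \<in> C" "y \<otimes> s = s \<otimes> (inv s \<otimes> y \<otimes> s)"
        using s y by (auto simp: m_assoc[symmetric])
      then show ?thesis by blast
    qed
  qed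
  then interpret C: normal C G .
  let ?D = "{y \<in> carrier G. \<exists>i :: nat. C #> y = C #> z [^] i}"
  have "subgroup ?D G"
  proof (rule subgroup_of_finite_order[OF _ _ _ finite_carrier])
    have "C #> \<one> = C #> z [^] (0 :: nat)" by simp
    then show "\<one> \<in> ?D" by blast
    fix y w assume "y \<in> ?D" "w \<in> ?D"
    then obtain i j :: nat where "C #> y = C #> z [^] i" "C #> w = C #> z [^] j"
      and yw: "y \<in> carrier G" "w \<in> carrier G" by blast
    then have "C #> (y \<otimes> w) = C #> z [^] (i + j)"
      using C.rcos_sum[of y w] C.rcos_sum[of "z [^] i" "z [^] j"] z by (simp add: nat_pow_mult)
    with yw show "y \<otimes> w \<in> ?D" by blast
  qed auto
  moreover have "insert z C \<subseteq> ?D"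
  proof
    fix y assume y: "y \<in> insert z C"
    have "C #> y = C #> z [^] (if y = z then 1 else 0 :: nat)"
      using y z coset_join2[OF _ C.subgroup_axioms, of y] C.subset by auto
    then show "y \<in> ?D" using y z C.subset by blast
  qed
  ultimately have "?D = carrier G" by (rule gen)
  then obtain i :: nat where i: "C #> x = C #> z [^] i" using x by blast
  have "C #> x [^] p = C #> (z [^] i) [^] p"
    using C.FactGroup_pow[OF x, of p] C.FactGroup_pow[of "z [^] i" p] z i by simp
  also have "(z [^] i) [^] p = (z [^] p) [^] i"
    using z by (simp add: nat_pow_pow mult.commute)
  also have "C #> (z [^] p) [^] i = C"
    by (rule coset_join2[OF _ C.subgroup_axioms subgroup_nat_pow_closed[OF C.subgroup_axioms z(3)]])
      (use z in simp)
  finally show ?thesis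
    using coset_join1[of C "x [^] p"] x C.subgroup_axioms C.subset by simp
qed

text \<open>A proper subgroup containing \<open>B\<close> of largest order is maximal, hence
  contains \<open>G^p\<close>, contradicting \<open>gen\<close>. So \<open>G^p\<close> lies in the
  Frattini subgroup.\<close>

lemma powers_are_nongenerators:
  assumes B: "subgroup B G"
    and gen: "\<And>C. subgroup C G \<Longrightarrow> B \<subseteq> C \<Longrightarrow> power_subgroup G (carrier G) p \<subseteq> C \<Longrightarrow> C = carrier G"
  shows "B = carrier G"
proof (rule ccontr)
  assume "B \<noteq> carrier G"
  let ?P = "\<lambda>C. subgroup C G \<and> B \<subseteq> C \<and> C \<noteq> carrier G"
  have "?P B" using B \<open>B \<noteq> carrier G\<close> by simp
  moreover have "\<forall>C. ?P C \<longrightarrow> card C < Suc (order G)"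
    using finite_carrier by (auto simp: order_def less_Suc_eq_le intro!: card_mono dest: subgroup.subset)
  ultimately obtain C where C: "?P C" and max: "\<forall>D. ?P D \<longrightarrow> card D \<le> card C"
    using ex_has_greatest_nat[of ?P B card "Suc (order G)"] by blast
  have "D = carrier G" if "subgroup D G" "C \<subset> D" for D
  proof (rule ccontr)
    assume "D \<noteq> carrier G"
    then have "card D \<le> card C" using max that C by blast
    moreover have "finite D" using that finite_carrier finite_subset subgroup.subset by blast
    ultimately show False using psubset_card_mono[OF _ that(2)] by simp
  qed
  then have "power_subgroup G (carrier G) p \<subseteq> C"
    using C maximal_subgroup_contains_powers by (intro power_subgroup_subset) auto
  then show False using gen C by blast
qed

text \<open>Induction from \<open>K = G\<close> downwards: \<open>L\<close> is the preimage of a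
  central subgroup of order \<open>p\<close> of \<open>G Mod K\<close>. The error term in
  \<open>L\<close> becomes a power of the central element modulo \<open>K\<close>, and
  \<open>absorb_central_element\<close> removes it by a change of generators.\<close>

lemma metacyclic_modulo:
  assumes ab: "a \<in> carrier G" "b \<in> carrier G" "generate G {a, b} = carrier G"
    and comm: "\<And>x y. x \<in> carrier G \<Longrightarrow> y \<in> carrier G \<Longrightarrow>
      commutator G x y \<in> power_subgroup G (power_subgroup G (carrier G) p) p"
    and K: "K \<lhd> G"
  shows "\<exists>g h s k. g \<in> carrier G \<and> h \<in> carrier G \<and> generate G {g, h} = carrier G \<and>
    k \<in> K \<and> commutator G g h = g [^] (p ^ 2 * s) \<otimes> k"
  using K
proof (induction "order G - card K" arbitrary: K rule: less_induct)
  case less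
  interpret K: normal K G by (rule less.prems)
  show ?case
  proof (cases "K = carrier G")
    case True
    then have "commutator G a b \<in> K" "commutator G a b = a [^] (p ^ 2 * 0) \<otimes> commutator G a b"
      using ab by simp_all
    then show ?thesis using ab by blast
  next
    case False
    obtain z where z: "z \<in> carrier G" "z \<notin> K" "z [^] p \<in> K"
      and z_comm: "\<And>y. y \<in> carrier G \<Longrightarrow> commutator G z y \<in> K"
      by (rule central_element_modulo[OF K.subgroup_axioms False]) blast
    let ?Q = "G Mod K" and ?\<pi> = "\<lambda>x. K #> x"
    have "order ?Q dvd p ^ E"
      using lagrange[OF K.subgroup_axioms] order by (simp add: order_def FactGroup_def) (metis dvd_triv_left)
    then obtain E' where "order ?Q = p ^ E'"
      using divides_primepow_nat[OF prime_p] by blast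
    then interpret Q: prime_power_group ?Q p E'
      using prime_p K.factorgroup_is_group
      by (simp add: prime_power_group_def prime_power_group_axioms_def)
    interpret pi: group_hom G ?Q ?\<pi> by (rule K.coset_hom)
    have pi_surj: "?\<pi> ` carrier G = carrier ?Q" by (simp add: carrier_FactGroup)
    have pi_eq: "?\<pi> x = ?\<pi> y \<longleftrightarrow> (\<exists>k \<in> K. x = y \<otimes> k)"
      if "x \<in> carrier G" "y \<in> carrier G" for x y
    proof -
      have "inv y \<otimes> x \<in> K \<longleftrightarrow> (\<exists>k \<in> K. x = y \<otimes> k)"
      proof
        assume "inv y \<otimes> x \<in> K"
        moreover have "x = y \<otimes> (inv y \<otimes> x)" using that by (simp flip: m_assoc)
        ultimately show "\<exists>k \<in> K. x = y \<otimes> k" by blast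
      next
        assume "\<exists>k \<in> K. x = y \<otimes> k"
        then show "inv y \<otimes> x \<in> K" using that by (auto simp flip: m_assoc)
      qed
      then show ?thesis using K.coset_eq_iff that by simp
    qed
    have pi_one: "?\<pi> x = \<one>\<^bsub>?Q\<^esub> \<longleftrightarrow> x \<in> K" if "x \<in> carrier G" for x
      using K.coset_eq_iff[OF that, of \<one>] that pi.hom_one K.subset by simp
    have zQ: "?\<pi> z \<in> carrier ?Q" using z by simp
    have z_central: "?\<pi> z \<otimes>\<^bsub>?Q\<^esub> x = x \<otimes>\<^bsub>?Q\<^esub> ?\<pi> z" if "x \<in> carrier ?Q" for x
    proof -
      from that obtain y where y: "y \<in> carrier G" "x = ?\<pi> y" using pi_surj by blast
      then have "?\<pi> (commutator G z y) = \<one>\<^bsub>?Q\<^esub>"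
        using pi_one[of "commutator G z y"] z_comm[OF y(1)] z(1) y(1) by simp
      then have "commutator ?Q (?\<pi> z) (?\<pi> y) = \<one>\<^bsub>?Q\<^esub>"
        using pi.hom_commutator[OF z(1) y(1)] by simp
      then show ?thesis using Q.commutator_eq_one_iff that zQ y by blast
    qed
    define L where "L = {x \<in> carrier G. ?\<pi> x \<in> Q.cyc (?\<pi> z)}"
    have cyc_sub: "subgroup (Q.cyc (?\<pi> z)) ?Q"
      by (rule Q.cyc_subgroup[OF Q.finite_carrier zQ])
    have "subgroup L G"
      unfolding L_def
    proof (rule subgroup_of_finite_order[OF _ _ _ finite_carrier])
      show "\<one> \<in> {x \<in> carrier G. ?\<pi> x \<in> Q.cyc (?\<pi> z)}"
        using subgroup.one_closed[OF cyc_sub] pi.hom_one by simp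
      fix x y assume "x \<in> {x \<in> carrier G. ?\<pi> x \<in> Q.cyc (?\<pi> z)}" "y \<in> {x \<in> carrier G. ?\<pi> x \<in> Q.cyc (?\<pi> z)}"
      then show "x \<otimes> y \<in> {x \<in> carrier G. ?\<pi> x \<in> Q.cyc (?\<pi> z)}"
        using subgroup.m_closed[OF cyc_sub] pi.hom_mult by simp
    qed auto
    then have "L \<lhd> G"
    proof (rule normal_invI)
      fix g x assume g: "g \<in> carrier G" and "x \<in> L"
      then obtain t :: nat where x: "x \<in> carrier G" "?\<pi> x = ?\<pi> z [^]\<^bsub>?Q\<^esub> t"
        by (auto simp: L_def elim: Q.cycE)
      have "?\<pi> (g \<otimes> x \<otimes> inv g) = ?\<pi> g \<otimes>\<^bsub>?Q\<^esub> ?\<pi> z [^]\<^bsub>?Q\<^esub> t \<otimes>\<^bsub>?Q\<^esub> inv\<^bsub>?Q\<^esub> ?\<pi> g"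
        using g x by (simp add: pi.hom_mult del: mult_FactGroup)
      also have "?\<pi> g \<otimes>\<^bsub>?Q\<^esub> ?\<pi> z [^]\<^bsub>?Q\<^esub> t = ?\<pi> z [^]\<^bsub>?Q\<^esub> t \<otimes>\<^bsub>?Q\<^esub> ?\<pi> g"
        using g Q.group_commutes_pow[OF z_central[of "?\<pi> g"] zQ, of t] by simp
      finally have "?\<pi> (g \<otimes> x \<otimes> inv g) = ?\<pi> z [^]\<^bsub>?Q\<^esub> t"
        using g zQ by (simp add: Q.m_assoc del: mult_FactGroup one_FactGroup)
      then show "g \<otimes> x \<otimes> inv g \<in> L" using g x Q.cycI by (simp add: L_def)
    qed
    moreover have "K \<subset> L"
    proof -
      have "K \<subseteq> L"
      proof
        fix x assume "x \<in> K"
        then have "x \<in> carrier G" "?\<pi> x = \<one>\<^bsub>?Q\<^esub>"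
          using pi_one[of x] K.subset by auto
        then show "x \<in> L"
          using subgroup.one_closed[OF cyc_sub] unfolding L_def by simp
      qed
      moreover have "z \<in> L"
        using z zQ Q.cycI[of "?\<pi> z" 1] by (simp add: L_def del: mult_FactGroup one_FactGroup)
      ultimately show ?thesis using z by blast
    qed
    moreover have "order G - card L < order G - card K"
    proof -
      have "L \<subseteq> carrier G" by (auto simp: L_def)
      then have "card K < card L" "card L \<le> order G"
        using psubset_card_mono[OF finite_subset[OF _ finite_carrier] \<open>K \<subset> L\<close>] card_mono[OF finite_carrier]
        by (auto simp: order_def)
      then show ?thesis by linarith
    qed
    ultimately obtain g h s k where gh: "g \<in> carrier G" "h \<in> carrier G" "generate G {g, h} = carrier G"
      and k: "k \<in> L" and gh_comm: "commutator G g h = g [^] (p ^ 2 * s) \<otimes> k"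
      using less.hyps[of L] by blast
    obtain t :: nat where t: "k \<in> carrier G" "?\<pi> k = ?\<pi> z [^]\<^bsub>?Q\<^esub> t"
      using k by (auto simp: L_def elim: Q.cycE)
    have ghQ: "?\<pi> g \<in> carrier ?Q" "?\<pi> h \<in> carrier ?Q" using gh by simp_all
    have genQ: "generate ?Q {?\<pi> g, ?\<pi> h} = carrier ?Q"
      using pi.generate_img[of "{g, h}"] gh pi_surj by simp
    have zp: "?\<pi> z [^]\<^bsub>?Q\<^esub> p = \<one>\<^bsub>?Q\<^esub>"
      using pi_one[of "z [^] p"] z pi.hom_nat_pow[of z p] by simp
    have twist: "commutator ?Q (?\<pi> g) (?\<pi> h) = ?\<pi> g [^]\<^bsub>?Q\<^esub> (p ^ 2 * s) \<otimes>\<^bsub>?Q\<^esub> ?\<pi> z [^]\<^bsub>?Q\<^esub> t"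
      using pi.hom_commutator[OF gh(1,2)] gh t gh_comm pi.hom_nat_pow[OF gh(1)]
      by (simp add: pi.hom_mult del: mult_FactGroup)
    have "?\<pi> (commutator G g h) \<in> ?\<pi> ` power_subgroup G (power_subgroup G (carrier G) p) p"
      using comm[OF gh(1,2)] by blast
    also have "\<dots> = power_subgroup ?Q (power_subgroup ?Q (carrier ?Q) p) p"
      using pi.image_power_subgroup[of "carrier G" p] pi.image_power_subgroup[of "power_subgroup G (carrier G) p" p]
        power_subgroup_is_subgroup[of "carrier G" p] subgroup.subset pi_surj by force
    finally have commQ: "commutator ?Q (?\<pi> g) (?\<pi> h) \<in> power_subgroup ?Q (power_subgroup ?Q (carrier ?Q) p) p"
      using pi.hom_commutator[OF gh(1,2)] by simp
    obtain i j :: nat where ij: "\<not> p dvd i \<or> \<not> p dvd j"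
      and ijQ: "\<forall>x \<in> carrier ?Q. \<forall>y \<in> carrier ?Q. commutator ?Q x y \<in>
        Q.cyc ((?\<pi> h [^]\<^bsub>?Q\<^esub> j \<otimes>\<^bsub>?Q\<^esub> ?\<pi> g [^]\<^bsub>?Q\<^esub> i) [^]\<^bsub>?Q\<^esub> (p ^ 2))"
      by (rule Q.absorb_central_element[OF ghQ genQ zQ z_central zp twist commQ])
    define x where "x = h [^] j \<otimes> g [^] i"
    have x: "x \<in> carrier G" using gh by (simp add: x_def)
    have pi_x: "?\<pi> h [^]\<^bsub>?Q\<^esub> j \<otimes>\<^bsub>?Q\<^esub> ?\<pi> g [^]\<^bsub>?Q\<^esub> i = ?\<pi> x"
      using gh by (simp add: x_def pi.hom_mult pi.hom_nat_pow del: mult_FactGroup)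
    have comm_x: "\<exists>s. \<exists>k \<in> K. commutator G x y = x [^] (p ^ 2 * s) \<otimes> k" if y: "y \<in> carrier G" for y
    proof -
      have "commutator ?Q (?\<pi> x) (?\<pi> y) \<in> Q.cyc (?\<pi> x [^]\<^bsub>?Q\<^esub> (p ^ 2))"
        using ijQ x y unfolding pi_x by simp
      then obtain s :: nat where "commutator ?Q (?\<pi> x) (?\<pi> y) = (?\<pi> x [^]\<^bsub>?Q\<^esub> (p ^ 2)) [^]\<^bsub>?Q\<^esub> s"
        by (rule Q.cycE)
      then have "?\<pi> (commutator G x y) = ?\<pi> (x [^] (p ^ 2 * s))"
        using x y pi.hom_commutator[OF x y] pi.hom_nat_pow[OF x, of "p ^ 2 * s"] Q.nat_pow_pow by simp
      then show ?thesis using pi_eq[of "commutator G x y" "x [^] (p ^ 2 * s)"] x y by auto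
    qed
    \<comment> \<open>One of \<open>i\<close>, \<open>j\<close> is prime to \<open>p\<close>, so
      \<open>x\<close> can replace the corresponding generator \<open>g\<close> or
      \<open>h\<close>.\<close>
    have "\<exists>y \<in> carrier G. generate G {x, y} = carrier G"
    proof (cases "p dvd i")
      case False
      have S: "{x, h} \<subseteq> carrier G" using x gh by simp
      have sub: "subgroup (generate G {x, h}) G" by (rule generate_is_subgroup[OF S])
      have in_S: "x \<in> generate G {x, h}" "h \<in> generate G {x, h}" by (auto intro: generate.incl)
      have "g [^] i = inv (h [^] j) \<otimes> x" using gh by (simp add: x_def flip: m_assoc)
      also have "\<dots> \<in> generate G {x, h}"
        using in_S sub subgroup_nat_pow_closed[OF sub] by (meson subgroup.m_closed subgroup.m_inv_closed)
      finally have "g \<in> generate G {x, h}" by (rule subgroup_pow_unit[OF sub gh(1) False])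
      then have "generate G {x, h} = carrier G"
        using generate_pair_eq_carrier[OF gh(3) x gh(2)] in_S by blast
      then show ?thesis using gh by blast
    next
      case True
      then have j: "\<not> p dvd j" using ij by blast
      have S: "{x, g} \<subseteq> carrier G" using x gh by simp
      have sub: "subgroup (generate G {x, g}) G" by (rule generate_is_subgroup[OF S])
      have in_S: "x \<in> generate G {x, g}" "g \<in> generate G {x, g}" by (auto intro: generate.incl)
      have "h [^] j = x \<otimes> inv (g [^] i)" using gh by (simp add: x_def m_assoc)
      also have "\<dots> \<in> generate G {x, g}"
        using in_S sub subgroup_nat_pow_closed[OF sub] by (meson subgroup.m_closed subgroup.m_inv_closed)
      finally have "h \<in> generate G {x, g}" by (rule subgroup_pow_unit[OF sub gh(2) j])
      then have "generate G {x, g} = carrier G"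
        using generate_pair_eq_carrier[OF gh(3) x gh(1)] in_S by blast
      then show ?thesis using gh by blast
    qed
    then obtain y where y: "y \<in> carrier G" "generate G {x, y} = carrier G" by blast
    obtain s k where "k \<in> K" "commutator G x y = x [^] (p ^ 2 * s) \<otimes> k"
      using comm_x[OF y(1)] by blast
    then show ?thesis using x y by (intro exI conjI)
  qed
qed

end


section \<open>From powerful nilpotency to \<open>[G, G]\<close> in the double power
  subgroup\<close>

lemma power_subgroup_4_subset:
  assumes "group G"
  shows "power_subgroup G (carrier G) 4 \<subseteq> power_subgroup G (carrier G) 2"
proof -
  interpret group G by fact
  show ?thesis
  proof (rule power_subgroup_subset[OF power_subgroup_is_subgroup[OF subset_refl]])
    fix x assume x: "x \<in> carrier G"
    then have "x [^]\<^bsub>G\<^esub> (4 :: nat) = (x [^]\<^bsub>G\<^esub> (2 :: nat)) [^]\<^bsub>G\<^esub> (2 :: nat)"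
      by (subst nat_pow_pow) auto
    also have "\<dots> \<in> power_subgroup G (carrier G) 2"
      using x by (intro power_in_power_subgroup) simp
    finally show "x [^]\<^bsub>G\<^esub> (4 :: nat) \<in> power_subgroup G (carrier G) 2" .
  qed
qed

lemma powerful_commutator_in_power_subgroup:
  assumes "powerful p G" "x \<in> carrier G" "y \<in> carrier G"
  shows "commutator G x y \<in> power_subgroup G (carrier G) p"
proof -
  interpret group G using assms(1) by (simp add: powerful_def p_group_def)
  have "commutator G x y \<in> power_subgroup G (carrier G) (if p = 2 then 4 else p)"
    using assms commutator_in_subgroup[of x "carrier G" y "carrier G"] unfolding powerful_def by blast
  then show ?thesis
    using power_subgroup_4_subset[OF is_group] by (auto split: if_splits)
qed

text \<open>As \<open>p\<close>-th powers stay in the term, the chain is central. The sharper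
  condition is kept beside it, since it puts commutators into the double power subgroup.\<close>

lemma powerfully_nilpotent_central_chain:
  assumes p: "Factorial_Ring.prime p" and G: "powerfully_nilpotent p G"
  obtains E H N where "central_chain G p E H N"
    "\<And>i x y. 1 \<le> i \<Longrightarrow> i \<le> N \<Longrightarrow> x \<in> H i \<Longrightarrow> y \<in> carrier G \<Longrightarrow>
      commutator G x y \<in> power_subgroup G (H (i - 1)) p"
proof -
  interpret group G using G by (simp add: powerfully_nilpotent_def powerful_def p_group_def)
  obtain E where E: "order G = p ^ E"
    using G by (auto simp: powerfully_nilpotent_def powerful_def p_group_def)
  obtain N :: nat and H where H: "\<forall>i\<le>N. subgroup (H i) G" "H 0 = {\<one>\<^bsub>G\<^esub>}" "H N = carrier G"
    and comm: "\<forall>i\<in>{1..N}. commutator_subgroup G (H i) (carrier G) \<subseteq> power_subgroup G (H (i - 1)) p"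
    using G unfolding powerfully_nilpotent_def by blast
  have comm': "commutator G x y \<in> power_subgroup G (H (i - 1)) p"
    if "1 \<le> i" "i \<le> N" "x \<in> H i" "y \<in> carrier G" for i x y
    using comm[rule_format, of i] commutator_in_subgroup[OF that(3,4)] that(1,2) by auto
  have "power_subgroup G (H i) p \<subseteq> H i" if "i \<le> N" for i
    using power_subgroup_subset subgroup_nat_pow_closed H(1) that by blast
  then have "commutator G x y \<in> H (i - 1)"
    if "1 \<le> i" "i \<le> N" "x \<in> H i" "y \<in> carrier G" for i x y
    using comm'[OF that] that(2) by (meson diff_le_self le_trans subsetD)
  then have "central_chain G p E H N"
    using p E H by (simp add: central_chain_def central_chain_axioms_def
        prime_power_group_def prime_power_group_axioms_def)
  then show ?thesis using comm' by (rule that)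
qed

context central_chain
begin

text \<open>
  The first term of the chain that is not contained in \<open>F = G\<^sup>p\<close> yields a generator \<open>u\<close> which is
  central modulo \<open>F\<^sup>p\<close>.
\<close>

lemma commutators_in_double_power_subgroup:
  assumes ab: "a \<in> carrier G" "b \<in> carrier G" "generate G {a, b} = carrier G"
    and nontrivial: "carrier G \<noteq> {\<one>}"
    and F: "\<And>x y. x \<in> carrier G \<Longrightarrow> y \<in> carrier G \<Longrightarrow> commutator G x y \<in> power_subgroup G (carrier G) p"
    and chain: "\<And>i x y. 1 \<le> i \<Longrightarrow> i \<le> N \<Longrightarrow> x \<in> H i \<Longrightarrow> y \<in> carrier G \<Longrightarrow>
      commutator G x y \<in> power_subgroup G (H (i - 1)) p"
    and xy: "x \<in> carrier G" "y \<in> carrier G"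
  shows "commutator G x y \<in> power_subgroup G (power_subgroup G (carrier G) p) p"
proof -
  define F where "F = power_subgroup G (carrier G) p"
  have F_normal: "F \<lhd> G"
    unfolding F_def by (rule normal_power_subgroup[OF normal_self])
  interpret F: normal F G by (rule F_normal)
  let ?M = "power_subgroup G F p"
  have M_normal: "?M \<lhd> G" by (rule normal_power_subgroup[OF F_normal])
  \<comment> \<open>If \<open>G^p\<close> were \<open>G\<close>, the trivial subgroup would be all
    of \<open>G\<close>, because \<open>p\<close>-th powers are nongenerators.\<close>
  have "F \<noteq> carrier G"
  proof
    assume "F = carrier G"
    have "{\<one>} = carrier G"
    proof (rule powers_are_nongenerators[OF triv_subgroup])
      fix C assume "subgroup C G" "power_subgroup G (carrier G) p \<subseteq> C"
      then show "C = carrier G"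
        using \<open>F = carrier G\<close> subgroup.subset unfolding F_def by blast
    qed
    with nontrivial show False by simp
  qed
  then obtain i where i: "1 \<le> i" "i \<le> N" "\<not> H i \<subseteq> F" "H (i - 1) \<subseteq> F"
    by (rule chain_leaves[OF F.subgroup_axioms])
  then obtain u where u: "u \<in> H i" "u \<notin> F" by blast
  have uG: "u \<in> carrier G" using u subgroup.subset[OF H_sub[OF i(2)]] by blast
  \<comment> \<open>The preceding chain term lies in \<open>F\<close>, so its \<open>p\<close>-th
    powers lie in \<open>?M\<close>.\<close>
  have u_comm: "commutator G u y \<in> ?M" if "y \<in> carrier G" for y
    using chain[OF i(1,2) u(1) that] power_subgroup_mono[OF i(4)] by blast
  interpret pi: group_hom G "G Mod F" "\<lambda>x. F #> x" by (rule F.coset_hom)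
  have swap: "F #> (x \<otimes> y) = F #> (y \<otimes> x)" if "x \<in> carrier G" "y \<in> carrier G" for x y
  proof -
    have "commutator G x y = inv (y \<otimes> x) \<otimes> (x \<otimes> y)"
      using that by (simp add: commutator_def inv_mult_group m_assoc)
    then show ?thesis
      using F[OF that] that F.coset_eq_iff[of "x \<otimes> y" "y \<otimes> x"] unfolding F_def by simp
  qed
  \<comment> \<open>Commutativity modulo \<open>F\<close> allows \<open>u\<close> to be written as
    \<open>a^k b^l\<close> modulo \<open>F\<close>.\<close>
  interpret Q: comm_group "G Mod F"
  proof (rule pi.H.group_comm_groupI)
    fix X Y assume "X \<in> carrier (G Mod F)" "Y \<in> carrier (G Mod F)"
    then obtain x y where xy: "x \<in> carrier G" "y \<in> carrier G" "X = F #> x" "Y = F #> y"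
      by (auto simp: carrier_FactGroup)
    have "X \<otimes>\<^bsub>G Mod F\<^esub> Y = F #> (x \<otimes> y)" "Y \<otimes>\<^bsub>G Mod F\<^esub> X = F #> (y \<otimes> x)"
      using xy by (simp_all del: mult_FactGroup)
    then show "X \<otimes>\<^bsub>G Mod F\<^esub> Y = Y \<otimes>\<^bsub>G Mod F\<^esub> X"
      using swap[OF xy(1,2)] by (simp only:)
  qed
  let ?A = "{x \<in> carrier G. \<exists>(k :: nat) (l :: nat). F #> x = F #> (a [^] k \<otimes> b [^] l)}"
  have "subgroup ?A G"
  proof (rule subgroup_of_finite_order[OF _ _ _ finite_carrier])
    have "F #> \<one> = F #> (a [^] (0 :: nat) \<otimes> b [^] (0 :: nat))" by simp
    then show "\<one> \<in> ?A" by blast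
    fix x y assume "x \<in> ?A" "y \<in> ?A"
    then obtain k l k' l' :: nat where xy: "x \<in> carrier G" "y \<in> carrier G"
      "F #> x = F #> (a [^] k \<otimes> b [^] l)" "F #> y = F #> (a [^] k' \<otimes> b [^] l')" by blast
    have "F #> (x \<otimes> y) = (F #> x) \<otimes>\<^bsub>G Mod F\<^esub> (F #> y)"
      using xy by (simp del: mult_FactGroup)
    also have "\<dots> = ((F #> a [^] k) \<otimes>\<^bsub>G Mod F\<^esub> (F #> b [^] l)) \<otimes>\<^bsub>G Mod F\<^esub> ((F #> a [^] k') \<otimes>\<^bsub>G Mod F\<^esub> (F #> b [^] l'))"
      using ab by (simp add: xy(3,4) del: mult_FactGroup)
    also have "\<dots> = ((F #> a [^] k) \<otimes>\<^bsub>G Mod F\<^esub> (F #> a [^] k')) \<otimes>\<^bsub>G Mod F\<^esub> ((F #> b [^] l) \<otimes>\<^bsub>G Mod F\<^esub> (F #> b [^] l'))"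
      using ab by (simp add: Q.m_ac del: mult_FactGroup)
    also have "\<dots> = F #> (a [^] (k + k') \<otimes> b [^] (l + l'))"
      using ab by (simp del: mult_FactGroup pi.hom_mult add: pi.hom_mult[symmetric] nat_pow_mult)
    finally show "x \<otimes> y \<in> ?A" using xy(1,2) by blast
  qed auto
  moreover have "a \<in> ?A" "b \<in> ?A"
  proof -
    have "F #> a = F #> (a [^] (1 :: nat) \<otimes> b [^] (0 :: nat))" "F #> b = F #> (a [^] (0 :: nat) \<otimes> b [^] (1 :: nat))"
      using ab by simp_all
    then show "a \<in> ?A" "b \<in> ?A" using ab by blast+
  qed
  ultimately have "generate G {a, b} \<subseteq> ?A"
    by (intro generate_subgroup_incl) blast+
  then have "carrier G \<subseteq> ?A" unfolding ab(3) .
  with uG obtain k l :: nat where kl: "F #> u = F #> (a [^] k \<otimes> b [^] l)" by blast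
  have p_power: "x [^] j \<in> F" if "p dvd j" "x \<in> carrier G" for x and j :: nat
  proof -
    from that(1) obtain d where "j = p * d" by blast
    then have "x [^] j = (x [^] p) [^] d" using that by (simp add: nat_pow_pow)
    moreover have "x [^] p \<in> F" unfolding F_def by (rule power_in_power_subgroup[OF that(2)])
    ultimately show ?thesis using subgroup_nat_pow_closed[OF F.subgroup_axioms] by simp
  qed
  \<comment> \<open>Otherwise \<open>u\<close> would be a product of \<open>p\<close>-th powers
    modulo \<open>F\<close>, hence in \<open>F\<close>. So \<open>u\<close> can replace
    \<open>a\<close> or \<open>b\<close> as a generator modulo \<open>F\<close>, and
    \<open>powers_are_nongenerators\<close> lifts this to \<open>G\<close>.\<close>
  have kl_p: "\<not> p dvd k \<or> \<not> p dvd l"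
  proof (rule ccontr)
    assume "\<not> ?thesis"
    then have "a [^] k \<otimes> b [^] l \<in> F" using p_power ab by simp
    then have "F #> u = F" using kl coset_join2[OF _ F.subgroup_axioms] F.subset by auto
    then show False using u(2) uG coset_join1[OF _ uG F.subgroup_axioms] by blast
  qed
  have in_C: "a [^] k \<otimes> b [^] l \<in> C" if "subgroup C G" "u \<in> C" "F \<subseteq> C" for C
  proof -
    have "inv u \<otimes> (a [^] k \<otimes> b [^] l) \<in> F"
      using kl[symmetric] F.coset_eq_iff[of "a [^] k \<otimes> b [^] l" u] ab uG by simp
    then have "u \<otimes> (inv u \<otimes> (a [^] k \<otimes> b [^] l)) \<in> C"
      using that subgroup.m_closed[OF that(1)] by blast
    then show ?thesis using ab uG by (simp flip: m_assoc)
  qed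
  have "\<exists>v \<in> carrier G. generate G {u, v} = carrier G"
  proof (cases "p dvd k")
    case False
    have "generate G {u, b} = carrier G"
    proof (rule powers_are_nongenerators)
      show "subgroup (generate G {u, b}) G" using uG ab by (intro generate_is_subgroup) auto
      fix C assume C: "subgroup C G" "generate G {u, b} \<subseteq> C" "power_subgroup G (carrier G) p \<subseteq> C"
      have ub: "u \<in> C" "b \<in> C" using C(2) generate.incl[of _ "{u, b}" G] by auto
      then have "a [^] k \<otimes> b [^] l \<otimes> inv (b [^] l) \<in> C"
        using in_C[OF C(1)] C(3) subgroup_nat_pow_closed[OF C(1)]
        unfolding F_def by (meson C(1) subgroup.m_closed subgroup.m_inv_closed)
      then have "a [^] k \<in> C" using ab by (simp add: m_assoc)
      then have "a \<in> C" by (rule subgroup_pow_unit[OF C(1) ab(1) False])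
      then have "generate G {a, b} \<subseteq> C" using generate_subgroup_incl[OF _ C(1)] ub by simp
      then show "C = carrier G" using ab(3) subgroup.subset[OF C(1)] by simp
    qed
    then show ?thesis using ab by blast
  next
    case True
    then have l: "\<not> p dvd l" using kl_p by blast
    have "generate G {u, a} = carrier G"
    proof (rule powers_are_nongenerators)
      show "subgroup (generate G {u, a}) G" using uG ab by (intro generate_is_subgroup) auto
      fix C assume C: "subgroup C G" "generate G {u, a} \<subseteq> C" "power_subgroup G (carrier G) p \<subseteq> C"
      have ub: "u \<in> C" "a \<in> C" using C(2) generate.incl[of _ "{u, a}" G] by auto
      then have "inv (a [^] k) \<otimes> (a [^] k \<otimes> b [^] l) \<in> C"
        using in_C[OF C(1)] C(3) subgroup_nat_pow_closed[OF C(1)]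
        unfolding F_def by (meson C(1) subgroup.m_closed subgroup.m_inv_closed)
      then have "b [^] l \<in> C" using ab by (simp flip: m_assoc)
      then have "b \<in> C" by (rule subgroup_pow_unit[OF C(1) ab(2) l])
      then have "generate G {a, b} \<subseteq> C" using generate_subgroup_incl[OF _ C(1)] ub by simp
      then show "C = carrier G" using ab(3) subgroup.subset[OF C(1)] by simp
    qed
    then show ?thesis using ab by blast
  qed
  then obtain v where v: "v \<in> carrier G" "generate G {u, v} = carrier G" by blast
  show ?thesis
    using commutators_in_normal_pair[OF finite_carrier M_normal uG v u_comm[OF v(1)] xy]
    unfolding F_def .
qed

end

section \<open>The classification\<close>

lemma group_rank_two_imp_generators:
  assumes "group G" "finite (carrier G)" "group_rank G = 2"
  obtains a b where "a \<in> carrier G" "b \<in> carrier G" "generate G {a, b} = carrier G"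
proof -
  interpret group G by fact
  let ?P = "\<lambda>k. \<exists>S \<subseteq> carrier G. finite S \<and> card S = k \<and> generate G S = carrier G"
  have "generate G (carrier G) = carrier G"
    using generate_incl[of "carrier G"] generate.incl[of _ "carrier G" G] by blast
  then have "?P (card (carrier G))" using assms(2) by blast
  then have "?P (group_rank G)" unfolding group_rank_def by (rule LeastI)
  then obtain S where "S \<subseteq> carrier G" "card S = 2" "generate G S = carrier G"
    using assms(3) by auto
  then show ?thesis using that by (auto simp: card_2_iff)
qed

lemma powerfully_nilpotent_iso_listed_group:
  assumes p: "Factorial_Ring.prime p" and G: "powerfully_nilpotent p G"
    and nc: "\<not> comm_group G" and rank: "group_rank G = 2"
  obtains i where "i \<in> param_list" "G \<cong> listed_group p i"
proof -
  obtain E H N where chain: "central_chain G p E H N"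
    and H: "\<And>i x y. 1 \<le> i \<Longrightarrow> i \<le> N \<Longrightarrow> x \<in> H i \<Longrightarrow> y \<in> carrier G \<Longrightarrow>
      commutator G x y \<in> power_subgroup G (H (i - 1)) p"
    by (rule powerfully_nilpotent_central_chain[OF p G]) blast
  interpret central_chain G p E H N by (rule chain)
  have not_all_commute: "\<exists>x \<in> carrier G. \<exists>y \<in> carrier G. x \<otimes>\<^bsub>G\<^esub> y \<noteq> y \<otimes>\<^bsub>G\<^esub> x"
    using nc group_comm_groupI by blast
  obtain a b where ab: "a \<in> carrier G" "b \<in> carrier G" "generate G {a, b} = carrier G"
    by (rule group_rank_two_imp_generators[OF is_group finite_carrier rank])
  have nontrivial: "carrier G \<noteq> {\<one>\<^bsub>G\<^esub>}" using not_all_commute by auto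
  have powerful: "powerful p G" using G by (simp add: powerfully_nilpotent_def)
  have comm: "commutator G x y \<in> power_subgroup G (power_subgroup G (carrier G) p) p"
    if "x \<in> carrier G" "y \<in> carrier G" for x y
    by (rule commutators_in_double_power_subgroup[OF ab nontrivial
          powerful_commutator_in_power_subgroup[OF powerful] H that])
  obtain g h s k where gh: "g \<in> carrier G" "h \<in> carrier G" "generate G {g, h} = carrier G"
    and "k \<in> {\<one>\<^bsub>G\<^esub>}" "commutator G g h = g [^]\<^bsub>G\<^esub> (p ^ 2 * s) \<otimes>\<^bsub>G\<^esub> k"
    using metacyclic_modulo[OF ab comm one_is_normal] by blast
  then have gh_comm: "commutator G g h = g [^]\<^bsub>G\<^esub> (p ^ 2 * s)" by simp
  then have twist: "g \<otimes>\<^bsub>G\<^esub> h = h \<otimes>\<^bsub>G\<^esub> g [^]\<^bsub>G\<^esub> (1 + p ^ 2 * s)"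
    using relation_iff_commutator[OF gh(1,2)] by blast
  have "g \<otimes>\<^bsub>G\<^esub> h \<noteq> h \<otimes>\<^bsub>G\<^esub> g"
  proof
    assume "g \<otimes>\<^bsub>G\<^esub> h = h \<otimes>\<^bsub>G\<^esub> g"
    then have "commutator G g h \<in> {\<one>\<^bsub>G\<^esub>}" using gh by (simp add: commutator_eq_one_iff)
    then have "commutator G x y = \<one>\<^bsub>G\<^esub>" if "x \<in> carrier G" "y \<in> carrier G" for x y
      using commutators_in_normal_pair[OF finite_carrier one_is_normal gh] that by blast
    then show False using not_all_commute commutator_eq_one_iff by blast
  qed
  then obtain c d n m l r where "powerful_pair G c d p n m l r"
    by (rule metacyclic_powerful_pair[OF gh twist])
  then have "G \<cong> listed_group p (params_of n m l r)" "canonical n m l r"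
    by (rule powerful_pair.iso_listed_group, rule powerful_pair.canonical)
  then show ?thesis using that param_list_eq by blast
qed

text \<open>Transporting the generators along the isomorphism gives one group two canonical
  parameter tuples, which \<open>powerful_pair_unique\<close> identifies.\<close>

lemma listed_groups_not_iso:
  assumes p: "Factorial_Ring.prime p" and ij: "i \<in> param_list" "j \<in> param_list"
    and iso: "listed_group p i \<cong> listed_group p j"
  shows "i = j"
proof -
  obtain n m l r where i: "i = params_of n m l r" and c: "canonical n m l r"
    using ij(1) unfolding param_list_eq by blast
  obtain n' m' l' r' where j: "j = params_of n' m' l' r'" and c': "canonical n' m' l' r'"
    using ij(2) unfolding param_list_eq by blast
  obtain a b where A: "powerful_pair (listed_group p i) a b p n m l r"
    unfolding i by (rule listed_group_powerful_pair[OF p c])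
  obtain c d where C: "powerful_pair (listed_group p j) c d p n' m' l' r'"
    unfolding j by (rule listed_group_powerful_pair[OF p c'])
  interpret A: powerful_pair "listed_group p i" a b p n m l r by (rule A)
  interpret C: powerful_pair "listed_group p j" c d p n' m' l' r' by (rule C)
  obtain a' b' where "powerful_pair (listed_group p j) a' b' p n m l r"
    by (rule A.iso_powerful_pair[OF iso C.is_group])
  from powerful_pair_unique[OF this C] show ?thesis by (simp add: i j)
qed

theorem mainTheorem1:
  fixes p :: nat
  assumes "Factorial_Ring.prime p"
  shows
    "(\<forall>i \<in> param_list.
        Coset.order (listed_group p i) = listed_order p i \<and>
        powerfully_nilpotent p (listed_group p i) \<and>
        \<not> comm_group (listed_group p i) \<and>
        group_rank (listed_group p i) = 2) \<and>
     (\<forall>i \<in> param_list. \<forall>j \<in> param_list. i \<noteq> j \<longrightarrow> \<not> listed_group p i \<cong> listed_group p j) \<and>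
     (\<forall>G :: ('a, 'b) monoid_scheme.
        powerfully_nilpotent p G \<and> \<not> comm_group G \<and> group_rank G = 2 \<longrightarrow>
        (\<exists>!i. i \<in> param_list \<and> G \<cong> listed_group p i))"
proof (intro conjI ballI allI impI)
  fix i assume "i \<in> param_list"
  then obtain n m l r where i: "i = params_of n m l r" and c: "canonical n m l r"
    unfolding param_list_eq by blast
  obtain a b where "powerful_pair (listed_group p i) a b p n m l r"
    unfolding i by (rule listed_group_powerful_pair[OF assms c])
  then interpret powerful_pair "listed_group p i" a b p n m l r .
  show "Coset.order (listed_group p i) = listed_order p i"
    using order by (simp add: i listed_order_params_of)
  show "powerfully_nilpotent p (listed_group p i)" by (rule is_powerfully_nilpotent)
  show "\<not> comm_group (listed_group p i)" by (rule not_commutative)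
  show "group_rank (listed_group p i) = 2"
    by (rule group_rank_two_generators[OF is_group a b gen not_commutative])
next
  fix i j assume "i \<in> param_list" "j \<in> param_list" "i \<noteq> j"
  then show "\<not> listed_group p i \<cong> listed_group p j"
    using listed_groups_not_iso[OF assms] by blast
next
  fix G :: "('a, 'b) monoid_scheme"
  assume G: "powerfully_nilpotent p G \<and> \<not> comm_group G \<and> group_rank G = 2"
  then interpret group G by (simp add: powerfully_nilpotent_def powerful_def p_group_def)
  obtain i where i: "i \<in> param_list" "G \<cong> listed_group p i"
    using powerfully_nilpotent_iso_listed_group[OF assms] G by blast
  show "\<exists>!i. i \<in> param_list \<and> G \<cong> listed_group p i"
  proof (rule ex1I[of _ i])
    fix j assume j: "j \<in> param_list \<and> G \<cong> listed_group p j"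
    then have "listed_group p j \<cong> listed_group p i"
      using iso_sym iso_trans i(2) by blast
    then show "j = i" using listed_groups_not_iso[OF assms _ i(1)] j by blast
  qed (use i in simp)
qed

end
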